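(* Let $F=\mathbb F_q(\mathcal X)$ be the function field of the Kummer curve $\mathcal X$ described in the context, with the places $Q_0,Q_1,\dots,Q_n$ and $R_1,\dots,R_N$ described there. Let $D=\sum_{k=1}^NR_k$ and let $E=\sum_{k=0}^n\alpha_kQ_k$ (with $\alpha_k\in\mathbb Z$) be a non-special divisor of degree $g-1$. For an integer $s$ with $\frac{g-1}{\lambda_0}<s<\frac{N+1-g}{\lambda_0}$, consider the divisors $$G=\sum_{k=1}^n\alpha_kQ_k+(\alpha_0+N-s\lambda_0)Q_0$$ and $$H=\sum_{k=1}^n(s\lambda_k+\alpha_k)Q_k+\alpha_0Q_0+\sum_{k=n+1}^{r}\frac{s\lambda_k}{\gcd(m,\lambda_k)}\sum_{Q\mid P_{a_k}}Q,$$ where the inner sum runs over all places $Q$ of $F$ lying over the place $P_{a_k}$ of $\mathbb F_q(x)$ corresponding to $a_k$. Then $(C_{\mathcal L}(D,G),C_{\mathcal L}(D,H))$ is a linear complementary pair of algebraic geometry codes with parameters (length and dimension) $$[N,\,N-s\lambda_0]\quad\text{and}\quad[N,\,s\lambda_0],$$ respectively.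
   Context: Let $\mathbb F_q$ be the finite field with $q$ elements, $m,r\ge2$ integers with $\operatorname{char}(\mathbb F_q)\nmid m$, $a_1,\dots,a_r\in\mathbb F_q$ pairwise distinct, and $1\le\lambda_k\le m-1$ for $1\le k\le r$, such that $\lambda_0:=\sum_{k=1}^r\lambda_k$ is coprime to $m$. Let $\mathcal X$ be the curve over $\mathbb F_q$ defined by $y^m=f(x)=\prod_{k=1}^r(x-a_k)^{\lambda_k}$, with function field $F=\mathbb F_q(\mathcal X)=\mathbb F_q(x,y)$ of genus $g\ge1$. Let $Q_0$ be the only place at infinity of $F$. For some $2\le n\le r$, assume the places of $\mathbb F_q(x)$ corresponding to $a_1,\dots,a_n$ are totally ramified in $F/\mathbb F_q(x)$, and let $Q_1,\dots,Q_n$ be the places of $F$ over them, respectively. Let $P_1,\dots,P_t$ be pairwise distinct rational places of $\mathbb F_q(x)$ that split completely in $F/\mathbb F_q(x)$, and let $R_1,\dots,R_N$ be all the $N=mt$ rational places of $F$ lying over $P_1,\dots,P_t$. A divisor $A$ of $F$ is non-special if $\ell(A)=\deg(A)+1-g$, where $\ell(A)=\dim_{\mathbb F_q}\mathcal L(A)$. If $D$ is a sum of $M$ distinct rational places $S_1,\dots,S_M$ and $A$ is a divisor with support disjoint from that of $D$, then $C_{\mathcal L}(D,A)=\{(z(S_1),\dots,z(S_M)):z\in\mathcal L(A)\}\subseteq\mathbb F_q^M$. A pair $(\mathcal C_1,\mathcal C_2)$ of linear codes in $\mathbb F_q^M$ is a linear complementary pair (LCP) if $\mathcal C_1\oplus\mathcal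 C_2=\mathbb F_q^M$. An $[M,k]$ code is a linear code of length $M$ and dimension $k$. *)

theory Defs
  imports
    "HOL-Analysis.Analysis"
    "HOL-Library.Poly_Mapping"
    "HOL-Computational_Algebra.Computational_Algebra"
begin

text \<open>
  A field extension is given by a homomorphism between two fields represented as types. In
  particular a function field over the constants \<open>'k\<close> is a type \<open>'f\<close> together with the embedding
  \<open>c :: 'k \<Rightarrow> 'f\<close> of the constants.
\<close>

definition field_embedding :: "('k::field \<Rightarrow> 'f::field) \<Rightarrow> bool" where
  "field_embedding h \<longleftrightarrow>
     h 1 = 1 \<and> (\<forall>u v. h (u + v) = h u + h v) \<and> (\<forall>u v. h (u * v) = h u * h v)"

definition is_subfield :: "'f::field set \<Rightarrow> bool" where
  "is_subfield S \<longleftrightarrow>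
     1 \<in> S \<and> (\<forall>u\<in>S. \<forall>v\<in>S. u - v \<in> S \<and> u * v \<in> S) \<and> (\<forall>u\<in>S. inverse u \<in> S)"

definition ext_degree :: "('k::field \<Rightarrow> 'f::field) \<Rightarrow> nat" where
  "ext_degree h = vector_space.dim (\<lambda>a z. h a * z) (UNIV :: 'f set)"


section \<open>Places\<close>

definition valuation_ring :: "('k::field \<Rightarrow> 'f::field) \<Rightarrow> 'f set \<Rightarrow> bool" where
  "valuation_ring c V \<longleftrightarrow>
     range c \<subset> V \<and> V \<subset> UNIV \<and>
     (\<forall>u\<in>V. \<forall>v\<in>V. u - v \<in> V \<and> u * v \<in> V) \<and>
     (\<forall>z. z \<in> V \<or> inverse z \<in> V)"

text \<open>A place is the maximal ideal, i.e. the set of non-units, of a valuation ring.\<close>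

definition places :: "('k::field \<Rightarrow> 'f::field) \<Rightarrow> 'f set set" where
  "places c = {P. \<exists>V. valuation_ring c V \<and> P = {z \<in> V. z = 0 \<or> inverse z \<notin> V}}"

text \<open>The valuation ring is recovered from its maximal ideal.\<close>

definition place_ring :: "'f::field set \<Rightarrow> 'f set" where
  "place_ring P = {z. z = 0 \<or> inverse z \<notin> P}"

text \<open>
  The discrete valuation of \<open>P\<close> on nonzero elements: \<open>z = t\<^sup>n u\<close> with \<open>t\<close> a generator of the
  ideal \<open>P\<close> and \<open>u\<close> a unit. The value at \<open>0\<close> (mathematically infinite) is never used.
\<close>

definition valuation :: "'f::field set \<Rightarrow> 'f \<Rightarrow> int" where
  "valuation P z = (THE n. \<exists>t u. P = (*) t ` place_ring P \<and>
      u \<noteq> 0 \<and> u \<in> place_ring P \<and> inverse u \<in> place_ring P \<and> z = t powi n * u)"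

text \<open>
  \<open>B\<close> represents a \<open>'k\<close>-basis of the residue class field \<open>place_ring P / P\<close>: every residue class is
  a linear combination of the classes of the elements of \<open>B\<close> in exactly one way.
\<close>

definition residue_basis :: "('k::field \<Rightarrow> 'f::field) \<Rightarrow> 'f set \<Rightarrow> 'f set \<Rightarrow> bool" where
  "residue_basis c P B \<longleftrightarrow>
     finite B \<and> B \<subseteq> place_ring P \<and>
     (\<forall>z\<in>place_ring P. \<exists>!u. (\<forall>b. b \<notin> B \<longrightarrow> u b = 0) \<and> z - (\<Sum>b\<in>B. c (u b) * b) \<in> P)"

definition place_degree :: "('k::field \<Rightarrow> 'f::field) \<Rightarrow> 'f set \<Rightarrow> nat" where
  "place_degree c P = (THE d. \<exists>B. residue_basis c P B \<and> card B = d)"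

text \<open>
  The residue class of \<open>z\<close> at a rational place \<open>P\<close> (for \<open>z \<in> place_ring P\<close>), identified with the
  unique constant it contains.
\<close>

definition place_value :: "('k::field \<Rightarrow> 'f::field) \<Rightarrow> 'f set \<Rightarrow> 'f \<Rightarrow> 'k" where
  "place_value c P z = (THE a. z - c a \<in> P)"


section \<open>Divisors\<close>

text \<open>Divisors are elements of the free abelian group on the places.\<close>

definition divisor :: "('k::field \<Rightarrow> 'f::field) \<Rightarrow> ('f set \<Rightarrow>\<^sub>0 int) \<Rightarrow> bool" where
  "divisor c A \<longleftrightarrow> Poly_Mapping.keys A \<subseteq> places c"

definition div_degree :: "('k::field \<Rightarrow> 'f::field) \<Rightarrow> ('f set \<Rightarrow>\<^sub>0 int) \<Rightarrow> int" where
  "div_degree c A =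
     (\<Sum>P\<in>Poly_Mapping.keys A. Poly_Mapping.lookup A P * int (place_degree c P))"

definition RR_space :: "('k::field \<Rightarrow> 'f::field) \<Rightarrow> ('f set \<Rightarrow>\<^sub>0 int) \<Rightarrow> 'f set" where
  "RR_space c A = {z. z = 0 \<or> (\<forall>P\<in>places c. valuation P z \<ge> - Poly_Mapping.lookup A P)}"

definition ell :: "('k::field \<Rightarrow> 'f::field) \<Rightarrow> ('f set \<Rightarrow>\<^sub>0 int) \<Rightarrow> nat" where
  "ell c A = vector_space.dim (\<lambda>a z. c a * z) (RR_space c A)"

definition genus :: "('k::field \<Rightarrow> 'f::field) \<Rightarrow> int" where
  "genus c = (GREATEST g. \<exists>A. divisor c A \<and> g = div_degree c A - int (ell c A) + 1)"

definition non_special :: "('k::field \<Rightarrow> 'f::field) \<Rightarrow> ('f set \<Rightarrow>\<^sub>0 int) \<Rightarrow> bool" where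
  "non_special c A \<longleftrightarrow> divisor c A \<and> int (ell c A) = div_degree c A + 1 - genus c"


section \<open>Extensions of function fields\<close>

text \<open>
  Here \<open>h :: 'e \<Rightarrow> 'f\<close> embeds a function field with constants \<open>c :: 'k \<Rightarrow> 'e\<close> into a function field
  with constants \<open>h \<circ> c\<close>.
\<close>

definition places_over ::
    "('k::field \<Rightarrow> 'e::field) \<Rightarrow> ('e \<Rightarrow> 'f::field) \<Rightarrow> 'e set \<Rightarrow> 'f set set" where
  "places_over c h P = {Q \<in> places (h \<circ> c). h ` P \<subseteq> Q}"

definition ram_index :: "('e::field \<Rightarrow> 'f::field) \<Rightarrow> 'e set \<Rightarrow> 'f set \<Rightarrow> nat" where
  "ram_index h P Q = (THE e. \<forall>z. z \<noteq> 0 \<longrightarrow> valuation Q (h z) = int e * valuation P z)"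

definition totally_ramified ::
    "('k::field \<Rightarrow> 'e::field) \<Rightarrow> ('e \<Rightarrow> 'f::field) \<Rightarrow> 'e set \<Rightarrow> bool" where
  "totally_ramified c h P \<longleftrightarrow> (\<exists>Q\<in>places_over c h P. ram_index h P Q = ext_degree h)"

definition splits_completely ::
    "('k::field \<Rightarrow> 'e::field) \<Rightarrow> ('e \<Rightarrow> 'f::field) \<Rightarrow> 'e set \<Rightarrow> bool" where
  "splits_completely c h P \<longleftrightarrow>
     finite (places_over c h P) \<and> card (places_over c h P) = ext_degree h"


section \<open>The rational function field\<close>

text \<open>The rational function field over \<open>'k\<close> is \<open>'k poly fract\<close>.\<close>

definition ratfun_const :: "'k::field \<Rightarrow> 'k poly fract" where
  "ratfun_const a = to_fract [:a:]"

definition zero_place :: "'k::field \<Rightarrow> 'k poly fract set" where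
  "zero_place a = {Fract p q | p q. [:- a, 1:] dvd p \<and> \<not> [:- a, 1:] dvd q}"

definition infinite_place :: "'k::field poly fract set" where
  "infinite_place = {Fract p q | p q. degree p < degree q}"


section \<open>Codes\<close>

text \<open>
  Words of length \<open>M\<close> are elements of \<open>'k ^ 'n\<close> with \<open>CARD('n) = M\<close>.
\<close>

definition linear_code :: "('k::field ^ 'n) set \<Rightarrow> nat \<Rightarrow> int \<Rightarrow> bool" where
  "linear_code C M k \<longleftrightarrow> vec.subspace C \<and> CARD('n) = M \<and> int (vec.dim C) = k"

definition linear_complementary_pair :: "('k::field ^ 'n) set \<Rightarrow> ('k ^ 'n) set \<Rightarrow> bool" where
  "linear_complementary_pair C1 C2 \<longleftrightarrow>
     vec.subspace C1 \<and> vec.subspace C2 \<and>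
     {u + v | u v. u \<in> C1 \<and> v \<in> C2} = UNIV \<and> C1 \<inter> C2 = {0}"

text \<open>
  The code of the divisors \<open>(\<Sum>i. S i)\<close> and \<open>A\<close>. The enumeration \<open>S\<close> fixes the order of the
  coordinates. Only meaningful if the two divisors have disjoint supports.
\<close>

definition AG_code ::
    "('k::field \<Rightarrow> 'f::field) \<Rightarrow> ('n \<Rightarrow> 'f set) \<Rightarrow> ('f set \<Rightarrow>\<^sub>0 int) \<Rightarrow> ('k ^ 'n) set" where
  "AG_code c S A = {(\<chi> i. place_value c (S i) z) | z. z \<in> RR_space c A}"

end

theory Submission
  imports Defs
begin

text \<open>
  The functions \<open>y\<close> and \<open>w = \<Prod>\<^sub>j (x - b\<^sub>j)\<close>, where \<open>x = b\<^sub>1, \<dots>, x = b\<^sub>t\<close> are the completely split places, have the divisors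
  \<open>(y) = Z - \<lambda>\<^sub>0 Q\<^sub>0\<close> and \<open>(w) = D - N Q\<^sub>0\<close>, where \<open>Z\<close> is the sum of \<open>\<lambda>\<^sub>k / gcd m \<lambda>\<^sub>k\<close> times the places over \<open>a\<^sub>k\<close>. So
  \<open>H = E + s Z\<close> and \<open>G = E + (N - s \<lambda>\<^sub>0) Q\<^sub>0\<close>, and with \<open>h = y\<^sup>s / w\<close> the divisor \<open>max G H - D\<close> is \<open>E + (h)\<close>, whereas
  \<open>min G H = E\<close>. A pair of functions in \<open>L(G)\<close> and \<open>L(H)\<close> with equal values on \<open>D\<close> thus gives an element of
  \<open>L(E + (h))\<close>, a space isomorphic to \<open>L(E) = 0\<close>. Evaluation is therefore injective, and the codes intersect trivially
  (\<open>complementary_codes\<close>). As \<open>deg G + 1 - g = N - s \<lambda>\<^sub>0\<close> and \<open>deg H + 1 - g = s \<lambda>\<^sub>0\<close> add up to \<open>N\<close>, Riemann's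
  inequality does the rest.

  The inequality requires that the genus exists, that is, Riemann's theorem, and that all places are discrete and of finite
  degree. Because the field of constants is finite, these facts follow from counting. The basic estimate is
  \<open>card_incongruent_le\<close>: if \<open>V\<close> is a ring in \<open>F\<close> that contains the polynomial \<open>w\<close> in \<open>x\<close>, then \<open>V / w V\<close> has at most
  \<open>q ^ (m deg w)\<close> elements, since expansions in powers of \<open>w\<close> are distinct and there are few elements of bounded degree.
  For the valuation ring of a single place this shows that the place is discrete with finite residue field
  (\<open>fin_uniformized_residues\<close>). For an intersection of valuation rings, together with weak approximation, it shows
  that the zeros of \<open>w\<close> have total degree at most \<open>m deg w\<close> (\<open>degree_zeros_le\<close>). At infinity, orders can be computed
  from degrees, because \<open>deg f\<close> and \<open>m\<close> are coprime. The monomials \<open>x\<^sup>i y\<^sup>j\<close> then show that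
  \<open>L(l Q\<^sub>0)\<close> is large enough (\<open>ell_Q0_ge\<close>), and a shift by a polynomial reduces an arbitrary divisor to this case
  (\<open>riemann_bound\<close>). The spaces \<open>L(A)\<close> are finite because a function without poles that vanishes at infinity is
  \<open>0\<close>; this uses Chevalley's theorem on the existence of places (\<open>ex_pole\<close>). Comparing dimensions for
  multiples of \<open>Q\<^sub>0\<close> shows that the zeros of \<open>w\<close> have total degree exactly \<open>m deg w\<close> (\<open>degree_zeros\<close>).

  The degree of \<open>H\<close> requires the ramification over the roots of \<open>f\<close>. With \<open>d = gcd m \<lambda>\<^sub>k\<close>, the function
  \<open>y\<^sup>m\<^sup>/\<^sup>d\<close> is a power of \<open>x - a\<^sub>k\<close> times a \<open>d\<close>-th root \<open>u\<close> of a polynomial without zero at \<open>a\<^sub>k\<close>. As \<open>d\<close> is prime to the characteristic,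
  \<open>K(x, u)\<close> is unramified over \<open>a\<^sub>k\<close> (\<open>Kxu_unramified\<close>), and \<open>y\<close> generates a totally ramified extension of degree \<open>m/d\<close>
  (\<open>kummer_valuations\<close>). So the ramification index is \<open>m/d\<close> and the places over \<open>a\<^sub>k\<close> have total degree \<open>d\<close>.
\<close>

abbreviation lookup :: "('a \<Rightarrow>\<^sub>0 int) \<Rightarrow> 'a \<Rightarrow> int" where
  "lookup \<equiv> Poly_Mapping.lookup"

section \<open>Valuation rings with a uniformizer\<close>

locale ring_in_field =
  fixes V :: "'f::field set"
  assumes one_mem: "1 \<in> V"
    and diff_mem: "u \<in> V \<Longrightarrow> v \<in> V \<Longrightarrow> u - v \<in> V"
    and mult_mem: "u \<in> V \<Longrightarrow> v \<in> V \<Longrightarrow> u * v \<in> V"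
begin

lemma zero_mem: "0 \<in> V"
  using diff_mem[OF one_mem one_mem] by simp

lemma minus_mem: "u \<in> V \<Longrightarrow> - u \<in> V"
  using diff_mem[OF zero_mem] by simp

lemma add_mem: "u \<in> V \<Longrightarrow> v \<in> V \<Longrightarrow> u + v \<in> V"
  using diff_mem[OF _ minus_mem] by force

lemma power_mem: "u \<in> V \<Longrightarrow> u ^ n \<in> V"
  by (induction n) (auto intro: one_mem mult_mem)

lemma sum_mem: "(\<And>i. i \<in> I \<Longrightarrow> h i \<in> V) \<Longrightarrow> sum h I \<in> V"
  by (induction I rule: infinite_finite_induct) (auto intro: zero_mem add_mem)

end

definition nonunits :: "'f::field set \<Rightarrow> 'f set" where
  "nonunits V = {z \<in> V. z = 0 \<or> inverse z \<notin> V}"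

definition unit_in :: "'f::field set \<Rightarrow> 'f \<Rightarrow> bool" where
  "unit_in V u \<longleftrightarrow> u \<noteq> 0 \<and> u \<in> V \<and> inverse u \<in> V"

locale total_ring = ring_in_field +
  assumes total: "z \<in> V \<or> inverse z \<in> V"
begin

lemma unit_mult: "unit_in V u \<Longrightarrow> unit_in V w \<Longrightarrow> unit_in V (u * w)"
  by (auto simp: unit_in_def intro: mult_mem)

lemma unit_inverse: "unit_in V u \<Longrightarrow> unit_in V (inverse u)"
  by (auto simp: unit_in_def)

lemma unit_one: "unit_in V 1"
  by (auto simp: unit_in_def one_mem)

lemma unit_power: "unit_in V u \<Longrightarrow> unit_in V (u ^ n)"
  by (induction n) (auto intro: unit_one unit_mult)

lemma unit_or_nonunit: "z \<in> V \<Longrightarrow> unit_in V z \<or> z \<in> nonunits V"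
  by (auto simp: unit_in_def nonunits_def)

lemma not_unit_nonunit: "z \<in> nonunits V \<Longrightarrow> \<not> unit_in V z"
  by (auto simp: unit_in_def nonunits_def)

lemma notin_imp_inverse: "z \<notin> V \<Longrightarrow> inverse z \<in> nonunits V"
  using total[of z] by (auto simp: nonunits_def)

lemma nonunits_mult: assumes "z \<in> nonunits V" "w \<in> V" shows "z * w \<in> nonunits V"
proof (rule ccontr)
  assume H: "z * w \<notin> nonunits V"
  have "z * w \<in> V" using assms by (auto simp: nonunits_def intro: mult_mem)
  with H have "unit_in V (z * w)" using unit_or_nonunit by blast
  then have "z \<noteq> 0" "w * inverse (z * w) \<in> V" using assms by (auto simp: unit_in_def intro: mult_mem)
  moreover have "w * inverse (z * w) = inverse z"
    using \<open>unit_in V (z * w)\<close> by (auto simp: unit_in_def)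
  ultimately have "z \<noteq> 0" "inverse z \<in> V" by (auto simp only:)
  then show False using assms by (auto simp: nonunits_def)
qed

lemma zero_nonunit: "0 \<in> nonunits V"
  by (auto simp: nonunits_def zero_mem)

lemma one_not_nonunit: "1 \<notin> nonunits V"
  by (auto simp: nonunits_def one_mem)

text \<open>Of two elements one divides the other, so their sum is a multiple of one of them.\<close>

lemma nonunits_add: assumes "z \<in> nonunits V" "w \<in> nonunits V" shows "z + w \<in> nonunits V"
proof -
  have *: "z + w \<in> nonunits V"
    if "z \<in> nonunits V" "w \<in> nonunits V" "z * inverse w \<in> V" "w \<noteq> 0" for z w
  proof -
    have "w * (z * inverse w + 1) \<in> nonunits V"
      using that by (intro nonunits_mult add_mem one_mem) 
    moreover have "w * (z * inverse w + 1) = z + w" using that by (simp add: distrib_left)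
    ultimately show ?thesis by simp
  qed
  show ?thesis
  proof (cases "z = 0 \<or> w = 0")
    case True
    then show ?thesis using assms by auto
  next
    case False
    then consider "z * inverse w \<in> V" | "w * inverse z \<in> V"
      using total[of "z * inverse w"] by (auto simp: inverse_mult_distrib mult.commute)
    then show ?thesis
      using *[of z w] *[of w z] assms False by cases (auto simp: add.commute)
  qed
qed

lemma nonunits_minus: "z \<in> nonunits V \<Longrightarrow> - z \<in> nonunits V"
  using nonunits_mult[of z "-1"] minus_mem[OF one_mem] by auto

lemma nonunits_diff: "z \<in> nonunits V \<Longrightarrow> w \<in> nonunits V \<Longrightarrow> z - w \<in> nonunits V"
  using nonunits_add[OF _ nonunits_minus] by force

lemma unit_add_nonunit: assumes "unit_in V u" "z \<in> nonunits V" shows "unit_in V (u + z)"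
proof (rule ccontr)
  assume "\<not> ?thesis"
  moreover have "u + z \<in> V" using assms by (auto simp: unit_in_def nonunits_def intro: add_mem)
  ultimately have "u + z \<in> nonunits V" using unit_or_nonunit by blast
  from nonunits_diff[OF this assms(2)] show False using assms not_unit_nonunit by auto
qed

lemma unit_minus: "unit_in V u \<Longrightarrow> unit_in V (- u)"
  by (auto simp: unit_in_def inverse_minus_eq intro: minus_mem)

text \<open>
  If \<open>z\<close> were outside \<open>V\<close>, then \<open>inverse z\<close> and all its powers would be nonunits.
\<close>

lemma root_mem: assumes "z ^ n \<in> V" "n > 0" shows "z \<in> V"
proof (rule ccontr)
  assume z: "z \<notin> V"
  then have i: "inverse z \<in> nonunits V" and z0: "z \<noteq> 0" using notin_imp_inverse zero_mem by auto
  have "inverse z * inverse z ^ (n - 1) \<in> nonunits V"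
    using i by (intro nonunits_mult power_mem) (auto simp: nonunits_def)
  then have "inverse z ^ n \<in> nonunits V"
    using assms(2) by (metis power_eq_if not_gr_zero)
  then show False using assms(1) z0 by (auto simp: nonunits_def power_inverse)
qed

lemma root_unit: assumes "unit_in V (z ^ n)" "n > 0" shows "unit_in V z"
  using assms root_mem[of z n] root_mem[of "inverse z" n] by (auto simp: unit_in_def power_inverse)

lemma root_nonunit: assumes "z ^ n \<in> nonunits V" "n > 0" shows "z \<in> nonunits V"
proof -
  have "z \<in> V" using assms root_mem by (auto simp: nonunits_def)
  then show ?thesis using unit_or_nonunit unit_power[of z n] not_unit_nonunit assms by blast
qed

lemma power_nonunit: assumes "z \<in> nonunits V" "n > 0" shows "z ^ n \<in> nonunits V"
  using root_unit[of z n] assms not_unit_nonunit unit_or_nonunit[of "z ^ n"] power_mem[of z n]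
  by (auto simp: nonunits_def)

text \<open>The elements outside \<open>V\<close> are the inverses of the nonzero nonunits.\<close>

lemma place_ring_nonunits: "place_ring (nonunits V) = V"
  using notin_imp_inverse zero_mem by (auto simp: place_ring_def nonunits_def)

end

subsection \<open>Orders with respect to a uniformizer\<close>

definition has_order :: "'f::field set \<Rightarrow> 'f \<Rightarrow> int \<Rightarrow> 'f \<Rightarrow> bool" where
  "has_order V t n z \<longleftrightarrow> (\<exists>u. unit_in V u \<and> z = t powi n * u)"

locale pre_uniformized = total_ring V for V :: "'f::field set" +
  fixes t :: 'f
  assumes t0: "t \<noteq> 0" and t_nonunit: "t \<in> nonunits V"
begin

lemma has_order_nonzero: "has_order V t n z \<Longrightarrow> z \<noteq> 0"
  using t0 by (auto simp: has_order_def unit_in_def)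

lemma has_order_unit: "unit_in V u \<Longrightarrow> has_order V t 0 u"
  by (auto simp: has_order_def)

lemma has_order_self: "has_order V t n (t powi n)"
  using unit_one by (auto simp: has_order_def intro!: exI[of _ 1])

lemma has_order_mult:
  "has_order V t n z \<Longrightarrow> has_order V t k w \<Longrightarrow> has_order V t (n + k) (z * w)"
  unfolding has_order_def
proof (elim exE conjE)
  fix u u' assume H: "unit_in V u" "z = t powi n * u" "unit_in V u'" "w = t powi k * u'"
  show "\<exists>v. unit_in V v \<and> z * w = t powi (n + k) * v"
    using H t0 unit_mult[OF H(1,3)] by (intro exI[of _ "u * u'"]) (auto simp: power_int_add)
qed

lemma has_order_inverse: "has_order V t n z \<Longrightarrow> has_order V t (- n) (inverse z)"
  unfolding has_order_def
proof (elim exE conjE)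
  fix u assume H: "unit_in V u" "z = t powi n * u"
  show "\<exists>v. unit_in V v \<and> inverse z = t powi (- n) * v"
    using H t0 unit_inverse[OF H(1)]
    by (intro exI[of _ "inverse u"]) (auto simp: power_int_minus)
qed

lemma has_order_power: "has_order V t n z \<Longrightarrow> has_order V t (int k * n) (z ^ k)"
proof (induction k)
  case 0
  then show ?case using has_order_unit[OF unit_one] by simp
next
  case (Suc k)
  then show ?case using has_order_mult[of n z "int k * n" "z ^ k"] by (simp add: algebra_simps)
qed

lemma powi_nonunit: assumes "n > 0" shows "t powi n \<in> nonunits V"
proof -
  have "t powi n = t ^ nat n" using assms by (auto simp: power_int_def)
  then show ?thesis using power_nonunit[OF t_nonunit, of "nat n"] assms by auto
qed

lemma has_order_pos: assumes "has_order V t n z" "n > 0" shows "z \<in> nonunits V"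
  using assms powi_nonunit by (auto simp: has_order_def unit_in_def intro: nonunits_mult)

lemma has_order_0: "has_order V t 0 z \<longleftrightarrow> unit_in V z"
  by (auto simp: has_order_def)

lemma has_order_unique: assumes "has_order V t n z" "has_order V t k z" shows "n = k"
proof -
  have "has_order V t (n - k) 1" if "has_order V t n z" "has_order V t k z" for n k
    using has_order_mult[OF that(1) has_order_inverse[OF that(2)]] has_order_nonzero[OF that(1)]
    by simp
  then have "\<not> n - k > 0" "\<not> k - n > 0" using assms has_order_pos one_not_nonunit by blast+
  then show ?thesis by simp
qed

lemma has_order_mem: assumes "has_order V t n z" shows "z \<in> V \<longleftrightarrow> n \<ge> 0"
proof
  assume "n \<ge> 0"
  then consider "n = 0" | "n > 0" by linarith
  then show "z \<in> V"
    using assms has_order_pos has_order_0 by cases (auto simp: nonunits_def unit_in_def)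
next
  assume z: "z \<in> V"
  show "n \<ge> 0"
  proof (rule ccontr)
    assume "\<not> n \<ge> 0"
    then have "inverse z \<in> nonunits V" using has_order_pos[OF has_order_inverse[OF assms]] by simp
    then show False using z has_order_nonzero[OF assms] by (auto simp: nonunits_def)
  qed
qed

lemma has_order_nonunit: assumes "has_order V t n z" shows "z \<in> nonunits V \<longleftrightarrow> n > 0"
  using has_order_mem[OF assms] has_order_pos[OF assms] not_unit_nonunit[of z] assms has_order_0[of z]
  by (cases "n = 0") (auto simp: nonunits_def)

lemma has_order_add: assumes "has_order V t n z" "has_order V t k w" "n < k"
  shows "has_order V t n (z + w)"
proof -
  have z0: "z \<noteq> 0" using has_order_nonzero assms by auto
  have "has_order V t (k - n) (w * inverse z)"
    using has_order_mult[OF assms(2) has_order_inverse[OF assms(1)]] by simp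
  then have "w * inverse z \<in> nonunits V" using has_order_pos assms by auto
  from unit_add_nonunit[OF unit_one this] have "has_order V t 0 (1 + w * inverse z)"
    using has_order_unit by blast
  moreover have "z * (1 + w * inverse z) = z + w" using z0 by (simp add: distrib_left)
  ultimately show ?thesis using has_order_mult[OF assms(1), of 0 "1 + w * inverse z"] by simp
qed

text \<open>The summand of smallest order dominates the others.\<close>

lemma has_order_sum:
  assumes "finite J" "J \<noteq> {}" "inj_on n J" "\<And>j. j \<in> J \<Longrightarrow> has_order V t (n j) (h j)"
  shows "has_order V t (Min (n ` J)) (sum h J)"
  using assms
proof (induction J rule: finite_ne_induct)
  case (singleton j)
  then show ?case by simp
next
  case (insert j J)
  have IH: "has_order V t (Min (n ` J)) (sum h J)" using insert by (auto simp: inj_on_def)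
  have j: "has_order V t (n j) (h j)" using insert by auto
  have "n j \<notin> n ` J" using insert.prems(1) insert.hyps(3) unfolding inj_on_def by blast
  have "Min (n ` J) \<in> n ` J" using insert.hyps by (intro Min_in) auto
  with \<open>n j \<notin> n ` J\<close> have ne: "n j \<noteq> Min (n ` J)" by force
  have "Min (n ` insert j J) = min (n j) (Min (n ` J))" using insert.hyps by simp
  then show ?case
    using has_order_add[OF j IH] has_order_add[OF IH j] ne
    unfolding sum.insert[OF insert.hyps(1,3)] min_def
    by (cases "n j < Min (n ` J)") (simp_all only: add.commute if_True if_False less_imp_le not_less order.strict_iff_order, simp_all)
qed

end

locale uniformized = pre_uniformized +
  assumes ex_order: "z \<noteq> 0 \<Longrightarrow> \<exists>n. has_order V t n z"
begin

lemma nonunits_eq: "nonunits V = (*) t ` V"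
proof
  show "nonunits V \<subseteq> (*) t ` V"
  proof
    fix z assume z: "z \<in> nonunits V"
    show "z \<in> (*) t ` V"
    proof (cases "z = 0")
      case True
      then show ?thesis using zero_mem by auto
    next
      case False
      then obtain n where n: "has_order V t n z" using ex_order by auto
      then have "n > 0" using z has_order_nonunit by auto
      moreover have "has_order V t (n + -1) (z * inverse t)"
        using has_order_mult[OF n has_order_inverse[OF has_order_self[of 1]]] by simp
      ultimately have "z * inverse t \<in> V" using has_order_mem by simp
      then show ?thesis using t0 by (auto simp: image_iff field_simps intro!: bexI[of _ "z * inverse t"])
    qed
  qed
  show "(*) t ` V \<subseteq> nonunits V" using nonunits_mult[OF t_nonunit] by auto
qed

text \<open>
  Two generators of the maximal ideal differ by a unit, so the exponent in the definition of
  \<open>valuation\<close> does not depend on the generator.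
\<close>

lemma valuation_eq: assumes "has_order V t n z" shows "valuation (nonunits V) z = n"
proof -
  have unitI: "(u \<noteq> 0 \<and> u \<in> V \<and> inverse u \<in> V) = unit_in V u" for u by (auto simp: unit_in_def)
  have "(\<exists>t u. nonunits V = (*) t ` V \<and> u \<noteq> 0 \<and> u \<in> V \<and> inverse u \<in> V \<and> z = t powi k * u) \<longleftrightarrow> k = n"
    for k
  proof
    assume "k = n"
    then show "\<exists>t u. nonunits V = (*) t ` V \<and> u \<noteq> 0 \<and> u \<in> V \<and> inverse u \<in> V \<and> z = t powi k * u"
      using assms nonunits_eq unfolding has_order_def unit_in_def by blast
  next
    assume "\<exists>t u. nonunits V = (*) t ` V \<and> u \<noteq> 0 \<and> u \<in> V \<and> inverse u \<in> V \<and> z = t powi k * u"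
    then obtain t' u where t': "nonunits V = (*) t' ` V" and u: "unit_in V u" "z = t' powi k * u"
      unfolding unit_in_def by auto
    have "t' \<noteq> 0" using t' t0 t_nonunit by auto
    have "t' \<in> nonunits V" using t' one_mem by force
    then obtain a where a: "a \<in> V" "t' = t * a" using nonunits_eq by auto
    obtain b where b: "b \<in> V" "t = t' * b" using t' t_nonunit by auto
    have "t * (a * b) = t' * b" by (simp add: a(2) mult.assoc)
    also have "\<dots> = t" using b(2) by (rule sym)
    finally have "a * b = 1" using t0 by simp
    then have ua: "unit_in V a"
      using a b unfolding unit_in_def by (metis inverse_unique mult_zero_left zero_neq_one)
    have "has_order V t 1 t'" using ua a by (auto simp: has_order_def)
    have "has_order V t k (t' powi k)"
    proof (cases "k \<ge> 0")
      case True
      then show ?thesis using has_order_power[OF \<open>has_order V t 1 t'\<close>, of "nat k"] by (simp add: power_int_def)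
    next
      case False
      then show ?thesis
        using has_order_inverse[OF has_order_power[OF \<open>has_order V t 1 t'\<close>, of "nat (- k)"]]
        by (simp add: power_int_def power_inverse)
    qed
    from has_order_mult[OF this has_order_unit[OF u(1)]] have "has_order V t k z" using u by simp
    then show "k = n" using assms has_order_unique by blast
  qed
  then show ?thesis unfolding valuation_def place_ring_nonunits by simp
qed

end

section \<open>Discrete places\<close>

locale discrete_place =
  fixes P :: "'f::field set"
  assumes ex_uniformized: "\<exists>t. uniformized (place_ring P) t"
    and nonunits_place_ring: "nonunits (place_ring P) = P"

text \<open>
  Counting \<open>0\<close> as having every order stands for its infinite valuation and makes the elements of
  order at least \<open>n\<close> a group.
\<close>

definition order_ge :: "'f::field set \<Rightarrow> int \<Rightarrow> 'f \<Rightarrow> bool" where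
  "order_ge P n z \<longleftrightarrow> z = 0 \<or> n \<le> valuation P z"

context discrete_place
begin

sublocale total_ring "place_ring P"
  using ex_uniformized by (auto simp: uniformized_def pre_uniformized_def)

lemma val_mult:
  assumes "z \<noteq> 0" "w \<noteq> 0" shows "valuation P (z * w) = valuation P z + valuation P w"
proof -
  obtain t where "uniformized (place_ring P) t" using ex_uniformized by blast
  then interpret uniformized "place_ring P" t .
  obtain n k where "has_order (place_ring P) t n z" "has_order (place_ring P) t k w"
    using ex_order assms by blast
  then show ?thesis using has_order_mult valuation_eq unfolding nonunits_place_ring by metis
qed

lemma val_ring: assumes "z \<noteq> 0" shows "z \<in> place_ring P \<longleftrightarrow> valuation P z \<ge> 0"
proof -
  obtain t where "uniformized (place_ring P) t" using ex_uniformized by blast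
  then interpret uniformized "place_ring P" t .
  show ?thesis using ex_order[OF assms] has_order_mem valuation_eq nonunits_place_ring by metis
qed

lemma val_place: assumes "z \<noteq> 0" shows "z \<in> P \<longleftrightarrow> valuation P z > 0"
proof -
  obtain t where "uniformized (place_ring P) t" using ex_uniformized by blast
  then interpret uniformized "place_ring P" t .
  show ?thesis using ex_order[OF assms] has_order_nonunit valuation_eq nonunits_place_ring by metis
qed

lemma ex_val_1: "\<exists>t. t \<noteq> 0 \<and> valuation P t = 1"
proof -
  obtain t where "uniformized (place_ring P) t" using ex_uniformized by blast
  then interpret uniformized "place_ring P" t .
  show ?thesis using valuation_eq[OF has_order_self[of 1]] t0 unfolding nonunits_place_ring by auto
qed

lemma zero_in_place: "0 \<in> P"
  using zero_nonunit nonunits_place_ring by auto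

lemma one_notin_place: "1 \<notin> P"
  using one_not_nonunit nonunits_place_ring by auto

lemma val_one: "valuation P 1 = 0"
  using val_mult[of 1 1] by simp

lemma val_inverse: "z \<noteq> 0 \<Longrightarrow> valuation P (inverse z) = - valuation P z"
  using val_mult[of z "inverse z"] val_one by simp

lemma val_divide: "z \<noteq> 0 \<Longrightarrow> w \<noteq> 0 \<Longrightarrow> valuation P (z / w) = valuation P z - valuation P w"
  using val_mult[of z "inverse w"] val_inverse by (simp add: divide_inverse)

lemma val_power: "z \<noteq> 0 \<Longrightarrow> valuation P (z ^ n) = int n * valuation P z"
  by (induction n) (auto simp: val_one val_mult algebra_simps)

lemma val_powi: "z \<noteq> 0 \<Longrightarrow> valuation P (z powi n) = n * valuation P z"
  by (auto simp: power_int_def val_power val_inverse power_inverse)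

lemma val_prod: "finite I \<Longrightarrow> (\<And>i. i \<in> I \<Longrightarrow> h i \<noteq> 0) \<Longrightarrow> valuation P (prod h I) = (\<Sum>i\<in>I. valuation P (h i))"
  by (induction I rule: finite_induct) (auto simp: val_one val_mult)

lemma val_unit: "unit_in (place_ring P) u \<longleftrightarrow> u \<noteq> 0 \<and> valuation P u = 0"
  by (cases "u = 0") (auto simp: unit_in_def val_ring val_inverse)

lemma val_minus: "z \<noteq> 0 \<Longrightarrow> valuation P (- z) = valuation P z"
  using val_unit[of "-1"] unit_minus[OF unit_one] val_mult[of "-1" z] by simp

lemma order_ge_0 [simp]: "order_ge P n 0"
  by (simp add: order_ge_def)

lemma order_ge_ring: "order_ge P 0 z \<longleftrightarrow> z \<in> place_ring P"
  using val_ring[of z] zero_mem by (cases "z = 0") (auto simp: order_ge_def)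

lemma order_ge_place: "order_ge P 1 z \<longleftrightarrow> z \<in> P"
  using val_place[of z] zero_in_place by (cases "z = 0") (auto simp: order_ge_def)

lemma order_ge_mono: "order_ge P n z \<Longrightarrow> k \<le> n \<Longrightarrow> order_ge P k z"
  by (auto simp: order_ge_def)

lemma order_ge_mult: "order_ge P n z \<Longrightarrow> order_ge P k w \<Longrightarrow> order_ge P (n + k) (z * w)"
  by (cases "z = 0 \<or> w = 0") (auto simp: order_ge_def val_mult)

lemma order_ge_mult_iff: "w \<noteq> 0 \<Longrightarrow> order_ge P n (z * w) \<longleftrightarrow> order_ge P (n - valuation P w) z"
  by (cases "z = 0") (auto simp: order_ge_def val_mult)

lemma ex_val: "\<exists>w. w \<noteq> 0 \<and> valuation P w = n"
proof -
  obtain t where "t \<noteq> 0" "valuation P t = 1" using ex_val_1 by auto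
  then show ?thesis by (intro exI[of _ "t powi n"]) (auto simp: val_powi)
qed

lemma order_ge_shift: "w \<noteq> 0 \<Longrightarrow> valuation P w = n \<Longrightarrow> order_ge P n z \<longleftrightarrow> z / w \<in> place_ring P"
  using order_ge_mult_iff[of "inverse w" 0 z] by (simp add: val_inverse order_ge_ring divide_inverse)

lemma order_ge_add: "order_ge P n z \<Longrightarrow> order_ge P n w \<Longrightarrow> order_ge P n (z + w)"
  using ex_val[of n] by (auto simp: order_ge_shift add_divide_distrib intro: add_mem)

lemma order_ge_minus: "order_ge P n z \<Longrightarrow> order_ge P n (- z)"
  by (cases "z = 0") (auto simp: order_ge_def val_minus)

lemma order_ge_diff: "order_ge P n z \<Longrightarrow> order_ge P n w \<Longrightarrow> order_ge P n (z - w)"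
  using order_ge_add[OF _ order_ge_minus] by force

lemma order_ge_sum: "(\<And>i. i \<in> I \<Longrightarrow> order_ge P n (h i)) \<Longrightarrow> order_ge P n (sum h I)"
  by (induction I rule: infinite_finite_induct) (auto intro: order_ge_add)

lemma val_add: assumes "z \<noteq> 0" "order_ge P (valuation P z + 1) w"
  shows "z + w \<noteq> 0 \<and> valuation P (z + w) = valuation P z"
proof -
  have n: "\<not> order_ge P (valuation P z + 1) z" using assms by (simp add: order_ge_def)
  have 1: "order_ge P (valuation P z) (z + w)"
    using assms by (intro order_ge_add) (auto simp: order_ge_def)
  have 2: "\<not> order_ge P (valuation P z + 1) (z + w)"
    using n order_ge_diff[OF _ assms(2), of "z + w"] by auto
  then show ?thesis using 1 by (auto simp: order_ge_def)
qed

lemma val_sum_distinct: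
  assumes "finite J" "J \<noteq> {}" "inj_on (\<lambda>j. valuation P (h j)) J" "\<And>j. j \<in> J \<Longrightarrow> h j \<noteq> 0"
  shows "sum h J \<noteq> 0 \<and> (\<exists>j\<in>J. valuation P (sum h J) = valuation P (h j))
         \<and> (\<forall>j\<in>J. valuation P (sum h J) \<le> valuation P (h j))"
proof -
  obtain t where "uniformized (place_ring P) t" using ex_uniformized by blast
  then interpret uniformized "place_ring P" t .
  have ho: "has_order (place_ring P) t (valuation P z) z" if "z \<noteq> 0" for z
    using ex_order[OF that] valuation_eq unfolding nonunits_place_ring by auto
  have *: "has_order (place_ring P) t (Min ((\<lambda>j. valuation P (h j)) ` J)) (sum h J)"
    by (rule has_order_sum) (use assms ho in auto)
  then have eq: "valuation P (sum h J) = Min ((\<lambda>j. valuation P (h j)) ` J)"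
    using valuation_eq unfolding nonunits_place_ring by blast
  have "Min ((\<lambda>j. valuation P (h j)) ` J) \<in> (\<lambda>j. valuation P (h j)) ` J"
    using assms by (intro Min_in) auto
  then obtain j where "j \<in> J" "Min ((\<lambda>j. valuation P (h j)) ` J) = valuation P (h j)" by (rule imageE)
  then have "\<exists>j\<in>J. valuation P (sum h J) = valuation P (h j)" unfolding eq by (intro bexI[of _ j])
  then show ?thesis using has_order_nonzero[OF *] assms eq by simp
qed

end

section \<open>Residue systems\<close>

definition residue_system :: "'f::field set \<Rightarrow> 'f set \<Rightarrow> bool" where
  "residue_system P Z \<longleftrightarrow>
     finite Z \<and> Z \<subseteq> place_ring P \<and> (\<forall>z\<in>place_ring P. \<exists>!r. r \<in> Z \<and> z - r \<in> P)"

lemma residue_system_card_unique: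
  assumes "residue_system P Z" "residue_system P Z'" "discrete_place P"
  shows "card Z \<le> card Z'"
proof -
  interpret discrete_place P by fact
  define h where "h z = (THE r. r \<in> Z' \<and> z - r \<in> P)" for z
  have h: "h z \<in> Z'" "z - h z \<in> P" if "z \<in> Z" for z
  proof -
    have "z \<in> place_ring P" using assms(1) that by (auto simp: residue_system_def)
    then have "\<exists>!r. r \<in> Z' \<and> z - r \<in> P" using assms(2) by (simp add: residue_system_def)
    from theI'[OF this] show "h z \<in> Z'" "z - h z \<in> P" by (auto simp: h_def)
  qed
  have "inj_on h Z"
  proof
    fix z w assume zw: "z \<in> Z" "w \<in> Z" "h z = h w"
    have "(z - h z) - (w - h w) \<in> P"
      using nonunits_diff[of "z - h z" "w - h w"] h zw(1,2) unfolding nonunits_place_ring by blast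
    then have "z - w \<in> P" using zw(3) by simp
    moreover have "z - z \<in> P" using zero_in_place by simp
    ultimately show "z = w" using assms(1) zw unfolding residue_system_def by (metis subsetD)
  qed
  then show ?thesis using h assms by (intro card_inj_on_le[of h]) (auto simp: residue_system_def)
qed

context discrete_place
begin

text \<open>Truncated expansions with digits in \<open>Z\<close> with respect to a uniformizer.\<close>

lemma ex_incongruent_set:
  assumes "residue_system P Z"
  shows "\<exists>X. finite X \<and> card X = card Z ^ n \<and> X \<subseteq> place_ring P \<and>
             (\<forall>x\<in>X. \<forall>x'\<in>X. order_ge P (int n) (x - x') \<longrightarrow> x = x')"
proof (induction n)
  case 0
  show ?case by (intro exI[of _ "{0}"]) (auto simp: zero_mem)
next
  case (Suc n)
  then obtain X where "finite X \<and> card X = card Z ^ n \<and> X \<subseteq> place_ring P \<and>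
    (\<forall>x\<in>X. \<forall>x'\<in>X. order_ge P (int n) (x - x') \<longrightarrow> x = x')" by (rule exE)
  then have X: "finite X" "card X = card Z ^ n" "X \<subseteq> place_ring P"
    "\<And>x x'. x \<in> X \<Longrightarrow> x' \<in> X \<Longrightarrow> order_ge P (int n) (x - x') \<Longrightarrow> x = x'" by simp_all
  obtain t where t: "t \<noteq> 0" "valuation P t = 1" using ex_val_1 by auto
  have tV: "t \<in> place_ring P" using t val_ring by simp
  have Z: "finite Z" "Z \<subseteq> place_ring P" "\<And>z. z \<in> place_ring P \<Longrightarrow> \<exists>!r. r \<in> Z \<and> z - r \<in> P"
    using assms by (auto simp: residue_system_def)
  have Zu: "r = r'" if "r \<in> Z" "r' \<in> Z" "r - r' \<in> P" for r r'
  proof -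
    have "r \<in> place_ring P" using that Z(2) by blast
    from Z(3)[OF this] obtain s where "\<And>s'. s' \<in> Z \<Longrightarrow> r - s' \<in> P \<Longrightarrow> s' = s" by blast
    from this[OF that(1)] this[OF that(2,3)] show ?thesis using zero_in_place by simp
  qed
  define h where "h = (\<lambda>(r, x). r + t * x)"
  have key: "r = r' \<and> x = x'"
    if H: "r \<in> Z" "r' \<in> Z" "x \<in> X" "x' \<in> X" "order_ge P (int (Suc n)) (h (r, x) - h (r', x'))" for r r' x x'
  proof -
    have d: "h (r, x) - h (r', x') = (r - r') + (x - x') * t" by (simp add: h_def algebra_simps)
    have o: "order_ge P 0 (x - x')" using H X by (auto simp: order_ge_ring intro: diff_mem)
    have "order_ge P 1 ((x - x') * t)" using o t by (simp add: order_ge_mult_iff)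
    moreover have "order_ge P 1 (r - r' + (x - x') * t)" using order_ge_mono[OF H(5), of 1] d by simp
    ultimately have "order_ge P 1 (r - r')" using order_ge_diff by fastforce
    then have "r - r' \<in> P" by (simp add: order_ge_place)
    then have rr: "r = r'" using Zu H by blast
    then have "order_ge P (int (Suc n)) ((x - x') * t)" using H(5) d by simp
    then have "order_ge P (int n) (x - x')" using t by (simp add: order_ge_mult_iff)
    then show ?thesis using rr X(4) H by blast
  qed
  have "inj_on h (Z \<times> X)"
  proof
    fix p p' assume H: "p \<in> Z \<times> X" "p' \<in> Z \<times> X" "h p = h p'"
    obtain r x r' x' where "p = (r, x)" "p' = (r', x')" by fastforce
    then show "p = p'" using key[of r r' x x'] H by auto
  qed
  then have "card (h ` (Z \<times> X)) = card Z ^ Suc n" using X by (simp add: card_image card_cartesian_product)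
  moreover have "h ` (Z \<times> X) \<subseteq> place_ring P"
    using X Z tV by (auto simp: h_def intro!: add_mem mult_mem)
  moreover have "\<forall>y\<in>h ` (Z \<times> X). \<forall>y'\<in>h ` (Z \<times> X). order_ge P (int (Suc n)) (y - y') \<longrightarrow> y = y'"
    using key by fast
  moreover have "finite (h ` (Z \<times> X))" using X Z by auto
  ultimately show ?case by blast
qed

end

text \<open>
  The fibres of \<open>U \<rightarrow> V/P\<close>, \<open>u \<mapsto> u \<tau> mod P\<close>, are contained in translates of \<open>W\<close>.
\<close>

lemma card_fibres_bound:
  fixes U W :: "'f::field set"
  assumes "finite W" "residue_system P Z"
    and U: "\<And>u u'. u \<in> U \<Longrightarrow> u' \<in> U \<Longrightarrow> u - u' \<in> U"
    and ring: "\<And>u. u \<in> U \<Longrightarrow> u * \<tau> \<in> place_ring P"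
    and kernel: "\<And>u. u \<in> U \<Longrightarrow> u * \<tau> \<in> P \<Longrightarrow> u \<in> W"
    and P: "\<And>z w. z \<in> P \<Longrightarrow> w \<in> P \<Longrightarrow> z - w \<in> P"
  shows "finite U \<and> card U \<le> card W * card Z"
proof -
  define A where "A r = {u \<in> U. u * \<tau> - r \<in> P}" for r
  have A: "finite (A r) \<and> card (A r) \<le> card W" for r
  proof (cases "A r = {}")
    case False
    then obtain u0 where u0: "u0 \<in> A r" by auto
    have "A r \<subseteq> (\<lambda>w. u0 + w) ` W"
    proof
      fix u assume u: "u \<in> A r"
      have "(u * \<tau> - r) - (u0 * \<tau> - r) \<in> P" using u u0 by (intro P[of "u * \<tau> - r"]) (auto simp: A_def)
      then have "(u - u0) * \<tau> \<in> P" by (simp add: algebra_simps)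
      then have "u - u0 \<in> W" using kernel U u u0 by (auto simp: A_def)
      then show "u \<in> (\<lambda>w. u0 + w) ` W" by (intro image_eqI[of _ _ "u - u0"]) auto
    qed
    then show ?thesis
      using assms(1) by (meson card_image_le card_mono finite_imageI finite_subset le_trans)
  qed simp
  have fZ: "finite Z" using assms(2) by (simp add: residue_system_def)
  have UA: "U = (\<Union>r\<in>Z. A r)"
    using ring assms(2) unfolding residue_system_def A_def by blast
  have "card (\<Union>r\<in>Z. A r) \<le> (\<Sum>r\<in>Z. card (A r))" using fZ by (intro card_UN_le) auto
  also have "\<dots> \<le> (\<Sum>r\<in>Z. card W)" using A by (intro sum_mono) auto
  also have "\<dots> = card W * card Z" by (simp add: mult.commute)
  finally show ?thesis using UA A fZ by auto
qed

subsection \<open>Degrees of places over a finite field of constants\<close>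

lemma card_supported_functions:
  assumes "finite B"
  shows "finite {u::'b \<Rightarrow> 'k::{zero,finite}. \<forall>b. b \<notin> B \<longrightarrow> u b = 0} \<and>
         card {u::'b \<Rightarrow> 'k. \<forall>b. b \<notin> B \<longrightarrow> u b = 0} = CARD('k) ^ card B"
proof -
  have "bij_betw (\<lambda>u. restrict u B) {u::'b \<Rightarrow> 'k. \<forall>b. b \<notin> B \<longrightarrow> u b = 0} (B \<rightarrow>\<^sub>E UNIV)"
    by (rule bij_betw_byWitness[where f' = "\<lambda>u b. if b \<in> B then u b else 0"])
       (auto simp: fun_eq_iff restrict_def PiE_def extensional_def)
  then show ?thesis
    using assms by (auto simp: bij_betw_same_card card_PiE bij_betw_finite finite_PiE)
qed

locale embedding =
  fixes c :: "'k::field \<Rightarrow> 'f::field"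
  assumes emb: "field_embedding c"
begin

lemma c_1 [simp]: "c 1 = 1" and c_add [simp]: "c (u + v) = c u + c v"
  and c_mult [simp]: "c (u * v) = c u * c v"
  using emb by (auto simp: field_embedding_def)

lemma c_0 [simp]: "c 0 = 0"
proof -
  have "c 0 + c 0 = c 0 + 0" using c_add[of 0 0] by simp
  then show ?thesis by (rule add_left_imp_eq)
qed

lemma c_minus [simp]: "c (- u) = - c u"
  using c_add[of u "- u"] by (simp add: eq_neg_iff_add_eq_0 add.commute)

lemma c_diff [simp]: "c (u - v) = c u - c v"
  using c_add[of u "- v"] by simp

lemma c_eq_0 [simp]: "c u = 0 \<longleftrightarrow> u = 0"
proof
  assume "c u = 0"
  then have "c (u * inverse u) = 0" by simp
  then show "u = 0" by (metis c_1 right_inverse zero_neq_one)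
qed simp

lemma c_eq [simp]: "c u = c v \<longleftrightarrow> u = v"
  using c_eq_0[of "u - v"] by (simp del: c_eq_0)

lemma c_inverse [simp]: "c (inverse u) = inverse (c u)"
proof (cases "u = 0")
  case False
  then have "c u * c (inverse u) = 1" using c_mult[of u "inverse u"] by simp
  then show ?thesis by (metis inverse_unique)
qed simp

lemma c_divide [simp]: "c (u / v) = c u / c v"
  by (simp add: divide_inverse)

lemma c_power [simp]: "c (u ^ n) = c u ^ n"
  by (induction n) auto

lemma vector_space_c: "vector_space (\<lambda>a z. c a * z)"
  by unfold_locales (auto simp: algebra_simps)

end

locale constants = embedding c for c :: "'k::{field,finite} \<Rightarrow> 'f::field"
begin

lemma card_constants: "CARD('k) > 1"
proof -
  have "card {0, 1 :: 'k} \<le> CARD('k)" by (rule card_mono) auto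
  then show ?thesis by simp
qed

lemma residue_basis_system:
  assumes "discrete_place P" "range c \<subseteq> place_ring P" "residue_basis c P B"
  shows "\<exists>Z. residue_system P Z \<and> card Z = CARD('k) ^ card B"
proof -
  interpret discrete_place P by fact
  define S where "S = {u. \<forall>b. b \<notin> B \<longrightarrow> u b = (0::'k)}"
  define h where "h u = (\<Sum>b\<in>B. c (u b) * b)" for u
  have B: "finite B" "B \<subseteq> place_ring P"
    "\<And>z. z \<in> place_ring P \<Longrightarrow> \<exists>!u. u \<in> S \<and> z - h u \<in> P"
    using assms(3) by (auto simp: residue_basis_def S_def h_def)
  have hV: "h u \<in> place_ring P" for u
    using B assms(2) by (auto simp: h_def intro!: sum_mem mult_mem)
  have self: "h u - h u \<in> P" for u using zero_in_place by simp
  have "inj_on h S"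
    by (rule inj_onI) (metis B(3) hV self)
  then have "card (h ` S) = CARD('k) ^ card B"
    using card_supported_functions[OF B(1), where 'k = 'k] by (simp add: card_image S_def)
  moreover have "residue_system P (h ` S)"
    unfolding residue_system_def
  proof (intro conjI ballI)
    show "finite (h ` S)" using card_supported_functions[OF B(1), where 'k = 'k] by (auto simp: S_def)
    show "h ` S \<subseteq> place_ring P" using hV by auto
    fix z assume "z \<in> place_ring P"
    then obtain u where u: "u \<in> S" "z - h u \<in> P" and uniq: "\<And>u'. u' \<in> S \<Longrightarrow> z - h u' \<in> P \<Longrightarrow> u' = u"
      using B(3) by blast
    show "\<exists>!r. r \<in> h ` S \<and> z - r \<in> P"
    proof (rule ex1I[of _ "h u"])
      fix r assume "r \<in> h ` S \<and> z - r \<in> P"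
      then show "r = h u" using uniq by auto
    qed (use u in auto)
  qed
  ultimately show ?thesis by blast
qed

text \<open>A spanning set of the residue field of minimal cardinality is a basis.\<close>

lemma ex_residue_basis:
  assumes "discrete_place P" "range c \<subseteq> place_ring P" "residue_system P Z"
  shows "\<exists>B. residue_basis c P B"
proof -
  interpret discrete_place P by fact
  define spanning where "spanning B \<longleftrightarrow> finite B \<and> B \<subseteq> place_ring P \<and>
     (\<forall>z\<in>place_ring P. \<exists>u. (\<forall>b. b \<notin> B \<longrightarrow> u b = 0) \<and> z - (\<Sum>b\<in>B. c (u b) * b) \<in> P)" for B
  have cV: "c u \<in> place_ring P" for u using assms by auto
  have addP: "z + w \<in> P" if "z \<in> P" "w \<in> P" for z w
    using nonunits_add[of z w] that nonunits_place_ring by auto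
  have diffP: "z - w \<in> P" if "z \<in> P" "w \<in> P" for z w
    using nonunits_diff[of z w] that nonunits_place_ring by auto
  have multP: "w * z \<in> P" if "z \<in> P" "w \<in> place_ring P" for z w
    using nonunits_mult[of z w] that nonunits_place_ring by (auto simp: mult.commute)
  have "spanning Z"
    unfolding spanning_def
  proof (intro conjI ballI)
    show "finite Z" "Z \<subseteq> place_ring P" using assms by (auto simp: residue_system_def)
    fix z assume "z \<in> place_ring P"
    then obtain r where r: "r \<in> Z" "z - r \<in> P" using assms(3) unfolding residue_system_def by blast
    have "(\<Sum>b\<in>Z. c (if b = r then 1 else 0) * b) = (\<Sum>b\<in>Z. if b = r then b else 0)"
      by (intro sum.cong) auto
    also have "\<dots> = r" using r \<open>finite Z\<close> by simp
    finally show "\<exists>u. (\<forall>b. b \<notin> Z \<longrightarrow> u b = 0) \<and> z - (\<Sum>b\<in>Z. c (u b) * b) \<in> P"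
      using r by (intro exI[of _ "\<lambda>b. if b = r then 1 else 0"]) auto
  qed
  then obtain B where B: "spanning B" and min: "\<And>B'. spanning B' \<Longrightarrow> card B \<le> card B'"
    using ex_has_least_nat[of spanning Z card] by blast
  have fB: "finite B" "B \<subseteq> place_ring P" using B by (auto simp: spanning_def)
  have indep: "w = (\<lambda>_. 0)"
    if w: "\<And>b. b \<notin> B \<Longrightarrow> w b = 0" "(\<Sum>b\<in>B. c (w b) * b) \<in> P" for w
  proof (rule ccontr)
    assume "w \<noteq> (\<lambda>_. 0)"
    then obtain b0 where b0: "w b0 \<noteq> 0" by auto
    then have b0B: "b0 \<in> B" using w by auto
    have "spanning (B - {b0})"
      unfolding spanning_def
    proof (intro conjI ballI)
      show "finite (B - {b0})" "B - {b0} \<subseteq> place_ring P" using fB by auto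
      fix z assume "z \<in> place_ring P"
      then obtain u where u: "\<And>b. b \<notin> B \<Longrightarrow> u b = 0" "z - (\<Sum>b\<in>B. c (u b) * b) \<in> P"
        using B unfolding spanning_def by blast
      define \<mu> where "\<mu> = u b0 / w b0"
      define u' where "u' b = u b - \<mu> * w b" for b
      have "(\<Sum>b\<in>B. c (u' b) * b) = (\<Sum>b\<in>B. c (u b) * b) - c \<mu> * (\<Sum>b\<in>B. c (w b) * b)"
        by (simp add: u'_def sum_subtractf sum_distrib_left algebra_simps)
      then have "z - (\<Sum>b\<in>B. c (u' b) * b) = (z - (\<Sum>b\<in>B. c (u b) * b)) + c \<mu> * (\<Sum>b\<in>B. c (w b) * b)"
        by simp
      also have "\<dots> \<in> P" using addP[OF u(2) multP[OF w(2) cV]] .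
      finally have "z - (\<Sum>b\<in>B. c (u' b) * b) \<in> P" .
      moreover have "u' b0 = 0" using b0 by (simp add: u'_def \<mu>_def)
      moreover have "(\<Sum>b\<in>B. c (u' b) * b) = (\<Sum>b\<in>B - {b0}. c (u' b) * b)"
        using \<open>u' b0 = 0\<close> fB by (intro sum.mono_neutral_right) auto
      moreover have "u' b = 0" if "b \<notin> B" for b using u w that by (simp add: u'_def)
      ultimately show "\<exists>u. (\<forall>b. b \<notin> B - {b0} \<longrightarrow> u b = 0) \<and> z - (\<Sum>b\<in>B - {b0}. c (u b) * b) \<in> P"
        by (intro exI[of _ u']) auto
    qed
    from min[OF this] show False
      using b0B fB by (meson card_Diff1_less linorder_not_less)
  qed
  have "residue_basis c P B"
    unfolding residue_basis_def
  proof (intro conjI ballI)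
    fix z assume "z \<in> place_ring P"
    then obtain u where u: "\<forall>b. b \<notin> B \<longrightarrow> u b = 0" "z - (\<Sum>b\<in>B. c (u b) * b) \<in> P"
      using B unfolding spanning_def by blast
    show "\<exists>!u. (\<forall>b. b \<notin> B \<longrightarrow> u b = 0) \<and> z - (\<Sum>b\<in>B. c (u b) * b) \<in> P"
    proof (rule ex1I[of _ u])
      fix u' assume u': "(\<forall>b. b \<notin> B \<longrightarrow> u' b = 0) \<and> z - (\<Sum>b\<in>B. c (u' b) * b) \<in> P"
      have "(z - (\<Sum>b\<in>B. c (u b) * b)) - (z - (\<Sum>b\<in>B. c (u' b) * b)) \<in> P"
        using diffP u u' by blast
      then have "(\<Sum>b\<in>B. c (u' b - u b) * b) \<in> P" by (simp add: algebra_simps sum_subtractf)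
      from indep[OF _ this] u u' show "u' = u" by (auto simp: fun_eq_iff)
    qed (use u in auto)
  qed (use fB in auto)
  then show ?thesis by blast
qed

text \<open>
  The number of residue classes determines the size of every residue basis; this makes
  \<open>place_degree\<close> well defined.
\<close>

lemma place_degree_residue_system:
  assumes "discrete_place P" "range c \<subseteq> place_ring P" "residue_system P Z"
  shows "card Z = CARD('k) ^ place_degree c P"
proof -
  have q: "CARD('k) > 1" by (rule card_constants)
  obtain B where B: "residue_basis c P B" using ex_residue_basis[OF assms] by blast
  have *: "card Z = CARD('k) ^ card B'" if "residue_basis c P B'" for B'
    using residue_basis_system[OF assms(1,2) that] residue_system_card_unique[OF _ _ assms(1)] assms(3)
    by (metis le_antisym)
  have "card B' = card B" if "residue_basis c P B'" for B'
    using *[OF that] *[OF B] q by (metis power_inject_exp)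
  then have "place_degree c P = card B"
    unfolding place_degree_def using B by blast
  then show ?thesis using *[OF B] by simp
qed

lemma place_degree_pos:
  assumes "discrete_place P" "range c \<subseteq> place_ring P" "residue_system P Z"
  shows "place_degree c P > 0"
proof (rule ccontr)
  assume "\<not> ?thesis"
  then have "card Z = 1" using place_degree_residue_system[OF assms] by simp
  then obtain r where Z: "Z = {r}" using card_1_singletonE by blast
  interpret discrete_place P by fact
  have "0 - r \<in> P" "1 - r \<in> P"
    using assms(3) Z zero_mem one_mem unfolding residue_system_def by blast+
  then have "(1 - r) - (0 - r) \<in> P"
    using nonunits_diff[of "1 - r" "0 - r"] nonunits_place_ring by metis
  then show False using one_notin_place by simp
qed

end

section \<open>Places of an extension of the constants\<close>

context embedding
begin

lemma place_props:
  assumes "P \<in> places c"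
  shows "total_ring (place_ring P)" "nonunits (place_ring P) = P" "range c \<subseteq> place_ring P"
    "place_ring P \<noteq> UNIV"
proof -
  obtain V where V: "valuation_ring c V" "P = nonunits V"
    using assms by (auto simp: places_def nonunits_def)
  have cV: "range c \<subseteq> V" and V_UNIV: "V \<noteq> UNIV"
    using V(1) unfolding valuation_ring_def by (elim conjE psubsetE; simp only: top_greatest)+
  have "c 1 \<in> V" by (rule range_subsetD[OF cV])
  then have "1 \<in> V" by simp
  moreover have "u - v \<in> V" "u * v \<in> V" if "u \<in> V" "v \<in> V" for u v
    using V(1) that unfolding valuation_ring_def by blast+
  moreover have "z \<in> V \<or> inverse z \<in> V" for z
    using V(1) unfolding valuation_ring_def by (elim conjE) (rule spec)
  ultimately interpret total_ring V by unfold_locales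
  have "place_ring P = V" using V place_ring_nonunits by simp
  then show "total_ring (place_ring P)" "nonunits (place_ring P) = P" "range c \<subseteq> place_ring P"
    "place_ring P \<noteq> UNIV" using V cV V_UNIV total_ring_axioms by simp_all
qed

lemma nonunits_in_places:
  assumes "total_ring V" "range c \<subseteq> V" "V \<noteq> range c" "V \<noteq> UNIV"
  shows "nonunits V \<in> places c"
proof -
  interpret total_ring V by fact
  have "valuation_ring c V"
    unfolding valuation_ring_def using assms diff_mem mult_mem total by auto
  then show ?thesis unfolding places_def nonunits_def by blast
qed

end

section \<open>The function field of a superelliptic curve\<close>

text \<open>
  Orders of the form \<open>m k + l j\<close> with \<open>0 \<le> j < m\<close> determine \<open>j\<close>; hence linear combinations of powers of an
  element of order \<open>l\<close> over elements of order divisible by \<open>m\<close> have no cancellation.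
\<close>

lemma coprime_orders_inj:
  fixes l m j j' :: nat and k k' :: int
  assumes "coprime l m" "int m * k + int l * int j = int m * k' + int l * int j'" "j < m" "j' < m"
  shows "j = j'"
proof -
  have "int l * (int j - int j') = int m * (k' - k)" using assms by (simp add: algebra_simps)
  then have "int m dvd int l * (int j - int j')" by simp
  moreover have "coprime (int m) (int l)" using assms(1) by (simp add: coprime_commute)
  ultimately have "int m dvd int j - int j'" by (simp add: coprime_dvd_mult_right_iff)
  moreover have "\<bar>int j - int j'\<bar> < int m" using assms by linarith
  ultimately have "int j - int j' = 0" using dvd_imp_le_int by (metis abs_of_nat not_le)
  then show ?thesis by simp
qed

locale superelliptic =
  fixes \<iota> :: "'q::{field,finite} poly fract \<Rightarrow> 'f::field"
    and c :: "'q \<Rightarrow> 'f" and y :: 'f and m :: nat and f :: "'q poly" and Q0 :: "'f set"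
  assumes emb_\<iota>: "field_embedding \<iota>"
    and c_def: "c = \<iota> \<circ> ratfun_const"
    and m2: "m \<ge> 2"
    and y_power: "y ^ m = \<iota> (to_fract f)"
    and coprime: "coprime (degree f) m"
    and generated: "is_subfield hull (insert y (range \<iota>)) = UNIV"
    and places_over_infinity: "places_over ratfun_const \<iota> infinite_place = {Q0}"
begin

sublocale iota: embedding \<iota>
  by unfold_locales (rule emb_\<iota>)

sublocale constants c
  by unfold_locales
     (auto simp: c_def field_embedding_def ratfun_const_def one_pCons[symmetric]
        simp flip: to_fract_add to_fract_mult iota.c_add iota.c_mult)

definition em :: "'q poly \<Rightarrow> 'f" where
  "em p = \<iota> (to_fract p)"

definition x :: 'f where
  "x = em [:0, 1:]"

lemma em_0 [simp]: "em 0 = 0" and em_1 [simp]: "em 1 = 1"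
  and em_add [simp]: "em (p + q) = em p + em q" and em_diff [simp]: "em (p - q) = em p - em q"
  and em_mult [simp]: "em (p * q) = em p * em q" and em_eq_0 [simp]: "em p = 0 \<longleftrightarrow> p = 0"
  by (simp_all add: em_def)

lemma em_power [simp]: "em (p ^ n) = em p ^ n"
  by (induction n) auto

lemma em_prod: "em (prod h I) = (\<Prod>i\<in>I. em (h i))"
  by (induction I rule: infinite_finite_induct) auto

lemma em_const [simp]: "em [:a:] = c a"
  by (simp add: em_def c_def ratfun_const_def)

lemma em_pCons [simp]: "em (pCons a p) = c a + x * em p"
proof -
  have "pCons a p = [:a:] + [:0, 1:] * p" by simp
  then have "em (pCons a p) = em [:a:] + em ([:0, 1:] * p)" by (metis em_add)
  then show ?thesis unfolding em_mult em_const x_def .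
qed

lemma em_smult [simp]: "em (smult a p) = c a * em p"
proof -
  have "em (smult a p) = em ([:a:] * p)" by simp
  then show ?thesis unfolding em_mult em_const .
qed

lemma x_nonzero: "x \<noteq> 0"
  by (simp add: x_def del: em_pCons)

lemma degree_f_pos: "degree f > 0"
  using coprime m2 by (cases "degree f") auto

lemma f_nonzero: "f \<noteq> 0"
  using degree_f_pos by auto

lemma m_pos: "m > 0"
  using m2 by simp

lemma y_power_em: "y ^ m = em f"
  using y_power by (simp add: em_def)

lemma y_nonzero: "y \<noteq> 0"
  using y_power_em f_nonzero m_pos by (metis em_eq_0 power_eq_0_iff)

lemma iota_Fract: "\<iota> (Fract p q) = em p / em q"
  by (simp add: Fract_conv_to_fract em_def)

definition comb :: "(nat \<Rightarrow> 'q poly) \<Rightarrow> 'f" where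
  "comb C = (\<Sum>j<m. em (C j) * y ^ j)"

lemma comb_add: "comb C + comb C' = comb (\<lambda>j. C j + C' j)"
  by (simp add: comb_def sum.distrib algebra_simps)

lemma comb_diff: "comb C - comb C' = comb (\<lambda>j. C j - C' j)"
  by (simp add: comb_def sum_subtractf algebra_simps)

lemma comb_mult: "em p * comb C = comb (\<lambda>j. p * C j)"
  by (simp add: comb_def sum_distrib_left algebra_simps)

interpretation vs: vector_space "\<lambda>a z. \<iota> a * z"
  by (rule iota.vector_space_c)

definition ybasis :: "'f set" where
  "ybasis = (\<lambda>j. y ^ j) ` {..<m}"

lemma subspace_mult: "vs.subspace S \<Longrightarrow> vs.subspace {w. w * z \<in> S}"
  by (auto simp: vs.subspace_def distrib_right mult.assoc)

text \<open>The relation \<open>y\<^sup>m = f(x)\<close> reduces the exponent.\<close>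

lemma span_mult_y: assumes "z \<in> vs.span ybasis" shows "z * y \<in> vs.span ybasis"
proof -
  have "ybasis \<subseteq> {w. w * y \<in> vs.span ybasis}"
  proof
    fix b assume "b \<in> ybasis"
    then obtain j where j: "j < m" "b = y ^ j" by (auto simp: ybasis_def)
    show "b \<in> {w. w * y \<in> vs.span ybasis}"
    proof (cases "Suc j < m")
      case True
      then have "y ^ Suc j \<in> ybasis" unfolding ybasis_def by blast
      then show ?thesis using j vs.span_base by (simp add: mult.commute)
    next
      case False
      then have "m = Suc j" using j by simp
      then have "b * y = y ^ m" using j by (simp add: mult.commute)
      then have "b * y = \<iota> (to_fract f) * y ^ 0" using y_power by simp
      moreover have "y ^ 0 \<in> ybasis" using m_pos unfolding ybasis_def by blast
      ultimately have "b * y \<in> vs.span ybasis" using vs.span_scale[OF vs.span_base] by metis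
      then show ?thesis by simp
    qed
  qed
  then show ?thesis using vs.span_minimal[OF _ subspace_mult[OF vs.subspace_span]] assms by blast
qed

lemma span_mult: assumes "z \<in> vs.span ybasis" "w \<in> vs.span ybasis" shows "w * z \<in> vs.span ybasis"
proof -
  have p: "z * y ^ j \<in> vs.span ybasis" for j
    using assms(1) span_mult_y by (induction j) (auto simp: mult.assoc[symmetric] power_Suc2 simp del: power_Suc)
  have "ybasis \<subseteq> {w. w * z \<in> vs.span ybasis}"
    using p by (auto simp: ybasis_def mult.commute)
  then show ?thesis using vs.span_minimal[OF _ subspace_mult[OF vs.subspace_span]] assms by blast
qed

text \<open>
  The powers of \<open>z\<close> are linearly dependent, and dividing a relation by its lowest power of \<open>z\<close>
  expresses \<open>inverse z\<close> as a polynomial in \<open>z\<close>.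
\<close>

lemma span_inverse: assumes "z \<in> vs.span ybasis" shows "inverse z \<in> vs.span ybasis"
proof (cases "z = 0")
  case True
  then show ?thesis by (simp add: vs.span_zero)
next
  case False
  have one: "1 \<in> vs.span ybasis"
  proof -
    have "y ^ 0 \<in> ybasis" using m_pos unfolding ybasis_def by blast
    from vs.span_base[OF this] show ?thesis by simp
  qed
  have pw: "z ^ i \<in> vs.span ybasis" for i
    by (induction i) (auto intro: one span_mult assms)
  have "\<exists>n\<le>m. z ^ n \<in> vs.span ((\<lambda>i. z ^ i) ` {n<..m})"
  proof (rule ccontr)
    assume "\<not> ?thesis"
    then have H: "z ^ n \<notin> vs.span ((\<lambda>i. z ^ i) ` {n<..m})" if "n \<le> m" for n using that by blast
    have "k \<le> m \<Longrightarrow> vs.independent ((\<lambda>i. z ^ i) ` {m - k..m}) \<and> card ((\<lambda>i. z ^ i) ` {m - k..m}) = Suc k" for k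
    proof (induction k)
      case 0
      then show ?case using False by (simp add: vs.dependent_single)
    next
      case (Suc k)
      have e: "{m - Suc k..m} = insert (m - Suc k) {m - k..m}" "{m - Suc k<..m} = {m - k..m}"
        using Suc.prems by auto
      have n: "z ^ (m - Suc k) \<notin> vs.span ((\<lambda>i. z ^ i) ` {m - k..m})"
        using H[of "m - Suc k"] unfolding e by simp
      then have "z ^ (m - Suc k) \<notin> (\<lambda>i. z ^ i) ` {m - k..m}" using vs.span_base by blast
      then show ?case using Suc n unfolding e by (simp add: vs.independent_insert)
    qed
    from this[of m] have "vs.independent ((\<lambda>i. z ^ i) ` {0..m})" "card ((\<lambda>i. z ^ i) ` {0..m}) = Suc m"
      by simp_all
    moreover have "(\<lambda>i. z ^ i) ` {0..m} \<subseteq> vs.span ybasis" using pw by auto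
    moreover have "finite ybasis" "card ybasis \<le> m"
      unfolding ybasis_def using card_image_le[of "{..<m}" "\<lambda>j. y ^ j"] by auto
    ultimately show False using vs.independent_span_bound[of ybasis "(\<lambda>i. z ^ i) ` {0..m}"] by simp
  qed
  then obtain n where n: "z ^ n \<in> vs.span ((\<lambda>i. z ^ i) ` {n<..m})" by auto
  define s where "s = inverse (z ^ Suc n)"
  have "(\<lambda>i. z ^ i) ` {n<..m} \<subseteq> {w. w * s \<in> vs.span ybasis}"
  proof (clarsimp)
    fix i assume "n < i" "i \<le> m"
    then have "z ^ i = z ^ (i - Suc n) * z ^ Suc n" by (metis Suc_leI le_add_diff_inverse2 power_add)
    then have "z ^ i * s = z ^ (i - Suc n)" using False unfolding s_def
      by (metis mult.assoc mult.right_neutral power_not_zero right_inverse)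
    then show "z ^ i * s \<in> vs.span ybasis" using pw by simp
  qed
  then have "z ^ n * s \<in> vs.span ybasis"
    using vs.span_minimal[OF _ subspace_mult[OF vs.subspace_span]] n by blast
  moreover have "z ^ n * s = inverse z" using False by (simp add: s_def field_simps)
  ultimately show ?thesis by simp
qed

lemma span_ybasis: "vs.span ybasis = UNIV"
proof -
  have "y ^ 0 \<in> ybasis" "y ^ 1 \<in> ybasis" unfolding ybasis_def using m2 by (intro image_eqI[OF refl], simp)+
  then have one: "1 \<in> vs.span ybasis" and y: "y \<in> vs.span ybasis" using vs.span_base by force+
  have "is_subfield (vs.span ybasis)"
    unfolding is_subfield_def using one span_mult span_inverse vs.span_diff by blast
  moreover have "insert y (range \<iota>) \<subseteq> vs.span ybasis"
    using y vs.span_scale[OF one] by auto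
  ultimately have "is_subfield hull (insert y (range \<iota>)) \<subseteq> vs.span ybasis"
    by (intro hull_minimal)
  then show ?thesis using generated by auto
qed

text \<open>Bring the coefficients with respect to the powers of \<open>y\<close> to a common denominator.\<close>

lemma representation: "\<exists>C d. d \<noteq> 0 \<and> z = comb C / em d"
proof -
  define S where "S = {z. \<exists>C d. d \<noteq> 0 \<and> z = comb C / em d}"
  have SI: "z \<in> S" if "d \<noteq> 0" "z = comb C / em d" for z C d using that unfolding S_def by blast
  have "vs.subspace S"
    unfolding vs.subspace_def
  proof (intro conjI ballI allI)
    show "0 \<in> S" unfolding S_def by (auto intro!: exI[of _ "\<lambda>_. 0"] exI[of _ 1] simp: comb_def)
    fix z w assume "z \<in> S" "w \<in> S"
    then obtain C d C' d' where H: "d \<noteq> 0" "z = comb C / em d" "d' \<noteq> 0" "w = comb C' / em d'"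
      unfolding S_def by auto
    have "em d' * comb C + em d * comb C' = (z + w) * em (d * d')"
      using H by (simp add: distrib_right)
    then have "z + w = (em d' * comb C + em d * comb C') / em (d * d')"
      using H by simp
    then have "z + w = comb (\<lambda>j. d' * C j + d * C' j) / em (d * d')"
      unfolding comb_mult comb_add .
    then show "z + w \<in> S" using H by (intro SI[of "d * d'"]) simp_all
  next
    fix r :: "'q poly fract" and z assume "z \<in> S"
    then obtain C d where H: "d \<noteq> 0" "z = comb C / em d" unfolding S_def by auto
    obtain p q where r: "r = Fract p q" "q \<noteq> 0" by (cases r) auto
    have "\<iota> r * z = (em p * comb C) / em (q * d)" using H r by (simp add: iota_Fract)
    then have "\<iota> r * z = comb (\<lambda>j. p * C j) / em (q * d)" unfolding comb_mult .
    then show "\<iota> r * z \<in> S" using H r by (intro SI[of "q * d"]) simp_all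
  qed
  moreover have "ybasis \<subseteq> S"
  proof
    fix b assume "b \<in> ybasis"
    then obtain j where j: "j < m" "b = y ^ j" by (auto simp: ybasis_def)
    have "comb (\<lambda>i. if i = j then 1 else 0) = (\<Sum>i<m. if i = j then y ^ j else 0)"
      unfolding comb_def by (intro sum.cong) auto
    also have "\<dots> = b" using j by simp
    finally show "b \<in> S" unfolding S_def by (auto intro!: exI[of _ "\<lambda>i. if i = j then 1 else 0"] exI[of _ 1])
  qed
  ultimately have "vs.span ybasis \<subseteq> S" by (intro vs.span_minimal)
  then show ?thesis using span_ybasis unfolding S_def by blast
qed

subsection \<open>Places at which x has a pole\<close>

lemmas coprime_orders = coprime_orders_inj[OF coprime]

context
  fixes P assumes P: "P \<in> places c" and x_pole: "x \<notin> place_ring P"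
begin

interpretation total_ring "place_ring P"
  using place_props[OF P] by simp

text \<open>The leading term dominates at a pole of \<open>x\<close>.\<close>

lemma inf_em_unit: "p \<noteq> 0 \<Longrightarrow> unit_in (place_ring P) (em p / x ^ degree p)"
proof (induction p)
  case (pCons a p)
  show ?case
  proof (cases "p = 0")
    case True
    then have "a \<noteq> 0" using pCons by auto
    then have "c a \<in> place_ring P" "inverse (c a) \<in> place_ring P"
      using place_props(3)[OF P] c_inverse[of a] by (metis range_subsetD, metis range_subsetD)
    then show ?thesis using True \<open>a \<noteq> 0\<close> by (simp add: unit_in_def)
  next
    case False
    have "inverse x \<in> nonunits (place_ring P)" using x_pole notin_imp_inverse by simp
    then have "inverse x ^ Suc (degree p) * c a \<in> nonunits (place_ring P)"
      using place_props(3)[OF P] by (intro nonunits_mult power_nonunit) auto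
    from unit_add_nonunit[OF pCons.IH[OF False] this]
    show ?thesis using False x_nonzero by (simp add: field_simps power_inverse)
  qed
qed simp

text \<open>
  As \<open>deg f\<close> and \<open>m\<close> are coprime, some \<open>t = x\<^sup>b / y\<^sup>a\<close> satisfies \<open>t\<^sup>m = 1/x\<close> up to a unit. Expressed
  in \<open>t\<close>, the monomials \<open>x\<^sup>i y\<^sup>j\<close> with \<open>j < m\<close> have pairwise distinct orders, so nothing cancels in a sum of
  such terms, and every element of the function field gets an order.
\<close>

lemma inf_uniformized:
  "\<exists>t. uniformized (place_ring P) t \<and> has_order (place_ring P) t (- int m) x
     \<and> has_order (place_ring P) t (- int (degree f)) y"
proof -
  let ?V = "place_ring P"
  obtain a b where ab: "degree f * a = m * b + 1"
    using bezout_nat[of "degree f" m] degree_f_pos coprime by auto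
  define u where "u = em f / x ^ degree f"
  have u: "unit_in ?V u" "em f = u * x ^ degree f"
    using inf_em_unit[OF f_nonzero] x_nonzero by (auto simp: u_def)
  define t where "t = x ^ b / y ^ a"
  have t0: "t \<noteq> 0" using x_nonzero y_nonzero by (simp add: t_def)
  have u0: "u \<noteq> 0" using u by (simp add: unit_in_def)
  have tm: "t ^ m * x = inverse u ^ a"
  proof -
    have "t ^ m = x ^ (m * b) / em f ^ a"
      by (simp add: t_def power_divide mult.commute flip: power_mult y_power_em)
    also have "\<dots> = x ^ (m * b) / (u ^ a * x ^ (degree f * a))"
      by (simp add: u(2) power_mult_distrib flip: power_mult)
    finally show ?thesis using ab x_nonzero u0 by (simp add: field_simps power_inverse)
  qed
  have i: "inverse x \<in> nonunits ?V" using x_pole notin_imp_inverse by simp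
  have "t ^ m = inverse x * (t ^ m * x)" using x_nonzero by simp
  then have "t ^ m = inverse x * inverse u ^ a" unfolding tm .
  moreover have "inverse u ^ a \<in> ?V" using u by (auto simp: unit_in_def intro: power_mem)
  ultimately have "t ^ m \<in> nonunits ?V" using i nonunits_mult by simp
  then have "t \<in> nonunits ?V" using root_nonunit m_pos by blast
  then interpret pre_uniformized ?V t by unfold_locales (use t0 in auto)
  have "has_order ?V t (- int m + 0) (inverse (t powi int m) * inverse u ^ a)"
    by (intro has_order_mult has_order_inverse has_order_self has_order_unit unit_power unit_inverse u)
  moreover have "inverse (t powi int m) * inverse u ^ a = x"
    using t0 unfolding tm[symmetric] by simp
  ultimately have ox: "has_order ?V t (- int m) x" by simp
  have "(y * t ^ degree f) ^ m = em f * (t ^ m) ^ degree f"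
    by (simp add: power_mult_distrib y_power_em mult.commute flip: power_mult)
  also have "\<dots> = u * (t ^ m * x) ^ degree f" by (simp add: u(2) power_mult_distrib mult_ac)
  finally have "unit_in ?V ((y * t ^ degree f) ^ m)"
    unfolding tm using u by (auto intro!: unit_mult unit_power unit_inverse)
  then have "unit_in ?V (y * t ^ degree f)" using root_unit m_pos by blast
  then have "has_order ?V t (0 + (- int (degree f))) (y * t ^ degree f * inverse (t powi int (degree f)))"
    by (intro has_order_mult has_order_inverse has_order_self has_order_unit)
  then have oy: "has_order ?V t (- int (degree f)) y" using t0 by (simp add: mult.assoc)
  have oem: "has_order ?V t (- (int m * int (degree p))) (em p)" if "p \<noteq> 0" for p
  proof -
    have "has_order ?V t (0 + int (degree p) * (- int m)) (em p / x ^ degree p * x ^ degree p)"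
      by (intro has_order_mult has_order_power ox has_order_unit inf_em_unit that)
    then show ?thesis using x_nonzero by (simp add: mult.commute)
  qed
  have ocomb: "\<exists>n. has_order ?V t n (comb C)" if "comb C \<noteq> 0" for C
  proof -
    define J where "J = {j. j < m \<and> C j \<noteq> 0}"
    have eq: "comb C = (\<Sum>j\<in>J. em (C j) * y ^ j)"
      unfolding comb_def J_def by (intro sum.mono_neutral_right) auto
    have "has_order ?V t (Min ((\<lambda>j. - (int m * int (degree (C j))) + int j * (- int (degree f))) ` J))
           (\<Sum>j\<in>J. em (C j) * y ^ j)"
    proof (rule has_order_sum)
      show "finite J" by (auto simp: J_def)
      show "J \<noteq> {}" using that eq by auto
      show "inj_on (\<lambda>j. - (int m * int (degree (C j))) + int j * - int (degree f)) J"
        by (rule inj_onI, rule coprime_orders[of "int (degree (C j))" j "int (degree (C j'))" j' for j j'])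
           (auto simp: J_def algebra_simps)
      fix j assume "j \<in> J"
      then show "has_order ?V t (- (int m * int (degree (C j))) + int j * - int (degree f)) (em (C j) * y ^ j)"
        by (intro has_order_mult has_order_power oy oem) (auto simp: J_def)
    qed
    then show ?thesis using eq by auto
  qed
  have "uniformized ?V t"
  proof
    fix z :: 'f assume z: "z \<noteq> 0"
    obtain C d where "d \<noteq> 0" "z = comb C / em d" using representation by blast
    then show "\<exists>n. has_order ?V t n z"
      using ocomb[of C] has_order_mult[OF _ has_order_inverse[OF oem[of d]]] z
      by (auto simp: divide_inverse)
  qed
  then show ?thesis using ox oy by blast
qed

lemma inf_discrete: "discrete_place P"
  using inf_uniformized place_props[OF P] by unfold_locales auto

lemma inf_val_x: "valuation P x = - int m" and inf_val_y: "valuation P y = - int (degree f)"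
proof -
  obtain t where t: "uniformized (place_ring P) t" "has_order (place_ring P) t (- int m) x"
     "has_order (place_ring P) t (- int (degree f)) y" using inf_uniformized by blast
  interpret uniformized "place_ring P" t by fact
  show "valuation P x = - int m" "valuation P y = - int (degree f)"
    using valuation_eq[OF t(2)] valuation_eq[OF t(3)] place_props(2)[OF P] by simp_all
qed

lemma inf_val_em: assumes "p \<noteq> 0" shows "valuation P (em p) = - (int m * int (degree p))"
proof -
  interpret discrete_place P by (rule inf_discrete)
  have "valuation P (em p / x ^ degree p) = 0" using inf_em_unit[OF assms] val_unit by blast
  then show ?thesis using assms x_nonzero by (simp add: val_divide val_power inf_val_x mult.commute)
qed

text \<open>
  Orders of polynomials in \<open>x\<close> are given by degrees, so \<open>P\<close> lies over the infinite place of \<open>K(x)\<close>.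
\<close>

lemma inf_unique: "P = Q0"
proof -
  interpret discrete_place P by (rule inf_discrete)
  have "\<iota> ` infinite_place \<subseteq> P"
  proof
    fix z assume "z \<in> \<iota> ` infinite_place"
    then obtain p q where pq: "degree p < degree q" "z = em p / em q"
      unfolding infinite_place_def by (auto simp: iota_Fract)
    show "z \<in> P"
    proof (cases "p = 0")
      case True
      then show ?thesis using pq zero_in_place by simp
    next
      case False
      then have "q \<noteq> 0" using pq by auto
      then have "valuation P z = int m * (int (degree q) - int (degree p))"
        using pq False by (simp add: val_divide inf_val_em algebra_simps)
      moreover have "\<dots> > 0" using pq m_pos by simp
      ultimately show ?thesis using val_place[of z] pq False \<open>q \<noteq> 0\<close> by simp
    qed
  qed
  then have "P \<in> places_over ratfun_const \<iota> infinite_place"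
    using P unfolding places_over_def by (simp add: c_def)
  then show ?thesis using places_over_infinity by simp
qed

end

lemma Q0_place: "Q0 \<in> places c" and Q0_pole: "x \<notin> place_ring Q0"
proof -
  have Q0: "Q0 \<in> places c" "\<iota> ` infinite_place \<subseteq> Q0"
    using places_over_infinity by (auto simp: places_over_def c_def)
  then show "Q0 \<in> places c" by simp
  have "Fract 1 [:0, 1:] \<in> infinite_place"
    unfolding infinite_place_def by (rule CollectI, intro exI[of _ 1] exI[of _ "[:0, 1:]"]) auto
  then have "\<iota> (Fract 1 [:0, 1:]) \<in> Q0" using Q0 by blast
  then have "em 1 / em [:0, 1:] \<in> Q0" unfolding iota_Fract .
  then have "inverse x \<in> Q0" unfolding x_def[symmetric] by (simp add: divide_inverse)
  then show "x \<notin> place_ring Q0" using x_nonzero by (simp add: place_ring_def)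
qed

end

section \<open>Counting\<close>

lemma card_polys_degree_le:
  "finite {p::'q::{field,finite} poly. degree p \<le> n} \<and> card {p::'q poly. degree p \<le> n} = CARD('q) ^ Suc n"
proof -
  let ?L = "{xs::'q list. set xs \<subseteq> UNIV \<and> length xs = Suc n}"
  have "bij_betw Poly ?L {p. degree p \<le> n}"
  proof (rule bij_betw_byWitness[where f' = "\<lambda>p. map (coeff p) [0..<Suc n]"])
    show "\<forall>xs\<in>?L. map (coeff (Poly xs)) [0..<Suc n] = xs"
      by (auto intro!: nth_equalityI simp: nth_default_def simp del: upt_Suc)
    show "\<forall>p\<in>{p::'q poly. degree p \<le> n}. Poly (map (coeff p) [0..<Suc n]) = p"
    proof
      fix p :: "'q poly" assume "p \<in> {p. degree p \<le> n}"
      then show "Poly (map (coeff p) [0..<Suc n]) = p"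
        by (intro poly_eqI) (auto simp: nth_default_def coeff_eq_0 simp del: upt_Suc)
    qed
    show "Poly ` ?L \<subseteq> {p. degree p \<le> n}"
    proof
      fix p assume "p \<in> Poly ` ?L"
      then obtain xs where "length xs = Suc n" "p = Poly xs" by auto
      then show "p \<in> {p. degree p \<le> n}"
        by (auto intro!: degree_le simp: nth_default_def)
    qed
  qed auto
  moreover have "finite ?L" "card ?L = CARD('q) ^ Suc n"
    using finite_lists_length_eq[of "UNIV :: 'q set" "Suc n"]
      card_lists_length_eq[of "UNIV :: 'q set" "Suc n"] by auto
  ultimately show ?thesis
    using bij_betw_finite[of Poly ?L] bij_betw_same_card[of Poly ?L] by metis
qed

lemma exponential_growth_le:
  fixes M Q K :: nat
  assumes "\<And>T. M ^ T \<le> K * Q ^ T" "Q > 0"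
  shows "M \<le> Q"
proof (rule ccontr)
  assume "\<not> M \<le> Q"
  then have "real M / real Q > 1" using assms(2) by simp
  from real_arch_pow[OF this, of "real K"] obtain T where "real K < (real M / real Q) ^ T" by blast
  then have "real K * real Q ^ T < real M ^ T" using assms(2) by (simp add: power_divide field_simps)
  then have "real (K * Q ^ T) < real (M ^ T)" by simp
  then have "K * Q ^ T < M ^ T" unfolding of_nat_less_iff .
  then show False using assms(1)[of T] by simp
qed

text \<open>An incongruent set of maximal size meets every class.\<close>

lemma ex_transversal:
  fixes V I :: "'f::field set"
  assumes I: "0 \<in> I" "\<And>z. z \<in> I \<Longrightarrow> - z \<in> I"
    and bound: "\<And>X. finite X \<Longrightarrow> X \<subseteq> V \<Longrightarrow> (\<And>r r'. r \<in> X \<Longrightarrow> r' \<in> X \<Longrightarrow> r - r' \<in> I \<Longrightarrow> r = r')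
                    \<Longrightarrow> card X \<le> B"
  shows "\<exists>X. finite X \<and> X \<subseteq> V \<and> (\<forall>r\<in>X. \<forall>r'\<in>X. r - r' \<in> I \<longrightarrow> r = r') \<and> (\<forall>z\<in>V. \<exists>r\<in>X. z - r \<in> I)"
proof -
  define good where "good X \<longleftrightarrow> finite X \<and> X \<subseteq> V \<and> (\<forall>r\<in>X. \<forall>r'\<in>X. r - r' \<in> I \<longrightarrow> r = r')" for X
  have "good {}" by (simp add: good_def)
  moreover have "\<forall>X. good X \<longrightarrow> card X < Suc B"
  proof (intro allI impI)
    fix X assume "good X"
    then have "card X \<le> B" by (intro bound) (auto simp: good_def)
    then show "card X < Suc B" by simp
  qed
  ultimately obtain X where X: "good X" "\<And>X'. good X' \<Longrightarrow> card X' \<le> card X"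
    using ex_has_greatest_nat[of good "{}" card "Suc B"] by auto
  have "\<exists>r\<in>X. z - r \<in> I" if z: "z \<in> V" for z
  proof (rule ccontr)
    assume H: "\<not> ?thesis"
    have "r - z \<notin> I" if "r \<in> X" for r
    proof
      assume "r - z \<in> I"
      from I(2)[OF this] show False using H that by simp
    qed
    with H have "good (insert z X)" using X(1) z by (auto simp: good_def)
    moreover have "z \<notin> X" using H I(1) by auto
    ultimately show False using X(2)[of "insert z X"] X(1) by (auto simp: good_def)
  qed
  then show ?thesis using X(1) unfolding good_def by (intro exI[of _ X]) simp
qed

lemma (in total_ring) ex_common_divisor:
  assumes "finite S" "S \<noteq> {}" shows "\<exists>t\<in>S. \<forall>s\<in>S. \<exists>v\<in>V. s = t * v"
  using assms
proof (induction S rule: finite_ne_induct)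
  case (singleton s)
  then show ?case using one_mem by (intro bexI[of _ s] ballI bexI[of _ 1]) simp_all
next
  case (insert s S)
  from insert.IH obtain t where t0: "t \<in> S" "\<forall>w\<in>S. \<exists>v\<in>V. w = t * v" by (rule bexE)
  have t: "t \<in> S" "\<And>w. w \<in> S \<Longrightarrow> \<exists>v\<in>V. w = t * v" using t0(1) bspec[OF t0(2)] .
  have "(\<exists>v\<in>V. s = t * v) \<or> (\<exists>v\<in>V. t = s * v)"
  proof (cases "s = 0 \<or> t = 0")
    case True
    then show ?thesis using zero_mem by (auto intro: bexI[of _ 0])
  next
    case False
    then consider "s * inverse t \<in> V" | "t * inverse s \<in> V"
      using total[of "s * inverse t"] by (auto simp: mult.commute)
    then show ?thesis
    proof cases
      case 1
      then show ?thesis using False by (intro disjI1 bexI[of _ "s * inverse t"]) auto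
    next
      case 2
      then show ?thesis using False by (intro disjI2 bexI[of _ "t * inverse s"]) auto
    qed
  qed
  then show ?case
  proof
    assume "\<exists>v\<in>V. s = t * v"
    then show ?thesis using t by (intro bexI[of _ t]) auto
  next
    assume "\<exists>v\<in>V. t = s * v"
    then obtain v where v: "v \<in> V" "t = s * v" by blast
    have "\<exists>v\<in>V. w = s * v" if "w \<in> insert s S" for w
    proof (cases "w = s")
      case True
      then show ?thesis using one_mem by (intro bexI[of _ 1]) auto
    next
      case False
      then have "w \<in> S" using that by simp
      from t(2)[OF this] obtain v' where "v' \<in> V" "w = t * v'" by (elim bexE)
      then show ?thesis using v mult_mem by (intro bexI[of _ "v * v'"]) (auto simp: mult.assoc)
    qed
    then show ?thesis by blast
  qed
qed

context superelliptic
begin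

definition bounded_combs :: "nat \<Rightarrow> 'f set" where
  "bounded_combs N = {comb C | C. \<forall>j<m. degree (C j) \<le> N}"

lemma comb_cong: "(\<And>j. j < m \<Longrightarrow> C j = C' j) \<Longrightarrow> comb C = comb C'"
  by (auto simp: comb_def)

lemma bounded_combs_eq: "bounded_combs N = comb ` ({..<m} \<rightarrow>\<^sub>E {p. degree p \<le> N})"
proof
  show "bounded_combs N \<subseteq> comb ` ({..<m} \<rightarrow>\<^sub>E {p. degree p \<le> N})"
  proof
    fix z assume "z \<in> bounded_combs N"
    then obtain C where C: "\<forall>j<m. degree (C j) \<le> N" "z = comb C" by (auto simp: bounded_combs_def)
    then have "z = comb (restrict C {..<m})" by (auto intro: comb_cong)
    moreover have "restrict C {..<m} \<in> {..<m} \<rightarrow>\<^sub>E {p. degree p \<le> N}" using C by auto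
    ultimately show "z \<in> comb ` ({..<m} \<rightarrow>\<^sub>E {p. degree p \<le> N})" by blast
  qed
qed (force simp: bounded_combs_def PiE_def)

lemma card_coefficients:
  "finite ({..<m} \<rightarrow>\<^sub>E {p::'q poly. degree p \<le> N})"
  "card ({..<m} \<rightarrow>\<^sub>E {p::'q poly. degree p \<le> N}) = CARD('q) ^ (m * Suc N)"
proof -
  note fin = card_polys_degree_le[where 'q = 'q and n = N]
  then show "finite ({..<m} \<rightarrow>\<^sub>E {p::'q poly. degree p \<le> N})" by (intro finite_PiE) auto
  have "card ({..<m} \<rightarrow>\<^sub>E {p::'q poly. degree p \<le> N}) = (CARD('q) ^ Suc N) ^ m"
    using fin by (simp add: card_PiE)
  then show "card ({..<m} \<rightarrow>\<^sub>E {p::'q poly. degree p \<le> N}) = CARD('q) ^ (m * Suc N)"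
    by (simp add: power_mult[symmetric] mult.commute del: power_Suc)
qed

lemma card_bounded_combs: "finite (bounded_combs N)" "card (bounded_combs N) \<le> CARD('q) ^ (m * Suc N)"
  unfolding bounded_combs_eq using card_coefficients card_image_le by (blast, metis)

lemma bounded_combs_mono: "z \<in> bounded_combs N \<Longrightarrow> N \<le> N' \<Longrightarrow> z \<in> bounded_combs N'"
  unfolding bounded_combs_def by (auto intro: le_trans)

lemma bounded_combs_add: "z \<in> bounded_combs N \<Longrightarrow> w \<in> bounded_combs N \<Longrightarrow> z + w \<in> bounded_combs N"
proof -
  assume "z \<in> bounded_combs N" "w \<in> bounded_combs N"
  then obtain C C' where "\<forall>j<m. degree (C j) \<le> N" "z = comb C" "\<forall>j<m. degree (C' j) \<le> N" "w = comb C'"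
    by (auto simp: bounded_combs_def)
  then show ?thesis unfolding bounded_combs_def comb_add
    by (intro CollectI exI[of _ "\<lambda>j. C j + C' j"]) (auto simp: comb_add intro: degree_add_le)
qed

lemma bounded_combs_mult: "z \<in> bounded_combs N \<Longrightarrow> em p * z \<in> bounded_combs (N + degree p)"
proof -
  assume "z \<in> bounded_combs N"
  then obtain C where "\<forall>j<m. degree (C j) \<le> N" "z = comb C" by (auto simp: bounded_combs_def)
  then show ?thesis unfolding bounded_combs_def
    by (intro CollectI exI[of _ "\<lambda>j. p * C j"])
       (auto simp: comb_mult intro!: order.trans[OF degree_mult_le])
qed

lemma common_denominator: "finite X \<Longrightarrow> \<exists>d N. d \<noteq> 0 \<and> (\<forall>b\<in>X. em d * b \<in> bounded_combs N)"
proof (induction X rule: finite_induct)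
  case empty
  show ?case by (intro exI[of _ 1]) auto
next
  case (insert b X)
  then obtain d N where d: "d \<noteq> 0" "\<And>b. b \<in> X \<Longrightarrow> em d * b \<in> bounded_combs N" by blast
  obtain C d' where C: "d' \<noteq> 0" "b = comb C / em d'" using representation by blast
  define N' where "N' = (\<Sum>j<m. degree (C j))"
  have "\<forall>j<m. degree (C j) \<le> N'" unfolding N'_def by (auto intro!: member_le_sum)
  then have "comb C \<in> bounded_combs N'" unfolding bounded_combs_def by blast
  from bounded_combs_mult[OF this, of d] have 1: "em (d * d') * b \<in> bounded_combs (N' + degree d)"
    using C by simp
  have 2: "em (d * d') * b' \<in> bounded_combs (N + degree d')" if "b' \<in> X" for b'
    using bounded_combs_mult[OF d(2)[OF that], of d'] by (simp add: mult_ac)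
  have "\<forall>b'\<in>insert b X. em (d * d') * b' \<in> bounded_combs (N + degree d' + (N' + degree d))"
    using bounded_combs_mono[OF 1] bounded_combs_mono[OF 2] by auto
  moreover have "d * d' \<noteq> 0" using d C by simp
  ultimately show ?case by blast
qed

text \<open>
  Expansions \<open>b\<^sub>0 + b\<^sub>1 w + \<dots> + b\<^sub>T\<^sub>-\<^sub>1 w\<^sup>T\<^sup>-\<^sup>1\<close> with digits in \<open>X\<close> are pairwise distinct, and up to a fixed
  denominator they are combinations of \<open>1, y, \<dots>, y\<^sup>m\<^sup>-\<^sup>1\<close> with coefficients of degree at most
  \<open>T deg w + N\<close>. Counting both sides for \<open>T \<rightarrow> \<infinity>\<close> bounds the number of digits.
\<close>

lemma card_incongruent_le:
  assumes "ring_in_field V" "em w \<in> V" "w \<noteq> 0" "finite X" "X \<subseteq> V"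
    and incongruent: "\<And>b b' s. b \<in> X \<Longrightarrow> b' \<in> X \<Longrightarrow> s \<in> V \<Longrightarrow> b - b' = em w * s \<Longrightarrow> b = b'"
  shows "card X \<le> CARD('q) ^ (m * degree w)"
proof -
  interpret ring_in_field V by fact
  obtain d N where d: "d \<noteq> 0" "\<And>b. b \<in> X \<Longrightarrow> em d * b \<in> bounded_combs N"
    using common_denominator[OF assms(4)] by blast
  have ex: "\<exists>Y. finite Y \<and> card Y = card X ^ T \<and> Y \<subseteq> V
      \<and> (\<forall>s\<in>Y. em d * s \<in> bounded_combs (N + T * degree w))" for T
  proof (induction T)
    case 0
    have "comb (\<lambda>_. 0) \<in> bounded_combs N" unfolding bounded_combs_def by (intro CollectI exI conjI refl) auto
    then show ?case by (intro exI[of _ "{0}"]) (auto simp: zero_mem comb_def)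
  next
    case (Suc T)
    then obtain Y where Y: "finite Y" "card Y = card X ^ T" "Y \<subseteq> V"
      "\<And>s. s \<in> Y \<Longrightarrow> em d * s \<in> bounded_combs (N + T * degree w)" by blast
    define h where "h = (\<lambda>(b, s). b + em w * s)"
    have "inj_on h (X \<times> Y)"
    proof (rule inj_onI, clarify)
      fix b s b' s' assume H: "b \<in> X" "s \<in> Y" "b' \<in> X" "s' \<in> Y" "h (b, s) = h (b', s')"
      have e: "b - b' = em w * (s' - s)" using H(5) by (simp add: h_def algebra_simps)
      have "s' - s \<in> V" using H Y by (auto intro: diff_mem)
      from incongruent[OF H(1,3) this e] have "b = b'" .
      then show "b = b' \<and> s = s'" using e assms(3) by simp
    qed
    then have "card (h ` (X \<times> Y)) = card X ^ Suc T" using Y by (simp add: card_image card_cartesian_product)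
    moreover have "finite (h ` (X \<times> Y))" using Y assms by auto
    moreover have "h ` (X \<times> Y) \<subseteq> V" using Y assms by (auto simp: h_def intro!: add_mem mult_mem)
    moreover have "em d * z \<in> bounded_combs (N + Suc T * degree w)" if "z \<in> h ` (X \<times> Y)" for z
    proof -
      from that obtain bs where "z = h bs" "bs \<in> X \<times> Y" by (rule imageE)
      then obtain b s where bs: "b \<in> X" "s \<in> Y" "z = b + em w * s" by (cases bs) (auto simp: h_def)
      have "em d * z = em d * b + em w * (em d * s)" using bs by (simp add: algebra_simps)
      moreover have "em d * b \<in> bounded_combs (N + Suc T * degree w)"
        using bounded_combs_mono[OF d(2)[OF bs(1)]] by simp
      moreover have "em w * (em d * s) \<in> bounded_combs (N + Suc T * degree w)"
        using bounded_combs_mult[OF Y(4)[OF bs(2)], of w] by (simp add: add_ac)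
      ultimately show ?thesis using bounded_combs_add by simp
    qed
    ultimately show ?case by blast
  qed
  have "card X ^ T \<le> CARD('q) ^ (m * Suc N) * (CARD('q) ^ (m * degree w)) ^ T" for T
  proof -
    obtain Y where "finite Y \<and> card Y = card X ^ T \<and> Y \<subseteq> V
      \<and> (\<forall>s\<in>Y. em d * s \<in> bounded_combs (N + T * degree w))" using ex[of T] by (rule exE)
    then have Y: "finite Y" "card Y = card X ^ T" "Y \<subseteq> V"
      "\<And>s. s \<in> Y \<Longrightarrow> em d * s \<in> bounded_combs (N + T * degree w)" by simp_all
    have "card Y \<le> card (bounded_combs (N + T * degree w))"
      by (rule card_inj_on_le[of "\<lambda>s. em d * s"]) (use Y d card_bounded_combs in \<open>auto simp: inj_on_def\<close>)
    also have "\<dots> \<le> CARD('q) ^ (m * Suc (N + T * degree w))" by (rule card_bounded_combs)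
    also have "m * Suc (N + T * degree w) = m * Suc N + (m * degree w) * T" by (simp add: algebra_simps)
    finally show ?thesis using Y by (simp add: power_add power_mult)
  qed
  then show ?thesis by (rule exponential_growth_le) simp
qed

subsection \<open>Places at which x is regular\<close>

context
  fixes P assumes P: "P \<in> places c" and x_regular: "x \<in> place_ring P"
begin

interpretation total_ring "place_ring P"
  using place_props[OF P] by simp

lemma fin_em_mem: "em p \<in> place_ring P"
proof (induction p)
  case (pCons a p)
  then show ?case using place_props(3)[OF P] x_regular by (auto intro!: add_mem mult_mem)
qed (simp add: zero_mem)

lemma fin_y_mem: "y \<in> place_ring P"
  using root_mem[of y m] y_power_em fin_em_mem m_pos by simp

lemma fin_comb_mem: "comb C \<in> place_ring P"
  unfolding comb_def by (intro sum_mem mult_mem power_mem fin_em_mem fin_y_mem)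

text \<open>
  Otherwise all nonzero polynomials in \<open>x\<close> would be units of the valuation ring, which would then
  contain all quotients \<open>comb C / em d\<close>.
\<close>

lemma fin_ex_poly: "\<exists>p. p \<noteq> 0 \<and> em p \<in> P"
proof (rule ccontr)
  assume H: "\<not> ?thesis"
  have "z \<in> place_ring P" for z
  proof -
    obtain C d where z: "d \<noteq> 0" "z = comb C / em d" using representation by blast
    then have "em d \<notin> P" using H by blast
    then have "inverse (em d) \<in> place_ring P"
      using unit_or_nonunit[OF fin_em_mem[of d]] place_props(2)[OF P] by (auto simp: unit_in_def)
    then show ?thesis unfolding z divide_inverse by (intro mult_mem fin_comb_mem)
  qed
  then show False using place_props(4)[OF P] by auto
qed

lemma fin_prime: "\<exists>w. w \<noteq> 0 \<and> em w \<in> P \<and> (\<forall>p. p \<noteq> 0 \<longrightarrow> degree p < degree w \<longrightarrow> em p \<notin> P)"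
  using ex_has_least_nat[of "\<lambda>p. p \<noteq> 0 \<and> em p \<in> P" _ degree] fin_ex_poly
  by (metis (no_types, lifting) linorder_not_less)

text \<open>
  The remainder of a division by \<open>w\<close> has smaller degree than \<open>w\<close>, so it is \<open>0\<close> or a unit.
\<close>

lemma fin_poly_power:
  assumes w: "w \<noteq> 0" "em w \<in> P" "\<And>p. p \<noteq> 0 \<Longrightarrow> degree p < degree w \<Longrightarrow> em p \<notin> P"
  shows "p \<noteq> 0 \<Longrightarrow> \<exists>k u. unit_in (place_ring P) u \<and> em p = em w ^ k * u"
proof (induction "degree p" arbitrary: p rule: less_induct)
  case less
  have wd: "degree w > 0"
  proof (rule ccontr)
    assume "\<not> ?thesis"
    then obtain a where a: "w = [:a:]" by (auto elim: degree_eq_zeroE)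
    then have "inverse (c a) \<in> place_ring P" using place_props(3)[OF P] c_inverse[of a] by (metis range_subsetD)
    moreover have "c a \<noteq> 0" "c a \<in> nonunits (place_ring P)" using w a place_props(2)[OF P] by auto
    ultimately show False unfolding nonunits_def by blast
  qed
  show ?case
  proof (cases "em p \<in> P")
    case False
    then have "unit_in (place_ring P) (em p)"
      using unit_or_nonunit[OF fin_em_mem[of p]] place_props(2)[OF P] by auto
    then show ?thesis by (intro exI[of _ 0] exI[of _ "em p"]) auto
  next
    case True
    have dm: "p = w * (p div w) + p mod w" by simp
    then have "em (p mod w) = em p - em w * em (p div w)" by (metis em_add em_mult add_diff_cancel_left')
    also have "\<dots> \<in> P"
      using True w nonunits_diff[OF _ nonunits_mult[OF _ fin_em_mem]] unfolding place_props(2)[OF P] by blast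
    finally have "p mod w = 0" using w(3)[of "p mod w"] degree_mod_less[of w p] w(1) by auto
    then have p: "p = w * (p div w)" using dm by simp
    then have nz: "p div w \<noteq> 0" using less.prems by auto
    have "degree p = degree w + degree (p div w)" using p nz w(1) by (metis degree_mult_eq)
    then obtain k u where "unit_in (place_ring P) u" "em (p div w) = em w ^ k * u"
      using less.hyps[of "p div w"] nz wd by auto
    moreover have "em p = em w * em (p div w)" using p by (metis em_mult)
    ultimately show ?thesis by (intro exI[of _ "Suc k"] exI[of _ u]) auto
  qed
qed

text \<open>
  By \<open>card_incongruent_le\<close> there are only finitely many residue classes modulo any power of a
  polynomial \<open>w\<close> in \<open>P\<close>. So the maximal ideal is finitely generated, hence principal in a valuation
  ring. Every nonzero element of the ring divides a power of \<open>w\<close>, and modulo this power the powers of the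
  generator that divide the element are pairwise incongruent; so only finitely many of them divide it.
\<close>

lemma fin_uniformized_residues: "(\<exists>t. uniformized (place_ring P) t) \<and> (\<exists>Z. residue_system P Z)"
proof -
  let ?V = "place_ring P"
  obtain w where w: "w \<noteq> 0" "em w \<in> P" "\<And>p. p \<noteq> 0 \<Longrightarrow> degree p < degree w \<Longrightarrow> em p \<notin> P"
    using fin_prime by blast
  have nP: "nonunits ?V = P" by (rule place_props(2)[OF P])
  have card_le: "card X \<le> CARD('q) ^ (m * degree w')"
    if "w' \<noteq> 0" "finite X" "X \<subseteq> ?V"
      "\<And>r r'. r \<in> X \<Longrightarrow> r' \<in> X \<Longrightarrow> r - r' \<in> (*) (em w') ` ?V \<Longrightarrow> r = r'" for X w'
    by (rule card_incongruent_le[of ?V w' X])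
       (use that fin_em_mem ring_in_field_axioms in auto)
  have "\<exists>X. finite X \<and> X \<subseteq> ?V \<and> (\<forall>r\<in>X. \<forall>r'\<in>X. r - r' \<in> (*) (em w) ` ?V \<longrightarrow> r = r')
            \<and> (\<forall>z\<in>?V. \<exists>r\<in>X. z - r \<in> (*) (em w) ` ?V)"
  proof (rule ex_transversal)
    show "0 \<in> (*) (em w) ` ?V" using zero_mem by force
    show "- z \<in> (*) (em w) ` ?V" if "z \<in> (*) (em w) ` ?V" for z
    proof -
      obtain v where "v \<in> ?V" "z = em w * v" using \<open>z \<in> (*) (em w) ` ?V\<close> by (rule imageE)
      then show ?thesis by (intro image_eqI[of _ _ "- v"] minus_mem) simp_all
    qed
    fix X assume "finite X" "X \<subseteq> ?V" "\<And>r r'. r \<in> X \<Longrightarrow> r' \<in> X \<Longrightarrow> r - r' \<in> (*) (em w) ` ?V \<Longrightarrow> r = r'"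
    then show "card X \<le> CARD('q) ^ (m * degree w)" by (rule card_le[OF w(1)])
  qed
  then obtain X where "finite X \<and> X \<subseteq> ?V \<and> (\<forall>r\<in>X. \<forall>r'\<in>X. r - r' \<in> (*) (em w) ` ?V \<longrightarrow> r = r')
            \<and> (\<forall>z\<in>?V. \<exists>r\<in>X. z - r \<in> (*) (em w) ` ?V)" by (rule exE)
  then have X: "finite X" "X \<subseteq> ?V" "\<And>z. z \<in> ?V \<Longrightarrow> \<exists>r\<in>X. z - r \<in> (*) (em w) ` ?V" by simp_all
  have wmult: "em w * v \<in> P" if "v \<in> ?V" for v
    using nonunits_mult[of "em w" v] that w nP by simp
  have "\<exists>X. finite X \<and> X \<subseteq> ?V \<and> (\<forall>r\<in>X. \<forall>r'\<in>X. r - r' \<in> P \<longrightarrow> r = r') \<and> (\<forall>z\<in>?V. \<exists>r\<in>X. z - r \<in> P)"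
  proof (rule ex_transversal)
    show "0 \<in> P" "\<And>z. z \<in> P \<Longrightarrow> - z \<in> P" using zero_nonunit nonunits_minus unfolding nP by auto
    fix X assume X': "finite X" "X \<subseteq> ?V" "\<And>r r'. r \<in> X \<Longrightarrow> r' \<in> X \<Longrightarrow> r - r' \<in> P \<Longrightarrow> r = r'"
    show "card X \<le> CARD('q) ^ (m * degree w)"
      by (rule card_le[OF w(1) X'(1,2)]) (use X'(3) wmult in auto)
  qed
  then obtain Z where "finite Z \<and> Z \<subseteq> ?V \<and> (\<forall>r\<in>Z. \<forall>r'\<in>Z. r - r' \<in> P \<longrightarrow> r = r')
    \<and> (\<forall>z\<in>?V. \<exists>r\<in>Z. z - r \<in> P)" by (rule exE)
  then have Z: "finite Z" "Z \<subseteq> ?V" "\<And>r r'. r \<in> Z \<Longrightarrow> r' \<in> Z \<Longrightarrow> r - r' \<in> P \<Longrightarrow> r = r'"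
    "\<And>z. z \<in> ?V \<Longrightarrow> \<exists>r\<in>Z. z - r \<in> P" by simp_all
  have "residue_system P Z"
    unfolding residue_system_def
  proof (intro conjI ballI)
    fix z assume "z \<in> ?V"
    from Z(4)[OF this] obtain r where r: "r \<in> Z" "z - r \<in> P" by (elim bexE)
    show "\<exists>!r. r \<in> Z \<and> z - r \<in> P"
    proof (rule ex1I[of _ r])
      fix s assume s: "s \<in> Z \<and> z - s \<in> P"
      then have "(z - r) - (z - s) \<in> P" using r nonunits_diff unfolding nP by blast
      then show "s = r" using Z(3)[of s r] s r by simp
    qed (use r in auto)
  qed (use Z(1,2) in auto)
  moreover
  (* P is generated by em w and finitely many representatives, hence by one of them. *)
  have "\<exists>t\<in>insert (em w) (X \<inter> P). \<forall>s\<in>insert (em w) (X \<inter> P). \<exists>v\<in>?V. s = t * v"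
    using X(1) by (intro ex_common_divisor) auto
  then obtain t where t0: "t \<in> insert (em w) (X \<inter> P)" "\<forall>s\<in>insert (em w) (X \<inter> P). \<exists>v\<in>?V. s = t * v"
    by (rule bexE)
  have t: "t \<in> insert (em w) (X \<inter> P)" "\<And>s. s \<in> insert (em w) (X \<inter> P) \<Longrightarrow> \<exists>v\<in>?V. s = t * v"
    using t0(1) bspec[OF t0(2)] .
  have tP: "t \<in> P" using t w by auto
  have t0: "t \<noteq> 0" using t(2)[of "em w"] w by auto
  have Pt: "\<exists>v\<in>?V. z = t * v" if "z \<in> P" for z
  proof -
    have "z \<in> ?V" using that nP by (auto simp: nonunits_def)
    then obtain r v where r: "r \<in> X" "v \<in> ?V" "z - r = em w * v" using X(3) by blast
    have "z - em w * v \<in> P" using nonunits_diff that wmult[OF r(2)] unfolding nP by blast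
    then have "r \<in> P" using r(3) by (metis diff_diff_eq2 add_diff_cancel_left')
    then obtain v1 v2 where "v1 \<in> ?V" "r = t * v1" "v2 \<in> ?V" "em w = t * v2"
      using t(2)[of r] t(2)[of "em w"] r(1) by blast
    then show ?thesis using r by (intro bexI[of _ "v1 + v2 * v"]) (auto simp: algebra_simps intro: add_mem mult_mem)
  qed
  interpret pre_uniformized ?V t by unfold_locales (use t0 tP nP in auto)
  have mem_order: "\<exists>n. has_order ?V t n z" if z: "z \<in> ?V" "z \<noteq> 0" for z
  proof -
    obtain C d where C: "d \<noteq> 0" "inverse z = comb C / em d" using representation by blast
    obtain k u where u: "unit_in ?V u" "em d = em w ^ k * u" using fin_poly_power[OF w C(1)] by blast
    have "em (w ^ k) = z * (comb C * inverse u)"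
    proof -
      have "z * inverse z = 1" using z by simp
      then have "z * comb C = em d" unfolding C(2) using C(1) by (simp add: field_simps)
      then have "z * (comb C * inverse u) = em w ^ k * (u * inverse u)"
        by (simp only: u(2) mult.assoc[symmetric])
      moreover have "u * inverse u = 1" using u(1) by (simp add: unit_in_def)
      ultimately show ?thesis by (simp only: em_power mult.right_neutral)
    qed
    moreover have "comb C * inverse u \<in> ?V" using u by (intro mult_mem fin_comb_mem) (auto simp: unit_in_def)
    ultimately obtain v where v: "v \<in> ?V" "em (w ^ k) = z * v" by blast
    have bound: "N \<le> CARD('q) ^ (m * degree (w ^ k))" if N: "z / t ^ N \<in> ?V" for N
    proof -
      have eq: "i = j" if "i < N" "j < N" "t ^ i - t ^ j \<in> (*) (em (w ^ k)) ` ?V" for i j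
      proof -
        have False if ij: "i < j" "j < N" "t ^ i - t ^ j = em (w ^ k) * s" "s \<in> ?V" for i j s
        proof -
          have tN: "t ^ N = t ^ i * t ^ (N - i)" and tj: "t ^ j = t ^ i * t ^ (j - i)"
            using ij by (simp_all flip: power_add)
          define r where "r = (z / t ^ N) * v * s"
          have "t ^ i * (1 - t ^ (j - i)) = t ^ i - t ^ j" by (simp only: right_diff_distrib tj mult_1_right)
          also have "\<dots> = t ^ N * r" using ij(3) v t0 by (simp add: r_def)
          finally have "t ^ i * (1 - t ^ (j - i)) = t ^ i * (t ^ (N - i) * r)"
            unfolding tN by (simp only: mult.assoc)
          then have e: "1 - t ^ (j - i) = t ^ (N - i) * r" using t0 by simp
          have "t ^ (N - i) * r \<in> nonunits ?V"
            unfolding r_def by (intro nonunits_mult power_nonunit t_nonunit mult_mem N v ij(4)) (use ij in auto)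
          then have "(1 - t ^ (j - i)) + t ^ (j - i) \<in> nonunits ?V"
            unfolding e[symmetric] using ij by (intro nonunits_add power_nonunit t_nonunit) auto
          then show False using one_not_nonunit by simp
        qed
        note F = this
        from that(3) obtain s where s: "t ^ i - t ^ j = em (w ^ k) * s" "s \<in> ?V" by (rule imageE)
        then have "t ^ j - t ^ i = em (w ^ k) * (- s)" "- s \<in> ?V" using minus_mem by (auto simp: algebra_simps)
        then show ?thesis using F[of i j s] F[of j i "- s"] s that by (metis linorder_neqE_nat)
      qed
      have z0: "0 \<in> (*) (em (w ^ k)) ` ?V" using zero_mem by force
      have "inj_on (\<lambda>i. t ^ i) {..<N}" by (rule inj_onI) (use eq z0 in auto)
      then have "N = card ((\<lambda>i. t ^ i) ` {..<N})" by (simp add: card_image)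
      also have "\<dots> \<le> CARD('q) ^ (m * degree (w ^ k))"
      proof (rule card_le)
        show "w ^ k \<noteq> 0" using w by simp
        show "(\<lambda>i. t ^ i) ` {..<N} \<subseteq> ?V" using tP nP by (auto intro!: power_mem simp: nonunits_def)
      qed (use eq in auto)
      finally show ?thesis .
    qed
    have "z / t ^ 0 \<in> ?V" using z by simp
    moreover have "\<forall>N. z / t ^ N \<in> ?V \<longrightarrow> N < Suc (CARD('q) ^ (m * degree (w ^ k)))"
      using bound less_Suc_eq_le by simp
    ultimately obtain N where N: "z / t ^ N \<in> ?V" "\<And>N'. z / t ^ N' \<in> ?V \<Longrightarrow> N' \<le> N"
      using ex_has_greatest_nat[of "\<lambda>N. z / t ^ N \<in> ?V" 0 "\<lambda>N. N"
          "Suc (CARD('q) ^ (m * degree (w ^ k)))"] by auto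
    have "unit_in ?V (z / t ^ N)"
    proof (rule ccontr)
      assume "\<not> ?thesis"
      then have "z / t ^ N \<in> P" using N unit_or_nonunit nP by blast
      then obtain v where "v \<in> ?V" "z / t ^ N = t * v" using Pt by blast
      then have "z / t ^ Suc N \<in> ?V" using t0 by (simp add: field_simps)
      from N(2)[OF this] show False by simp
    qed
    then show ?thesis using t0 unfolding has_order_def by (intro exI[of _ "int N"] exI[of _ "z / t ^ N"]) auto
  qed
  have "uniformized ?V t"
  proof
    fix z :: 'f assume z: "z \<noteq> 0"
    show "\<exists>n. has_order ?V t n z"
    proof (cases "z \<in> ?V")
      case True
      then show ?thesis using mem_order z by blast
    next
      case False
      then have "inverse z \<in> ?V" using total by blast
      moreover have "inverse z \<noteq> 0" using z by simp
      ultimately obtain n where "has_order ?V t n (inverse z)" using mem_order by blast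
      from has_order_inverse[OF this] show ?thesis by auto
    qed
  qed
  ultimately show ?thesis by blast
qed

end

end

section \<open>The place at infinity\<close>

context superelliptic
begin

lemma Q0_discrete: "discrete_place Q0"
  by (rule inf_discrete[OF Q0_place Q0_pole])

interpretation Q0: discrete_place Q0
  by (rule Q0_discrete)

lemmas Q0_val_y = inf_val_y[OF Q0_place Q0_pole]
  and Q0_val_em = inf_val_em[OF Q0_place Q0_pole]

lemma Q0_val_term:
  "p \<noteq> 0 \<Longrightarrow> valuation Q0 (em p * y ^ j) = - (int m * int (degree p) + int (degree f) * int j)"
  using y_nonzero by (simp add: Q0.val_mult Q0.val_power Q0_val_em Q0_val_y)

text \<open>The orders of the summands at infinity are pairwise incongruent modulo \<open>m\<close>.\<close>

lemma Q0_val_comb: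
  assumes "j0 < m" "C j0 \<noteq> 0"
  shows "comb C \<noteq> 0"
    and "\<exists>j<m. C j \<noteq> 0 \<and> valuation Q0 (comb C) = - (int m * int (degree (C j)) + int (degree f) * int j)"
    and "\<And>j. j < m \<Longrightarrow> C j \<noteq> 0 \<Longrightarrow>
           valuation Q0 (comb C) \<le> - (int m * int (degree (C j)) + int (degree f) * int j)"
proof -
  define J where "J = {j. j < m \<and> C j \<noteq> 0}"
  have eq: "comb C = (\<Sum>j\<in>J. em (C j) * y ^ j)"
    unfolding comb_def J_def by (intro sum.mono_neutral_right) auto
  have v: "valuation Q0 (em (C j) * y ^ j) = - (int m * int (degree (C j)) + int (degree f) * int j)"
    if "j \<in> J" for j using that Q0_val_term by (simp add: J_def)
  have "(\<Sum>j\<in>J. em (C j) * y ^ j) \<noteq> 0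
      \<and> (\<exists>j\<in>J. valuation Q0 (\<Sum>j\<in>J. em (C j) * y ^ j) = valuation Q0 (em (C j) * y ^ j))
      \<and> (\<forall>j\<in>J. valuation Q0 (\<Sum>j\<in>J. em (C j) * y ^ j) \<le> valuation Q0 (em (C j) * y ^ j))"
  proof (rule Q0.val_sum_distinct)
    show "finite J" "J \<noteq> {}" using assms by (auto simp: J_def)
    show "inj_on (\<lambda>j. valuation Q0 (em (C j) * y ^ j)) J"
    proof (rule inj_onI)
      fix j j' assume H: "j \<in> J" "j' \<in> J"
        "valuation Q0 (em (C j) * y ^ j) = valuation Q0 (em (C j') * y ^ j')"
      show "j = j'"
        by (rule coprime_orders[of "int (degree (C j))" j "int (degree (C j'))" j'])
           (use H v in \<open>auto simp: J_def\<close>)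
    qed
    show "em (C j) * y ^ j \<noteq> 0" if "j \<in> J" for j using that y_nonzero by (simp add: J_def)
  qed
  note * = this[folded eq]
  show "comb C \<noteq> 0" using * by simp
  obtain j where "j \<in> J" "valuation Q0 (comb C) = valuation Q0 (em (C j) * y ^ j)" using * by auto
  then show "\<exists>j<m. C j \<noteq> 0 \<and> valuation Q0 (comb C) = - (int m * int (degree (C j)) + int (degree f) * int j)"
    using v[of j] by (intro exI[of _ j]) (simp add: J_def)
  show "valuation Q0 (comb C) \<le> - (int m * int (degree (C j)) + int (degree f) * int j)"
    if "j < m" "C j \<noteq> 0" for j
  proof -
    have "j \<in> J" using that by (simp add: J_def)
    then show ?thesis using * v[of j] by auto
  qed
qed

text \<open>
  In a quotient of \<open>comb C\<close> by \<open>em d\<close> that is regular at infinity, only the summand with \<open>j = 0\<close> can have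
  order \<open>0\<close>, because the orders of \<open>y, \<dots>, y\<^sup>m\<^sup>-\<^sup>1\<close> are not divisible by \<open>m\<close>.
\<close>

lemma Q0_residue: assumes "z \<in> place_ring Q0" shows "\<exists>a. z - c a \<in> Q0"
proof -
  obtain C d where z: "d \<noteq> 0" "z = comb C / em d" using representation by blast
  let ?n = "- (int m * int (degree d))"
  show ?thesis
  proof (cases "comb C = 0")
    case True
    then show ?thesis using z Q0.zero_in_place by (intro exI[of _ 0]) simp
  next
    case False
    then have z0: "z \<noteq> 0" using z by simp
    have "comb C = z * em d" using z by simp
    then have "valuation Q0 (comb C) = valuation Q0 z + ?n"
      using Q0.val_mult[OF z0, of "em d"] z Q0_val_em[OF z(1)] by simp
    then have vC: "valuation Q0 (comb C) \<ge> ?n" using Q0.val_ring[OF z0] assms by simp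
    have le: "int m * int (degree (C j)) + int (degree f) * int j \<le> int m * int (degree d)"
      if "j < m" "C j \<noteq> 0" for j
      using Q0_val_comb(3)[of j C j] that vC by linarith
    define a where "a = coeff (C 0) (degree d) / lead_coeff d"
    have term0: "order_ge Q0 (?n + 1) (em (C 0 - smult a d))"
    proof -
      have "degree (C 0) \<le> degree d"
        using le[of 0] m_pos by (cases "C 0 = 0") auto
      then have "degree (C 0 - smult a d) \<le> degree d" by (intro degree_diff_le) auto
      moreover have "coeff (C 0 - smult a d) (degree d) = 0" using z by (simp add: a_def)
      ultimately consider "C 0 - smult a d = 0" | "degree (C 0 - smult a d) < degree d" "C 0 - smult a d \<noteq> 0"
        using eq_zero_or_degree_less by blast
      then show ?thesis
      proof cases
        case 2
        then have "int m * int (degree (C 0 - smult a d)) + int m * 1 \<le> int m * int (degree d)"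
          unfolding distrib_left[symmetric] by (intro mult_left_mono) auto
        then show ?thesis using 2 Q0_val_em[OF 2(2)] m_pos by (simp only: order_ge_def) linarith
      qed (simp only: em_0 Q0.order_ge_0)
    qed
    have termj: "order_ge Q0 (?n + 1) (em (C j) * y ^ j)" if j: "j \<in> {..<m} - {0}" for j
    proof (cases "C j = 0")
      case False
      have "int m * int (degree (C j)) + int (degree f) * int j \<noteq> int m * int (degree d)"
        using coprime_orders[of "int (degree (C j))" j "int (degree d)" 0] j by auto
      then show ?thesis using le[of j] j False Q0_val_term[of "C j" j] by (simp add: order_ge_def)
    qed simp
    have "comb C = em (C 0) * y ^ 0 + (\<Sum>j\<in>{..<m} - {0}. em (C j) * y ^ j)"
      unfolding comb_def using m_pos by (intro sum.remove) auto
    then have eq: "comb C - c a * em d = em (C 0 - smult a d) + (\<Sum>j\<in>{..<m} - {0}. em (C j) * y ^ j)" by simp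
    have "order_ge Q0 (?n + 1) (\<Sum>j\<in>{..<m} - {0}. em (C j) * y ^ j)"
      by (rule Q0.order_ge_sum) (rule termj)
    then have "order_ge Q0 (?n + 1) (comb C - c a * em d)"
      unfolding eq by (rule Q0.order_ge_add[OF term0])
    moreover have "comb C - c a * em d = (z - c a) * em d" using z by (simp add: algebra_simps)
    ultimately have "order_ge Q0 1 (z - c a)"
      using Q0.order_ge_mult_iff[of "em d" "?n + 1" "z - c a"] z Q0_val_em[OF z(1)] by simp
    then show ?thesis using Q0.order_ge_place by blast
  qed
qed

lemma place_const: assumes "P \<in> places c" shows "c a \<in> P \<longleftrightarrow> a = 0"
proof
  assume a: "c a \<in> P"
  show "a = 0"
  proof (rule ccontr)
    assume "a \<noteq> 0"
    have "inverse (c a) \<in> place_ring P" using place_props(3)[OF assms] c_inverse[of a] by (metis range_subsetD)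
    moreover have "c a \<in> nonunits (place_ring P)" using a place_props(2)[OF assms] by simp
    ultimately show False using \<open>a \<noteq> 0\<close> unfolding nonunits_def by simp
  qed
next
  assume "a = 0"
  interpret total_ring "place_ring P" using place_props[OF assms] by simp
  show "c a \<in> P" using zero_nonunit place_props(2)[OF assms] \<open>a = 0\<close> by simp
qed

lemma place_residue_unique:
  assumes "P \<in> places c" "z - c a \<in> P" "z - c b \<in> P" shows "a = b"
proof -
  interpret total_ring "place_ring P" using place_props[OF assms(1)] by simp
  have "(z - c b) - (z - c a) \<in> P"
    using nonunits_diff assms(2,3) unfolding place_props(2)[OF assms(1)] by blast
  then have "c (a - b) \<in> P" by simp
  then show ?thesis unfolding place_const[OF assms(1)] by simp
qed

lemma residue_system_range: 
  assumes "P \<in> places c" "\<And>z. z \<in> place_ring P \<Longrightarrow> \<exists>a. z - c a \<in> P"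
  shows "residue_system P (range c)"
  unfolding residue_system_def
proof (intro conjI ballI)
  fix z assume "z \<in> place_ring P"
  then obtain a where a: "z - c a \<in> P" using assms(2) by blast
  show "\<exists>!r. r \<in> range c \<and> z - r \<in> P"
  proof (rule ex1I[of _ "c a"])
    fix r assume "r \<in> range c \<and> z - r \<in> P"
    then obtain b where "r = c b" "z - c b \<in> P" by auto
    then show "r = c a" using place_residue_unique[OF assms(1) a] by simp
  qed (use a in auto)
qed (use place_props(3)[OF assms(1)] in auto)

lemma place_discrete: assumes "P \<in> places c" shows "discrete_place P"
proof (cases "x \<in> place_ring P")
  case True
  show ?thesis
    using fin_uniformized_residues[OF assms True] place_props(2)[OF assms] by unfold_locales auto
qed (use inf_discrete assms in auto)

lemma ex_residue_system: assumes "P \<in> places c" shows "\<exists>Z. residue_system P Z"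
proof (cases "x \<in> place_ring P")
  case True
  then show ?thesis using fin_uniformized_residues assms by blast
next
  case False
  then have "P = Q0" using inf_unique assms by blast
  then show ?thesis using residue_system_range[OF Q0_place Q0_residue] by blast
qed

lemma residue_system_card: assumes "P \<in> places c" "residue_system P Z"
  shows "card Z = CARD('q) ^ place_degree c P"
  using place_degree_residue_system[OF place_discrete[OF assms(1)] place_props(3)[OF assms(1)] assms(2)] .

lemma degree_pos: assumes "P \<in> places c" shows "place_degree c P > 0"
  using place_degree_pos[OF place_discrete place_props(3)] ex_residue_system assms by blast

lemma power_card_le_iff: "CARD('q) ^ i \<le> CARD('q) ^ k \<longleftrightarrow> i \<le> k"
  using card_constants by (metis power_increasing_iff)

lemma degree_Q0: "place_degree c Q0 = 1"
proof -
  have "card (range c) = CARD('q) ^ place_degree c Q0"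
    by (rule residue_system_card[OF Q0_place residue_system_range[OF Q0_place Q0_residue]])
  moreover have "card (range c) = CARD('q)" by (intro card_image injI) simp
  ultimately have "CARD('q) ^ place_degree c Q0 = CARD('q) ^ 1" by simp
  then show ?thesis using power_card_le_iff by (metis le_antisym order_refl)
qed

text \<open>
  The constants represent as many residue classes as there are constants, and a place of degree one
  has no further classes.
\<close>

lemma rational_residue: assumes "P \<in> places c" "place_degree c P = 1" "z \<in> place_ring P"
  shows "\<exists>a. z - c a \<in> P"
proof -
  interpret discrete_place P by (rule place_discrete) fact
  obtain Z where Z: "residue_system P Z" using ex_residue_system assms by blast
  then have cardZ: "card Z = CARD('q)" "finite Z" using residue_system_card[OF assms(1) Z] assms(2)
    by (auto simp: residue_system_def)
  define h where "h a = (THE r. r \<in> Z \<and> c a - r \<in> P)" for a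
  have h: "h a \<in> Z \<and> c a - h a \<in> P" for a
  proof -
    have "c a \<in> place_ring P" using place_props(3)[OF assms(1)] by auto
    then have "\<exists>!r. r \<in> Z \<and> c a - r \<in> P" using Z by (simp add: residue_system_def)
    from theI'[OF this] show ?thesis by (simp add: h_def)
  qed
  have "inj h"
  proof (rule injI)
    fix a b assume "h a = h b"
    then have "c a - h a \<in> P" "c b - h a \<in> P" using h by metis+
    then have "(c a - h a) - (c b - h a) \<in> P" using nonunits_diff unfolding nonunits_place_ring by blast
    then have "c (a - b) \<in> P" by simp
    then show "a = b" unfolding place_const[OF assms(1)] by simp
  qed
  then have "card (range h) = card Z" using cardZ card_image by metis
  then have rZ: "range h = Z" using h cardZ by (intro card_subset_eq) auto
  obtain r where r: "r \<in> Z" "z - r \<in> P" using Z assms(3) unfolding residue_system_def by blast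
  then obtain a where "r = h a" using rZ by blast
  then have "(z - h a) - (c a - h a) \<in> P"
    using h[of a] r nonunits_diff unfolding nonunits_place_ring by blast
  then show ?thesis by auto
qed

text \<open>
  The powers \<open>1, y, \<dots>, y\<^sup>m\<^sup>-\<^sup>1\<close> are independent over \<open>K(x)\<close>, because their orders at infinity are pairwise
  incongruent modulo \<open>m\<close> and those of elements of \<open>K(x)\<close> are divisible by \<open>m\<close>.
\<close>

lemma ext_degree_eq: "ext_degree \<iota> = m"
proof -
  interpret vs: vector_space "\<lambda>a z. \<iota> a * z"
    by (rule iota.vector_space_c)
  have inj: "inj_on (\<lambda>j. y ^ j) {..<m}"
  proof (rule inj_onI)
    fix j j' assume "y ^ j = y ^ j'"
    then have "int j * int (degree f) = int j' * int (degree f)"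
      using Q0.val_power[OF y_nonzero, of j] Q0.val_power[OF y_nonzero, of j'] Q0_val_y by auto
    then show "j = j'" using degree_f_pos by auto
  qed
  have fin: "finite ybasis" by (simp add: ybasis_def)
  have "vs.independent ybasis"
    unfolding vs.dependent_finite[OF fin]
  proof (rule notI, elim exE conjE bexE)
    fix u v assume H: "v \<in> ybasis" "u v \<noteq> 0" "(\<Sum>v\<in>ybasis. \<iota> (u v) * v) = 0"
    define J where "J = {j. j < m \<and> u (y ^ j) \<noteq> 0}"
    have "(\<Sum>v\<in>ybasis. \<iota> (u v) * v) = (\<Sum>j<m. \<iota> (u (y ^ j)) * y ^ j)"
      unfolding ybasis_def using inj by (subst sum.reindex) auto
    also have "\<dots> = (\<Sum>j\<in>J. \<iota> (u (y ^ j)) * y ^ j)"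
      unfolding J_def by (intro sum.mono_neutral_right) auto
    finally have s0: "(\<Sum>j\<in>J. \<iota> (u (y ^ j)) * y ^ j) = 0" using H by simp
    have v: "\<exists>k. valuation Q0 (\<iota> (u (y ^ j)) * y ^ j) = - (int m * k + int (degree f) * int j)" if "j \<in> J" for j
    proof -
      obtain p q where pq: "u (y ^ j) = Fract p q" "q \<noteq> 0" by (cases "u (y ^ j)") auto
      have "\<iota> (u (y ^ j)) \<noteq> 0" using that by (simp add: J_def)
      then have "p \<noteq> 0" unfolding pq iota_Fract by auto
      then show ?thesis unfolding pq iota_Fract using pq(2) y_nonzero
        by (intro exI[of _ "int (degree p) - int (degree q)"])
           (simp add: Q0.val_mult Q0.val_divide Q0.val_power Q0_val_em Q0_val_y algebra_simps)
    qed
    have "(\<Sum>j\<in>J. \<iota> (u (y ^ j)) * y ^ j) \<noteq> 0"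
    proof (rule Q0.val_sum_distinct[THEN conjunct1])
      show "finite J" by (simp add: J_def)
      obtain j where "j < m" "v = y ^ j" using H(1) by (auto simp: ybasis_def)
      then show "J \<noteq> {}" using H(2) by (auto simp: J_def)
      show "inj_on (\<lambda>j. valuation Q0 (\<iota> (u (y ^ j)) * y ^ j)) J"
      proof (rule inj_onI)
        fix j j' assume J: "j \<in> J" "j' \<in> J"
          "valuation Q0 (\<iota> (u (y ^ j)) * y ^ j) = valuation Q0 (\<iota> (u (y ^ j')) * y ^ j')"
        obtain k k' where "valuation Q0 (\<iota> (u (y ^ j)) * y ^ j) = - (int m * k + int (degree f) * int j)"
          "valuation Q0 (\<iota> (u (y ^ j')) * y ^ j') = - (int m * k' + int (degree f) * int j')"
          using v[OF J(1)] v[OF J(2)] by blast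
        then show "j = j'" using coprime_orders[of k j k' j'] J by (simp add: J_def)
      qed
      show "\<iota> (u (y ^ j)) * y ^ j \<noteq> 0" if "j \<in> J" for j using that y_nonzero by (simp add: J_def)
    qed
    then show False using s0 by simp
  qed
  then have "vs.dim UNIV = card ybasis" by (intro vs.dim_eq_card) (simp_all add: span_ybasis)
  also have "card ybasis = m" unfolding ybasis_def using inj by (simp add: card_image)
  finally show ?thesis by (simp add: ext_degree_def)
qed

end

section \<open>Riemann--Roch spaces\<close>

lemma card_finite_subspace:
  fixes scale :: "'k::{field,finite} \<Rightarrow> 'v::ab_group_add \<Rightarrow> 'v"
  assumes "vector_space scale" "module.subspace scale S" "finite S"
  shows "card S = CARD('k) ^ vector_space.dim scale S"
proof -
  interpret vector_space scale by fact
  obtain B where B: "B \<subseteq> S" "independent B" "S \<subseteq> span B" "card B = dim S"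
    using basis_exists[of S] by blast
  have fB: "finite B" using B assms finite_subset by blast
  have SB: "S = span B" using B span_minimal[OF B(1)] assms(2) by auto
  define h where "h u = (\<Sum>b\<in>B. scale (u b) b)" for u
  let ?U = "{u::'v \<Rightarrow> 'k. \<forall>b. b \<notin> B \<longrightarrow> u b = 0}"
  have "h ` ?U = span B"
  proof
    show "h ` ?U \<subseteq> span B" by (auto simp: h_def intro!: span_sum span_scale intro: span_base)
    show "span B \<subseteq> h ` ?U"
    proof
      fix z assume "z \<in> span B"
      then obtain u where u: "z = (\<Sum>b\<in>B. scale (u b) b)" unfolding span_finite[OF fB] by auto
      have "z = h (\<lambda>b. if b \<in> B then u b else 0)" unfolding u h_def by (intro sum.cong) auto
      then show "z \<in> h ` ?U" by (intro image_eqI) auto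
    qed
  qed
  moreover have "inj_on h ?U"
  proof (rule inj_onI, rule ext)
    fix u u' b assume u: "u \<in> ?U" "u' \<in> ?U" "h u = h u'"
    have "(\<Sum>b\<in>B. scale (u b - u' b) b) = 0"
      using u(3) by (simp add: h_def scale_left_diff_distrib sum_subtractf)
    then have "\<forall>b\<in>B. u b - u' b = 0"
      using independentD[OF B(2) fB subset_refl, of "\<lambda>b. u b - u' b"] by simp
    then show "u b = u' b" using u by (cases "b \<in> B") auto
  qed
  ultimately have "card (span B) = card ?U" using card_image[of h ?U] by simp
  then show ?thesis using card_supported_functions[OF fB, where 'k = 'k] SB B(4) by simp
qed

context superelliptic
begin

lemma div_degree_superset:
  assumes "finite S" "Poly_Mapping.keys A \<subseteq> S"
  shows "div_degree c A = (\<Sum>P\<in>S. lookup A P * int (place_degree c P))"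
  unfolding div_degree_def using assms by (intro sum.mono_neutral_left) (auto simp: in_keys_iff)

lemma div_degree_add: "div_degree c (A + B) = div_degree c A + div_degree c B"
proof -
  let ?S = "Poly_Mapping.keys A \<union> Poly_Mapping.keys B"
  have "Poly_Mapping.keys (A + B) \<subseteq> ?S" by (rule keys_add)
  then show ?thesis
    using div_degree_superset[of ?S A] div_degree_superset[of ?S B] div_degree_superset[of ?S "A + B"]
    by (simp add: lookup_add distrib_right sum.distrib)
qed

lemma div_degree_zero: "div_degree c 0 = 0"
  by (simp add: div_degree_def)

lemma div_degree_cmul: "div_degree c (frag_cmul k A) = k * div_degree c A"
  using div_degree_superset[of "Poly_Mapping.keys A" "frag_cmul k A"] keys_cmul[of k A]
  by (simp add: div_degree_def sum_distrib_left mult.assoc)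

lemma div_degree_of: "div_degree c (frag_of P) = int (place_degree c P)"
  by (simp add: div_degree_def)

lemma div_degree_sum: "div_degree c (sum h I) = (\<Sum>i\<in>I. div_degree c (h i))"
  by (induction I rule: infinite_finite_induct) (auto simp: div_degree_add div_degree_zero)

lemma RR_space_order: "RR_space c A = {z. \<forall>P\<in>places c. order_ge P (- lookup A P) z}"
  by (auto simp: RR_space_def order_ge_def)

lemma RR_diff: "z \<in> RR_space c A \<Longrightarrow> w \<in> RR_space c A \<Longrightarrow> z - w \<in> RR_space c A"
  unfolding RR_space_order by (auto intro: discrete_place.order_ge_diff place_discrete)

lemma order_ge_const: assumes "P \<in> places c" "order_ge P n z" shows "order_ge P n (c a * z)"
proof -
  interpret discrete_place P by (rule place_discrete) fact
  have "order_ge P 0 (c a)" using place_props(3)[OF assms(1)] order_ge_ring by blast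
  from order_ge_mult[OF this assms(2)] show ?thesis by simp
qed

lemma RR_subspace: "module.subspace (\<lambda>a z. c a * z) (RR_space c A)"
proof -
  interpret vs: vector_space "\<lambda>a z. c a * z" by (rule vector_space_c)
  show ?thesis unfolding vs.subspace_def RR_space_order
    by (auto intro: discrete_place.order_ge_add place_discrete order_ge_const discrete_place.order_ge_0)
qed

lemma RR_zero: "0 \<in> RR_space c A"
  by (simp add: RR_space_def)

lemma card_RR: "finite (RR_space c A) \<Longrightarrow> card (RR_space c A) = CARD('q) ^ ell c A"
  unfolding ell_def using card_finite_subspace[OF vector_space_c RR_subspace] by simp

text \<open>
  Multiplication by an element \<open>\<tau>\<close> of suitable order at \<open>P\<close> and reduction modulo \<open>P\<close> map the larger
  space to the residue field, with the smaller space as kernel.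
\<close>

lemma RR_add_place:
  assumes "P \<in> places c" "finite (RR_space c A)"
  shows "finite (RR_space c (A + frag_of P)) \<and>
    card (RR_space c (A + frag_of P)) \<le> card (RR_space c A) * CARD('q) ^ place_degree c P"
proof -
  interpret discrete_place P by (rule place_discrete) fact
  obtain Z where Z: "residue_system P Z" using ex_residue_system assms by blast
  obtain \<tau> where \<tau>: "\<tau> \<noteq> 0" "valuation P \<tau> = lookup A P + 1" using ex_val by blast
  have "finite (RR_space c (A + frag_of P)) \<and>
        card (RR_space c (A + frag_of P)) \<le> card (RR_space c A) * card Z"
  proof (rule card_fibres_bound[where \<tau> = \<tau>, OF assms(2) Z])
    fix u u' assume u: "u \<in> RR_space c (A + frag_of P)"
    then have "order_ge P (- (lookup A P + 1)) u"
      using assms(1) unfolding RR_space_order by (auto simp: lookup_add)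
    then have "order_ge P 0 (u * \<tau>)" using \<tau> by (simp add: order_ge_mult_iff)
    then show "u * \<tau> \<in> place_ring P" by (simp add: order_ge_ring)
    {
      assume "u * \<tau> \<in> P"
      then have "order_ge P 1 (u * \<tau>)" by (simp add: order_ge_place)
      then have 1: "order_ge P (- lookup A P) u" using \<tau> by (simp add: order_ge_mult_iff)
      show "u \<in> RR_space c A"
        unfolding RR_space_order
      proof (clarify)
        fix P' assume P': "P' \<in> places c"
        show "order_ge P' (- lookup A P') u"
        proof (cases "P' = P")
          case False
          have "order_ge P' (- lookup (A + frag_of P) P') u"
            using u P' unfolding RR_space_order by blast
          then show ?thesis using False by (simp add: lookup_add)
        qed (use 1 in simp)
      qed
    }
    assume u': "u' \<in> RR_space c (A + frag_of P)"
    show "u - u' \<in> RR_space c (A + frag_of P)" using RR_diff u u' by simp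
  next
    fix z w assume "z \<in> P" "w \<in> P"
    then show "z - w \<in> P" using nonunits_diff unfolding nonunits_place_ring by blast
  qed
  then show ?thesis using residue_system_card[OF assms(1) Z] by simp
qed

lemma RR_add_multiple:
  assumes "P \<in> places c" "finite (RR_space c A)"
  shows "finite (RR_space c (A + frag_cmul (int n) (frag_of P))) \<and>
    card (RR_space c (A + frag_cmul (int n) (frag_of P))) \<le> card (RR_space c A) * CARD('q) ^ (n * place_degree c P)"
proof (induction n)
  case (Suc n)
  have e: "A + frag_cmul (int (Suc n)) (frag_of P) = A + frag_cmul (int n) (frag_of P) + frag_of P"
    by (simp add: frag_cmul_distrib add_ac)
  have "card (RR_space c (A + frag_cmul (int n) (frag_of P))) * CARD('q) ^ place_degree c P
     \<le> card (RR_space c A) * CARD('q) ^ (n * place_degree c P) * CARD('q) ^ place_degree c P"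
    using Suc by (intro mult_right_mono) auto
  moreover have "finite (RR_space c (A + frag_cmul (int n) (frag_of P) + frag_of P)) \<and>
      card (RR_space c (A + frag_cmul (int n) (frag_of P) + frag_of P))
        \<le> card (RR_space c (A + frag_cmul (int n) (frag_of P))) * CARD('q) ^ place_degree c P"
    using Suc by (intro RR_add_place assms(1)) simp
  moreover have "card (RR_space c A) * CARD('q) ^ (n * place_degree c P) * CARD('q) ^ place_degree c P
      = card (RR_space c A) * CARD('q) ^ (Suc n * place_degree c P)"
    by (simp add: power_add mult_ac)
  ultimately show ?case unfolding e by linarith
qed (use assms in simp)

lemma RR_add_sum:
  assumes "finite S" "S \<subseteq> places c" "finite (RR_space c A)"
  shows "finite (RR_space c (A + (\<Sum>P\<in>S. frag_cmul (int (n P)) (frag_of P)))) \<and>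
    card (RR_space c (A + (\<Sum>P\<in>S. frag_cmul (int (n P)) (frag_of P))))
      \<le> card (RR_space c A) * CARD('q) ^ (\<Sum>P\<in>S. n P * place_degree c P)"
  using assms(1,2)
proof (induction S rule: finite_induct)
  case (insert P S)
  let ?B = "A + (\<Sum>P\<in>S. frag_cmul (int (n P)) (frag_of P))"
  have IH: "finite (RR_space c ?B)"
    "card (RR_space c ?B) \<le> card (RR_space c A) * CARD('q) ^ (\<Sum>P\<in>S. n P * place_degree c P)"
    using insert by auto
  have e: "A + (\<Sum>P\<in>insert P S. frag_cmul (int (n P)) (frag_of P)) = ?B + frag_cmul (int (n P)) (frag_of P)"
    using insert by (simp add: add_ac)
  have "card (RR_space c ?B) * CARD('q) ^ (n P * place_degree c P)
    \<le> card (RR_space c A) * CARD('q) ^ (\<Sum>P\<in>S. n P * place_degree c P) * CARD('q) ^ (n P * place_degree c P)"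
    using IH by (intro mult_right_mono) auto
  moreover have "finite (RR_space c (?B + frag_cmul (int (n P)) (frag_of P))) \<and>
      card (RR_space c (?B + frag_cmul (int (n P)) (frag_of P)))
        \<le> card (RR_space c ?B) * CARD('q) ^ (n P * place_degree c P)"
    using insert.prems by (intro RR_add_multiple IH(1)) simp
  moreover have "card (RR_space c A) * CARD('q) ^ (\<Sum>P\<in>S. n P * place_degree c P) * CARD('q) ^ (n P * place_degree c P)
      = card (RR_space c A) * CARD('q) ^ (\<Sum>P\<in>insert P S. n P * place_degree c P)"
    using insert.hyps by (simp add: power_add mult_ac)
  ultimately show ?case unfolding e by linarith
qed (use assms in simp)

lemma ell_mono:
  assumes "divisor c A" "divisor c B" "\<And>P. lookup A P \<le> lookup B P"
    "finite (RR_space c A)"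
  shows "finite (RR_space c B)"
    and "int (ell c B) - div_degree c B \<le> int (ell c A) - div_degree c A"
proof -
  let ?S = "Poly_Mapping.keys A \<union> Poly_Mapping.keys B"
  define n where "n P = nat (lookup B P - lookup A P)" for P
  have S: "finite ?S" "?S \<subseteq> places c" using assms by (auto simp: divisor_def)
  have n: "int (n P) = lookup B P - lookup A P" for P
    using assms(3)[of P] by (simp add: n_def)
  have e: "A + (\<Sum>P\<in>?S. frag_cmul (int (n P)) (frag_of P)) = B"
  proof (rule poly_mapping_eqI)
    fix P
    have "lookup (\<Sum>P\<in>?S. frag_cmul (int (n P)) (frag_of P)) P
        = (\<Sum>P'\<in>?S. if P' = P then int (n P') else 0)"
      unfolding lookup_sum by (intro sum.cong) auto
    also have "\<dots> = (if P \<in> ?S then int (n P) else 0)" using S(1) by simp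
    also have "\<dots> = int (n P)" using n[of P] by (auto simp: in_keys_iff)
    finally show "lookup (A + (\<Sum>P\<in>?S. frag_cmul (int (n P)) (frag_of P))) P = lookup B P"
      by (simp add: lookup_add n)
  qed
  note * = RR_add_sum[OF S assms(4), of n, unfolded e]
  show fB: "finite (RR_space c B)" using * by blast
  have "CARD('q) ^ ell c B \<le> CARD('q) ^ (ell c A + (\<Sum>P\<in>?S. n P * place_degree c P))"
    using * card_RR[OF fB] card_RR[OF assms(4)] by (simp add: power_add)
  then have "ell c B \<le> ell c A + (\<Sum>P\<in>?S. n P * place_degree c P)" unfolding power_card_le_iff .
  moreover have "int (\<Sum>P\<in>?S. n P * place_degree c P) = div_degree c B - div_degree c A"
    using div_degree_superset[OF S(1), of A] div_degree_superset[OF S(1), of B]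
    by (simp add: n left_diff_distrib sum_subtractf)
  ultimately show "int (ell c B) - div_degree c B \<le> int (ell c A) - div_degree c A" by linarith
qed

end

section \<open>Weak approximation\<close>

text \<open>
  The units of the smaller ring are units of the larger one, so the two valuations are proportional.
\<close>

lemma discrete_place_ring_antisym:
  assumes "discrete_place P" "discrete_place P'" "place_ring P \<subseteq> place_ring P'"
  shows "P = P'"
proof -
  interpret A: discrete_place P by fact
  interpret B: discrete_place P' by fact
  obtain t where t: "t \<noteq> 0" "valuation P t = 1" using A.ex_val_1 by blast
  have proportional: "valuation P' z = valuation P z * valuation P' t" if "z \<noteq> 0" for z
  proof -
    define u where "u = z * t powi (- valuation P z)"
    have u0: "u \<noteq> 0" using that t by (simp add: u_def)
    have "valuation P u = 0" using that t by (simp add: u_def A.val_mult A.val_powi)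
    then have "unit_in (place_ring P) u" using u0 A.val_unit by simp
    then have "unit_in (place_ring P') u" using assms(3) by (auto simp: unit_in_def)
    then have "valuation P' u = 0" using B.val_unit by simp
    then show ?thesis using that t by (simp add: u_def B.val_mult B.val_powi)
  qed
  have "t \<in> place_ring P'" using A.val_ring[of t] t assms(3) by auto
  then have "valuation P' t \<ge> 0" using B.val_ring t by simp
  moreover obtain t' where "t' \<noteq> 0" "valuation P' t' = 1" using B.ex_val_1 by blast
  ultimately have pos: "valuation P' t > 0" using proportional[of t'] by (cases "valuation P' t = 0") auto
  have "z \<in> P \<longleftrightarrow> z \<in> P'" for z
  proof (cases "z = 0")
    case False
    then show ?thesis
      using A.val_place[of z] B.val_place[of z] proportional[of z] pos by (simp add: zero_less_mult_iff)
  qed (simp add: A.zero_in_place B.zero_in_place)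
  then show ?thesis by blast
qed

text \<open>
  Induction on \<open>S\<close>: if \<open>u\<close> serves the places of \<open>S\<close> but not the additional place, and \<open>z\<close> separates \<open>P\<close> from
  that place, then \<open>z\<^sup>N + u\<close> serves all of them for large \<open>N\<close>.
\<close>

lemma ex_separating_element:
  assumes "finite S" "discrete_place P" "\<And>P'. P' \<in> S \<Longrightarrow> discrete_place P'" "P \<notin> S"
  shows "\<exists>u. u \<noteq> 0 \<and> valuation P u > 0 \<and> (\<forall>P'\<in>S. valuation P' u < 0)"
  using assms(1,3,4)
proof (induction S rule: finite_induct)
  case empty
  then show ?case using discrete_place.ex_val_1[OF assms(2)] by auto
next
  case (insert P2 S)
  interpret A: discrete_place P by fact
  interpret B: discrete_place P2 using insert by simp
  obtain u where u: "u \<noteq> 0" "valuation P u > 0" "\<And>P'. P' \<in> S \<Longrightarrow> valuation P' u < 0"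
    using insert by auto
  have "P \<noteq> P2" using insert by auto
  then obtain a b where ab: "a \<in> place_ring P" "a \<notin> place_ring P2" "b \<in> place_ring P2" "b \<notin> place_ring P"
    using discrete_place_ring_antisym[OF A.discrete_place_axioms B.discrete_place_axioms]
      discrete_place_ring_antisym[OF B.discrete_place_axioms A.discrete_place_axioms] by blast
  have nz: "a \<noteq> 0" "b \<noteq> 0" using ab A.zero_mem B.zero_mem by auto
  define z where "z = a / b"
  have z: "z \<noteq> 0" "valuation P z > 0" "valuation P2 z < 0"
    using ab nz A.val_ring[of a] A.val_ring[of b] B.val_ring[of a] B.val_ring[of b]
    by (auto simp: z_def A.val_divide B.val_divide)
  show ?case
  proof (cases "valuation P2 u < 0")
    case True
    then show ?thesis using u by (intro exI[of _ u]) auto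
  next
    case False
    define M where "M = (\<Sum>P'\<in>S. nat \<bar>valuation P' u\<bar>)"
    define N where "N = Suc M"
    have zN: "z ^ N \<noteq> 0" using z by simp
    have N0: "N > 0" by (simp add: N_def)
    have "valuation P2 (z ^ N) < 0" using z N0 by (simp add: B.val_power mult_pos_neg)
    then have 2: "z ^ N + u \<noteq> 0" "valuation P2 (z ^ N + u) < 0"
      using B.val_add[OF zN, of u] False u(1) by (auto simp: order_ge_def)
    have "valuation P (z ^ N) > 0" using z N0 by (simp add: A.val_power)
    then have "order_ge P 1 (z ^ N + u)" using u by (intro A.order_ge_add) (auto simp: order_ge_def)
    then have 1: "valuation P (z ^ N + u) > 0" using 2(1) by (simp add: order_ge_def)
    have 3: "valuation P' (z ^ N + u) < 0" if P': "P' \<in> S" for P'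
    proof -
      interpret C: discrete_place P' using insert.prems(1) P' by blast
      have "nat \<bar>valuation P' u\<bar> \<le> M"
        unfolding M_def using insert.hyps P' by (intro member_le_sum) auto
      then have N: "int N > - valuation P' u" by (simp add: N_def)
      show ?thesis
      proof (cases "valuation P' z \<ge> 0")
        case True
        then have "order_ge P' (valuation P' u + 1) (z ^ N)"
          using u(3)[OF P'] z by (simp add: order_ge_def C.val_power) (smt (verit) mult_nonneg_nonneg of_nat_0_le_iff)
        then show ?thesis using C.val_add[OF u(1), of "z ^ N"] u(3)[OF P'] by (simp add: add.commute)
      next
        case False
        then have "int N * valuation P' z \<le> int N * (-1)" by (intro mult_left_mono) auto
        then have v: "valuation P' (z ^ N) < valuation P' u" using N z by (simp add: C.val_power)
        then have "order_ge P' (valuation P' (z ^ N) + 1) u" using u by (simp add: order_ge_def)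
        then show ?thesis using C.val_add[OF zN, of u] v u(3)[OF P'] by simp
      qed
    qed
    show ?thesis using 1 2 3 by (intro exI[of _ "z ^ N + u"]) auto
  qed
qed

lemma approximation_at_one_place:
  assumes "finite S" "\<And>P. P \<in> S \<Longrightarrow> discrete_place P" "P \<in> S"
  shows "\<exists>e. order_ge P n (e - z) \<and> (\<forall>P'\<in>S - {P}. order_ge P' n e)"
proof (cases "z = 0")
  case True
  then show ?thesis by (intro exI[of _ 0]) (auto simp: order_ge_def)
next
  case False
  obtain u where u: "u \<noteq> 0" "valuation P u > 0" "\<And>P'. P' \<in> S - {P} \<Longrightarrow> valuation P' u < 0"
    using ex_separating_element[of "S - {P}" P] assms by auto
  define M where "M = (\<Sum>P'\<in>S. nat \<bar>valuation P' z\<bar>)"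
  define k where "k = Suc (nat \<bar>n\<bar> + M)"
  have k: "int k + valuation P' z \<ge> n" if "P' \<in> S" for P'
  proof -
    have "nat \<bar>valuation P' z\<bar> \<le> M"
      unfolding M_def using assms(1) that by (intro member_le_sum) auto
    then show ?thesis by (simp add: k_def)
  qed
  (* The element 1 / (1 + u^k) is close to 1 at P and close to 0 at the other places of S. *)
  define e where "e = z / (1 + u ^ k)"
  have uk: "u ^ k \<noteq> 0" using u by simp
  have 1: "order_ge P n (e - z)"
  proof -
    interpret discrete_place P using assms by blast
    have "k > 0" by (simp add: k_def)
    then have "valuation P (u ^ k) > 0" using u by (simp add: val_power)
    then have s: "1 + u ^ k \<noteq> 0" "valuation P (1 + u ^ k) = 0"
      using val_add[of 1 "u ^ k"] uk by (auto simp: val_one order_ge_def)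
    have "int k * 1 \<le> int k * valuation P u" using u by (intro mult_left_mono) auto
    moreover have "e - z = - (z * u ^ k / (1 + u ^ k))"
      using s(1) by (simp add: e_def field_simps)
    moreover have "valuation P (- (z * u ^ k / (1 + u ^ k))) = valuation P z + int k * valuation P u"
      using s False u(1) by (simp add: val_minus val_divide val_mult val_power)
    ultimately show ?thesis using k[OF assms(3)] by (simp add: order_ge_def)
  qed
  have "order_ge P' n e" if P': "P' \<in> S - {P}" for P'
  proof -
    interpret discrete_place P' using assms P' by blast
    have v: "valuation P' (u ^ k) = int k * valuation P' u" using u(1) by (rule val_power)
    have le: "int k * valuation P' u \<le> int k * (-1)" using u(3)[OF P'] by (intro mult_left_mono) auto
    then have "order_ge P' (valuation P' (u ^ k) + 1) 1"
      using v by (simp add: order_ge_def val_one k_def)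
    then have s: "u ^ k + 1 \<noteq> 0 \<and> valuation P' (u ^ k + 1) = int k * valuation P' u"
      using val_add[OF uk, of 1] v by simp
    then have "valuation P' e = valuation P' z - int k * valuation P' u"
      using False by (simp add: e_def val_divide add.commute)
    then show ?thesis using le k[of P'] P' by (simp add: order_ge_def)
  qed
  then show ?thesis using 1 by blast
qed

text \<open>
  Add up approximations that are close to \<open>0\<close> at all places of \<open>S\<close> but one.
\<close>

lemma weak_approximation:
  assumes "finite S" "\<And>P. P \<in> S \<Longrightarrow> discrete_place P"
  shows "\<exists>e. \<forall>P\<in>S. order_ge P n (e - z P)"
proof -
  have "\<forall>P\<in>S. \<exists>e. order_ge P n (e - z P) \<and> (\<forall>P'\<in>S - {P}. order_ge P' n e)"
    using approximation_at_one_place[OF assms] by blast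
  then obtain e where e: "\<And>P. P \<in> S \<Longrightarrow> order_ge P n (e P - z P)"
    "\<And>P P'. P \<in> S \<Longrightarrow> P' \<in> S - {P} \<Longrightarrow> order_ge P' n (e P)"
    unfolding bchoice_iff by blast
  have "order_ge P n (sum e S - z P)" if P: "P \<in> S" for P
  proof -
    interpret discrete_place P using assms P by blast
    have "sum e S - z P = (e P - z P) + (\<Sum>P'\<in>S - {P}. e P')"
      using sum.remove[OF assms(1) P, of e] by simp
    moreover have "order_ge P n (\<Sum>P'\<in>S - {P}. e P')" using e(2) P by (intro order_ge_sum) auto
    ultimately show ?thesis using order_ge_add[OF e(1)[OF P]] by (simp only:)
  qed
  then show ?thesis by blast
qed

section \<open>Existence of places\<close>

context embedding
begin

definition ev :: "'f \<Rightarrow> 'k poly \<Rightarrow> 'f" where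
  "ev s p = poly (map_poly c p) s"

lemma ev_0 [simp]: "ev s 0 = 0"
  by (simp add: ev_def)

lemma ev_pCons [simp]: "ev s (pCons a p) = c a + s * ev s p"
  by (simp add: ev_def map_poly_pCons)

lemma ev_add: "ev s (p + q) = ev s p + ev s q"
proof (induction p arbitrary: q)
  case (pCons a p)
  then show ?case by (cases q) (auto simp: algebra_simps)
qed simp

lemma ev_smult: "ev s (smult a p) = c a * ev s p"
  by (induction p) (auto simp: algebra_simps)

lemma ev_mult: "ev s (p * q) = ev s p * ev s q"
  by (induction p) (auto simp: ev_add ev_smult algebra_simps)

lemma ev_diff: "ev s (p - q) = ev s p - ev s q"
  using ev_add[of s "p - q" q] by simp

end

definition adjoin :: "'f::field set \<Rightarrow> 'f \<Rightarrow> 'f set" where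
  "adjoin V u = {poly p u | p. \<forall>i. coeff p i \<in> V}"

lemma (in ring_in_field) adjoin_ring: "ring_in_field (adjoin V u)"
proof
  show "1 \<in> adjoin V u"
    unfolding adjoin_def using one_mem zero_mem by (intro CollectI exI[of _ 1]) (auto simp: coeff_1)
  fix z w assume "z \<in> adjoin V u" "w \<in> adjoin V u"
  then obtain p q where pq: "z = poly p u" "w = poly q u" "\<And>i. coeff p i \<in> V" "\<And>i. coeff q i \<in> V"
    unfolding adjoin_def by blast
  show "z - w \<in> adjoin V u"
    unfolding adjoin_def using pq diff_mem by (intro CollectI exI[of _ "p - q"]) auto
  show "z * w \<in> adjoin V u"
    unfolding adjoin_def using pq
    by (intro CollectI exI[of _ "p * q"]) (auto simp: coeff_mult intro!: sum_mem mult_mem)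
qed

lemma (in ring_in_field) subset_adjoin: "V \<subseteq> adjoin V u"
proof
  fix v assume "v \<in> V"
  then show "v \<in> adjoin V u"
    unfolding adjoin_def using zero_mem
    by (intro CollectI exI[of _ "[:v:]"]) (auto simp: coeff_pCons split: nat.split)
qed

lemma (in ring_in_field) mem_adjoin: "u \<in> adjoin V u"
  unfolding adjoin_def using zero_mem one_mem
  by (intro CollectI exI[of _ "[:0, 1:]"]) (auto simp: coeff_pCons split: nat.split)

text \<open>
  Maximal rings without \<open>z\<close>: adjoining any further element produces \<open>z\<close>. Such a ring is a
  valuation ring, because two relations that produce \<open>z\<close> from \<open>u\<close> and from \<open>inverse u\<close> can be
  used to lower each other's degrees.
\<close>

locale maximal_without = ring_in_field V for V :: "'f::field set" +
  fixes z :: 'f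
  assumes z_notin: "z \<notin> V" and inverse_z: "inverse z \<in> V"
    and adjoin: "u \<notin> V \<Longrightarrow> z \<in> adjoin V u"
begin

lemma z_nonzero: "z \<noteq> 0"
  using z_notin zero_mem by auto

text \<open>
  Suppose that \<open>e = 1 - b/z\<close> has no inverse in \<open>V\<close>. Adjoining the inverse produces \<open>z\<close>, and clearing
  denominators gives \<open>z e\<^sup>n \<in> V\<close>. But \<open>e\<^sup>n\<close> has the form \<open>1 - b'/z\<close> with \<open>b' \<in> V\<close> again, so \<open>z \<in> V\<close>.
\<close>

lemma one_minus_nonunit: assumes "b \<in> V" shows "1 - b * inverse z \<noteq> 0 \<and> inverse (1 - b * inverse z) \<in> V"
proof -
  define e where "e = 1 - b * inverse z"
  have e0: "e \<noteq> 0"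
  proof
    assume "e = 0"
    then have "z = b" using z_nonzero by (simp add: e_def field_simps)
    then show False using assms z_notin by simp
  qed
  have eV: "e \<in> V" unfolding e_def by (intro diff_mem one_mem mult_mem assms inverse_z)
  have pw: "\<exists>b\<in>V. e ^ n = 1 - b * inverse z" for n
  proof (induction n)
    case 0
    show ?case using zero_mem by (intro bexI[of _ 0]) auto
  next
    case (Suc n)
    then obtain b' where b': "b' \<in> V" "e ^ n = 1 - b' * inverse z" by blast
    have "e ^ Suc n = 1 - (b + b' - b * b' * inverse z) * inverse z"
      unfolding power_Suc b'(2) by (simp add: e_def algebra_simps)
    moreover have "b + b' - b * b' * inverse z \<in> V"
      by (intro diff_mem add_mem mult_mem assms b' inverse_z)
    ultimately show ?case by blast
  qed
  have "inverse e \<in> V"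
  proof (rule ccontr)
    assume "inverse e \<notin> V"
    then obtain p where p: "z = poly p (inverse e)" "\<And>i. coeff p i \<in> V"
      using adjoin unfolding adjoin_def by blast
    define n where "n = degree p"
    have "z * e ^ n = (\<Sum>i\<le>n. coeff p i * inverse e ^ i * e ^ n)"
      using p(1) by (simp add: poly_altdef n_def sum_distrib_right)
    also have "\<dots> = (\<Sum>i\<le>n. coeff p i * e ^ (n - i))"
    proof (rule sum.cong)
      fix i assume "i \<in> {..n}"
      then have "e ^ n = e ^ i * e ^ (n - i)" by (simp flip: power_add)
      then show "coeff p i * inverse e ^ i * e ^ n = coeff p i * e ^ (n - i)"
        using e0 by (simp add: power_inverse)
    qed simp
    also have "\<dots> \<in> V" by (intro sum_mem mult_mem power_mem p eV)
    finally have "z * e ^ n \<in> V" .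
    moreover obtain b' where "b' \<in> V" "e ^ n = 1 - b' * inverse z" using pw by blast
    ultimately have "z - b' \<in> V" "b' \<in> V" using z_nonzero by (auto simp: algebra_simps)
    then have "(z - b') + b' \<in> V" by (rule add_mem)
    then show False using z_notin by simp
  qed
  then show ?thesis using e0 by (simp add: e_def)
qed

text \<open>
  The relation \<open>z = poly q (inverse u)\<close> writes the unit \<open>1 - q\<^sub>0/z\<close> as a combination of negative powers of
  \<open>u\<close>. Multiplying by the leading term of \<open>p\<close> replaces this term by terms of lower degree.
\<close>

lemma lower_degree:
  assumes "u \<noteq> 0" "\<And>i. coeff p i \<in> V" "\<And>i. coeff q i \<in> V" "z = poly p u" "z = poly q (inverse u)"
    "degree q \<le> degree p"
  shows "\<exists>p'. (\<forall>i. coeff p' i \<in> V) \<and> z = poly p' u \<and> degree p' < degree p"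
proof -
  define n where "n = degree p"
  have n: "n > 0"
  proof (rule ccontr)
    assume "\<not> n > 0"
    then obtain a where a: "p = [:a:]" by (auto simp: n_def elim: degree_eq_zeroE)
    then have "z = coeff p 0" using assms(4) by simp
    then show False using assms(2) z_notin by metis
  qed
  define e where "e = 1 - coeff q 0 * inverse z"
  have e: "e \<noteq> 0" "inverse e \<in> V" using one_minus_nonunit[OF assms(3)[of 0]] by (auto simp: e_def)
  define d where "d j = lead_coeff p * inverse e * coeff q j * inverse z" for j
  have dV: "d j \<in> V" for j unfolding d_def by (intro mult_mem assms e inverse_z)
  define p' where "p' = p - monom (lead_coeff p) n + (\<Sum>j=1..degree q. monom (d j) (n - j))"
  have "coeff p' i \<in> V" for i
    unfolding p'_def using assms(2) dV zero_mem
    by (auto simp: coeff_sum intro!: add_mem diff_mem sum_mem)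
  moreover have "degree p' < n"
  proof (rule degree_lessI)
    show "\<forall>i\<ge>n. coeff p' i = 0"
    proof (intro allI impI)
      fix i assume i: "n \<le> i"
      have "coeff (\<Sum>j=1..degree q. monom (d j) (n - j)) i = 0"
        unfolding coeff_sum using i n by (intro sum.neutral) auto
      moreover have "coeff (p - monom (lead_coeff p) n) i = 0"
        using i by (cases "i = n") (auto simp: n_def coeff_eq_0)
      ultimately show "coeff p' i = 0" by (simp add: p'_def)
    qed
  qed (use n in simp)
  moreover have "poly p' u = z"
  proof -
    define s where "s = (\<Sum>j=1..degree q. coeff q j * inverse u ^ j)"
    have "poly q (inverse u) = coeff q 0 + s"
      unfolding s_def poly_altdef by (simp add: atMost_atLeast0 sum.atLeast_Suc_atMost)
    then have "z = coeff q 0 + s" using assms(5) by simp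
    moreover have "z * e = z - coeff q 0" using z_nonzero by (simp add: e_def right_diff_distrib)
    ultimately have "s = z * e" by simp
    then have "lead_coeff p * u ^ n = lead_coeff p * inverse e * inverse z * u ^ n
        * (\<Sum>j=1..degree q. coeff q j * inverse u ^ j)"
      using e z_nonzero unfolding s_def[symmetric] by (simp add: field_simps)
    also have "\<dots> = (\<Sum>j=1..degree q. d j * u ^ (n - j))"
      unfolding sum_distrib_left
    proof (rule sum.cong)
      fix j assume "j \<in> {1..degree q}"
      then have "j \<le> n" using assms(6) by (simp add: n_def)
      then have "u ^ n = u ^ (n - j) * u ^ j" by (simp flip: power_add)
      then show "lead_coeff p * inverse e * inverse z * u ^ n * (coeff q j * inverse u ^ j) = d j * u ^ (n - j)"
        using assms(1) by (simp add: d_def power_inverse)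
    qed simp
    finally have "poly (\<Sum>j=1..degree q. monom (d j) (n - j)) u = lead_coeff p * u ^ n"
      by (simp add: poly_sum poly_monom)
    then show ?thesis using assms(4) by (simp add: p'_def poly_monom)
  qed
  ultimately show ?thesis unfolding n_def by (intro exI[of _ p']) simp
qed

lemma maximal_total: "u \<in> V \<or> inverse u \<in> V"
proof (rule ccontr)
  assume H: "\<not> ?thesis"
  then have u0: "u \<noteq> 0" using zero_mem by auto
  define rel where "rel u p \<longleftrightarrow> (\<forall>i. coeff p i \<in> V) \<and> z = poly p u" for u p
  have ex: "\<exists>p. rel w p" if "w \<notin> V" for w
    using adjoin[OF that] unfolding adjoin_def rel_def by blast
  obtain p where p: "rel u p" "\<And>p'. rel u p' \<Longrightarrow> degree p \<le> degree p'"
    using ex_has_least_nat[of "rel u" _ degree] ex[of u] H by blast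
  obtain q where q: "rel (inverse u) q" "\<And>p'. rel (inverse u) p' \<Longrightarrow> degree q \<le> degree p'"
    using ex_has_least_nat[of "rel (inverse u)" _ degree] ex[of "inverse u"] H by blast
  show False
  proof (cases "degree q \<le> degree p")
    case True
    obtain p' where "rel u p'" "degree p' < degree p"
      using lower_degree[OF u0, of p q] p q True unfolding rel_def by blast
    then show False using p(2)[of p'] by simp
  next
    case False
    have "inverse u \<noteq> 0" "z = poly p (inverse (inverse u))" using u0 p(1) by (simp_all add: rel_def)
    then obtain p' where "rel (inverse u) p'" "degree p' < degree q"
      using lower_degree[of "inverse u" q p] p q False unfolding rel_def by auto
    then show False using q(2)[of p'] by simp
  qed
qed

end

lemma subset_chain_union_ring:
  assumes "\<And>A. A \<in> \<C> \<Longrightarrow> ring_in_field A" "\<C> \<noteq> {}" "\<And>A B. A \<in> \<C> \<Longrightarrow> B \<in> \<C> \<Longrightarrow> A \<subseteq> B \<or> B \<subseteq> A"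
  shows "ring_in_field (\<Union>\<C>)"
proof
  show "1 \<in> \<Union>\<C>" using assms(1,2) ring_in_field.one_mem by blast
  fix u v assume "u \<in> \<Union>\<C>" "v \<in> \<Union>\<C>"
  then obtain A B where "A \<in> \<C>" "u \<in> A" "B \<in> \<C>" "v \<in> B" by blast
  then obtain C where C: "C \<in> \<C>" "u \<in> C" "v \<in> C" using assms(3)[of A B] by blast
  then show "u - v \<in> \<Union>\<C>" "u * v \<in> \<Union>\<C>"
    using assms(1) ring_in_field.diff_mem ring_in_field.mult_mem by blast+
qed

context superelliptic
begin

text \<open>
  Chevalley's extension theorem: Zorn's lemma provides a ring that contains the constants and
  \<open>inverse z\<close> and is maximal among those without \<open>z\<close>; it is a valuation ring in which \<open>inverse z\<close> is not
  a unit.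
\<close>

lemma ex_pole:
  assumes "z \<notin> range (ev (inverse z))"
  shows "\<exists>P\<in>places c. inverse z \<in> P"
proof -
  define \<A> where "\<A> = {A. ring_in_field A \<and> range c \<subseteq> A \<and> inverse z \<in> A \<and> z \<notin> A}"
  have "range (ev (inverse z)) \<in> \<A>"
    unfolding \<A>_def
  proof (intro CollectI conjI)
    show "ring_in_field (range (ev (inverse z)))"
    proof
      show "1 \<in> range (ev (inverse z))" by (intro range_eqI[of _ _ 1]) (simp add: one_pCons)
      fix u v assume "u \<in> range (ev (inverse z))" "v \<in> range (ev (inverse z))"
      then obtain p q where "u = ev (inverse z) p" "v = ev (inverse z) q" by blast
      then show "u - v \<in> range (ev (inverse z))" "u * v \<in> range (ev (inverse z))"
        using ev_diff ev_mult by (metis rangeI)+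
    qed
    show "range c \<subseteq> range (ev (inverse z))"
    proof
      fix u assume "u \<in> range c"
      then obtain a where "u = c a" by blast
      then show "u \<in> range (ev (inverse z))" by (intro range_eqI[of _ _ "[:a:]"]) simp
    qed
    show "inverse z \<in> range (ev (inverse z))" by (intro range_eqI[of _ _ "[:0, 1:]"]) simp
  qed (use assms in simp)
  moreover have "\<Union>\<C> \<in> \<A>" if "\<C> \<noteq> {}" "subset.chain \<A> \<C>" for \<C>
  proof -
    have \<C>: "\<C> \<subseteq> \<A>" "\<And>A B. A \<in> \<C> \<Longrightarrow> B \<in> \<C> \<Longrightarrow> A \<subseteq> B \<or> B \<subseteq> A"
      using that(2) by (auto simp: subset_chain_def)
    have "ring_in_field (\<Union>\<C>)"
      using \<C> that(1) by (intro subset_chain_union_ring) (auto simp: \<A>_def)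
    then show ?thesis using \<C>(1) that(1) unfolding \<A>_def by blast
  qed
  ultimately obtain V where V: "V \<in> \<A>" "\<And>A. A \<in> \<A> \<Longrightarrow> V \<subseteq> A \<Longrightarrow> A = V"
    using subset_Zorn_nonempty[of \<A>] by blast
  interpret ring_in_field V using V by (simp add: \<A>_def)
  interpret maximal_without V z
  proof
    show "z \<notin> V" "inverse z \<in> V" using V by (auto simp: \<A>_def)
    fix u assume u: "u \<notin> V"
    show "z \<in> adjoin V u"
    proof (rule ccontr)
      assume "z \<notin> adjoin V u"
      then have "adjoin V u \<in> \<A>" using V(1) adjoin_ring subset_adjoin unfolding \<A>_def by blast
      then have "adjoin V u = V" using V(2) subset_adjoin by blast
      then show False using mem_adjoin u by blast
    qed
  qed
  have "total_ring V" by unfold_locales (rule maximal_total)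
  moreover have "V \<noteq> range c"
  proof
    assume "V = range c"
    then obtain a where "inverse z = c a" using inverse_z by blast
    then have "z = c (inverse a)" by (metis c_inverse inverse_inverse_eq)
    then show False using z_notin \<open>V = range c\<close> by blast
  qed
  moreover have "V \<noteq> UNIV" using z_notin by blast
  ultimately have "nonunits V \<in> places c" using V(1) by (intro nonunits_in_places) (auto simp: \<A>_def)
  moreover have "inverse z \<in> nonunits V" using inverse_z z_notin by (simp add: nonunits_def)
  ultimately show ?thesis by blast
qed

end

section \<open>Riemann's theorem\<close>

context superelliptic
begin

interpretation Q0: discrete_place Q0
  by (rule Q0_discrete)

lemma power_card_eq_iff: "CARD('q) ^ i = CARD('q) ^ k \<longleftrightarrow> i = k"
  using power_card_le_iff[of i k] power_card_le_iff[of k i] by (auto simp: le_antisym)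

text \<open>The leading term dominates at a pole of \<open>s\<close>.\<close>

lemma val_ev_pole:
  assumes "P \<in> places c" "s \<noteq> 0" "valuation P s < 0" "p \<noteq> 0"
  shows "ev s p \<noteq> 0 \<and> valuation P (ev s p) = int (degree p) * valuation P s"
  using assms(4)
proof (induction p)
  case (pCons a p)
  interpret discrete_place P by (rule place_discrete) fact
  have a: "order_ge P 0 (c a)" using place_props(3)[OF assms(1)] order_ge_ring by blast
  show ?case
  proof (cases "p = 0")
    case True
    then have "a \<noteq> 0" using pCons by simp
    then have "c a \<noteq> 0" "c a \<notin> P" using place_const[OF assms(1)] by simp_all
    then show ?thesis using a True val_place[of "c a"] by (simp add: order_ge_def)
  next
    case False
    have IH: "ev s p \<noteq> 0" "valuation P (ev s p) = int (degree p) * valuation P s"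
      using pCons.IH[OF False] by simp_all
    have v: "valuation P (s * ev s p) = int (Suc (degree p)) * valuation P s"
      using val_mult[OF assms(2) IH(1)] IH(2) by (simp add: algebra_simps)
    have neg: "int (Suc (degree p)) * valuation P s < 0" using assms(3) by (intro mult_pos_neg) auto
    have "order_ge P (valuation P (s * ev s p) + 1) (c a)"
      using a by (rule order_ge_mono) (use v neg in linarith)
    from val_add[OF _ this] show ?thesis using v IH(1) assms(2) False by (simp add: add.commute)
  qed
qed simp

text \<open>
  Polynomials in \<open>1/z\<close> do not vanish at infinity if \<open>z\<close> does, so a nonzero \<open>z\<close> in this space is not one of
  them. Then \<open>ex_pole\<close> provides a place at which \<open>z\<close> has a pole.
\<close>

lemma RR_minus_Q0: "RR_space c (- frag_of Q0) = {0}"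
proof (rule ccontr)
  assume "RR_space c (- frag_of Q0) \<noteq> {0}"
  then obtain z where z: "z \<in> RR_space c (- frag_of Q0)" "z \<noteq> 0" using RR_zero by blast
  have ord: "valuation P z \<ge> (if P = Q0 then 1 else 0)" if "P \<in> places c" for P
    using z that unfolding RR_space_def by auto
  have Q: "valuation Q0 z > 0" using ord[OF Q0_place] by simp
  have "z \<notin> range (ev (inverse z))"
  proof
    assume "z \<in> range (ev (inverse z))"
    then obtain p where p: "z = ev (inverse z) p" by blast
    then have "p \<noteq> 0" using z(2) by auto
    have "valuation Q0 (inverse z) < 0" using Q z(2) by (simp add: Q0.val_inverse)
    from val_ev_pole[OF Q0_place _ this \<open>p \<noteq> 0\<close>] p z(2)
    have "valuation Q0 z = int (degree p) * valuation Q0 (inverse z)" by simp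
    also have "\<dots> \<le> 0" using \<open>valuation Q0 (inverse z) < 0\<close> by (simp add: mult_nonneg_nonpos)
    finally show False using Q by simp
  qed
  then obtain P where P: "P \<in> places c" "inverse z \<in> P" using ex_pole by blast
  interpret discrete_place P by (rule place_discrete) fact
  have "valuation P z < 0" using P z(2) val_place[of "inverse z"] by (simp add: val_inverse)
  then show False using ord[OF P(1)] by (simp split: if_splits)
qed

subsection \<open>Zeros of polynomials in x\<close>

lemma x_regular: "P \<in> places c \<Longrightarrow> P \<noteq> Q0 \<Longrightarrow> x \<in> place_ring P"
  using inf_unique by blast

lemma val_em_nonneg:
  assumes "P \<in> places c" "P \<noteq> Q0" "w \<noteq> 0" shows "valuation P (em w) \<ge> 0"
proof -
  interpret discrete_place P by (rule place_discrete) fact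
  show ?thesis using fin_em_mem[OF assms(1) x_regular[OF assms(1,2)], of w] val_ring[of "em w"] assms(3) by simp
qed

lemma ex_polynomial_vanishing:
  assumes "finite S" "S \<subseteq> places c - {Q0}"
  shows "\<exists>w. w \<noteq> 0 \<and> (\<forall>P\<in>S. valuation P (em w) \<ge> n P)"
  using assms
proof (induction S rule: finite_induct)
  case empty
  then show ?case by (intro exI[of _ 1]) auto
next
  case (insert P S)
  then obtain w where w: "w \<noteq> 0" "\<And>P. P \<in> S \<Longrightarrow> valuation P (em w) \<ge> n P" by auto
  have P: "P \<in> places c" "P \<noteq> Q0" using insert.prems by auto
  interpret A: discrete_place P by (rule place_discrete) fact
  obtain p where p: "p \<noteq> 0" "em p \<in> P" using fin_ex_poly[OF P(1) x_regular[OF P]] by blast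
  have p1: "valuation P (em p) \<ge> 1" using A.val_place[of "em p"] p by simp
  define k where "k = nat \<bar>n P\<bar>"
  have "valuation P' (em (w * p ^ k)) \<ge> n P'" if P': "P' \<in> insert P S" for P'
  proof -
    have P'': "P' \<in> places c" "P' \<noteq> Q0" using insert.prems P' by auto
    interpret B: discrete_place P' by (rule place_discrete) fact
    have v: "valuation P' (em (w * p ^ k)) = valuation P' (em w) + int k * valuation P' (em p)"
      using w(1) p(1) by (simp add: B.val_mult B.val_power)
    have nn: "valuation P' (em w) \<ge> 0" "int k * valuation P' (em p) \<ge> 0"
      using val_em_nonneg[OF P''] w(1) p(1) by simp_all
    show ?thesis
    proof (cases "P' = P")
      case True
      have "int k * 1 \<le> int k * valuation P (em p)" using p1 by (intro mult_left_mono) auto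
      then show ?thesis using v nn True by (simp add: k_def)
    next
      case False
      then show ?thesis using v nn w(2)[of P'] P' by auto
    qed
  qed
  moreover have "w * p ^ k \<noteq> 0" using w p by simp
  ultimately show ?case by blast
qed

text \<open>
  By weak approximation, incongruent residues modulo powers of the places can be prescribed
  independently inside the intersection of the valuation rings.
\<close>

lemma degree_zeros_le:
  assumes "finite S" "S \<subseteq> places c - {Q0}" "w \<noteq> 0"
  shows "(\<Sum>P\<in>S. valuation P (em w) * int (place_degree c P)) \<le> int m * int (degree w)"
proof -
  define n where "n P = nat (valuation P (em w))" for P
  have n: "int (n P) = valuation P (em w)" if "P \<in> S" for P
  proof -
    have "P \<in> places c" "P \<noteq> Q0" using assms(2) that by blast+
    then show ?thesis using val_em_nonneg[of P w] assms(3) by (simp add: n_def)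
  qed
  have disc: "discrete_place P" if "P \<in> S" for P using place_discrete assms(2) that by blast
  have "\<forall>P\<in>S. \<exists>X. finite X \<and> card X = CARD('q) ^ (place_degree c P * n P) \<and> X \<subseteq> place_ring P \<and>
             (\<forall>x\<in>X. \<forall>x'\<in>X. order_ge P (int (n P)) (x - x') \<longrightarrow> x = x')"
  proof
    fix P assume P: "P \<in> S"
    then have "P \<in> places c" using assms(2) by blast
    then obtain Z where Z: "residue_system P Z" using ex_residue_system by blast
    show "\<exists>X. finite X \<and> card X = CARD('q) ^ (place_degree c P * n P) \<and> X \<subseteq> place_ring P \<and>
             (\<forall>x\<in>X. \<forall>x'\<in>X. order_ge P (int (n P)) (x - x') \<longrightarrow> x = x')"
      using discrete_place.ex_incongruent_set[OF disc[OF P] Z, of "n P"]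
        residue_system_card[OF \<open>P \<in> places c\<close> Z] by (simp add: power_mult)
  qed
  then obtain X where "\<forall>P\<in>S. finite (X P) \<and> card (X P) = CARD('q) ^ (place_degree c P * n P)
      \<and> X P \<subseteq> place_ring P \<and> (\<forall>x\<in>X P. \<forall>x'\<in>X P. order_ge P (int (n P)) (x - x') \<longrightarrow> x = x')"
    unfolding bchoice_iff by (rule exE)
  then have X: "\<And>P. P \<in> S \<Longrightarrow> finite (X P)"
    "\<And>P. P \<in> S \<Longrightarrow> card (X P) = CARD('q) ^ (place_degree c P * n P)"
    "\<And>P. P \<in> S \<Longrightarrow> X P \<subseteq> place_ring P"
    "\<And>P u u'. P \<in> S \<Longrightarrow> u \<in> X P \<Longrightarrow> u' \<in> X P \<Longrightarrow> order_ge P (int (n P)) (u - u') \<Longrightarrow> u = u'"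
    by simp_all
  define N where "N = (\<Sum>P\<in>S. n P)"
  have N: "n P \<le> N" if "P \<in> S" for P unfolding N_def using assms(1) that by (intro member_le_sum) auto
  have "\<forall>g. \<exists>e. \<forall>P\<in>S. order_ge P (int N) (e - g P)"
    using weak_approximation[OF assms(1) disc] by blast
  then obtain \<phi> where \<phi>: "\<And>g P. P \<in> S \<Longrightarrow> order_ge P (int N) (\<phi> g - g P)" by metis
  define V where "V = (\<Inter>P\<in>S. place_ring P)"
  define G where "G = PiE S X"
  have ring: "ring_in_field V"
  proof -
    have "ring_in_field (place_ring P)" if "P \<in> S" for P
    proof -
      interpret discrete_place P by (rule disc) fact
      show ?thesis by (rule ring_in_field_axioms)
    qed
    then show ?thesis unfolding V_def
      by unfold_locales (auto intro: ring_in_field.one_mem ring_in_field.diff_mem ring_in_field.mult_mem)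
  qed
  have congr: "g P = g' P"
    if H: "g \<in> G" "g' \<in> G" "s \<in> V" "\<phi> g - \<phi> g' = em w * s" "P \<in> S" for g g' s P
  proof -
    interpret discrete_place P by (rule disc) fact
    have gX: "g P \<in> X P" "g' P \<in> X P" using H by (auto simp: G_def)
    have "order_ge P 0 s" using H by (auto simp: V_def order_ge_ring)
    then have "order_ge P (int (n P)) (s * em w)"
      using n[OF H(5)] assms(3) by (simp add: order_ge_mult_iff)
    then have 1: "order_ge P (int (n P)) (\<phi> g - \<phi> g')" unfolding H(4) by (simp only: mult.commute)
    have 2: "order_ge P (int (n P)) (\<phi> g - g P)" "order_ge P (int (n P)) (\<phi> g' - g' P)"
      using order_ge_mono[OF \<phi>[OF H(5)]] N[OF H(5)] by simp_all
    have "order_ge P (int (n P)) ((\<phi> g - \<phi> g') - (\<phi> g - g P) + (\<phi> g' - g' P))"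
      by (intro order_ge_add order_ge_diff 1 2)
    then have "order_ge P (int (n P)) (g P - g' P)" by simp
    then show ?thesis using X(4)[OF H(5) gX] by simp
  qed
  have congr': "g = g'" if "g \<in> G" "g' \<in> G" "s \<in> V" "\<phi> g - \<phi> g' = em w * s" for g g' s
    using congr[OF that] that(1,2) unfolding G_def by (intro PiE_ext) auto
  have zeroV: "0 \<in> V" using ring_in_field.zero_mem[OF ring] .
  have "inj_on \<phi> G" by (rule inj_onI) (use congr'[OF _ _ zeroV] in auto)
  then have "card (\<phi> ` G) = card G" by (rule card_image)
  also have "\<dots> = CARD('q) ^ (\<Sum>P\<in>S. place_degree c P * n P)"
    unfolding G_def using assms(1) X by (simp add: card_PiE power_sum)
  finally have cG: "card (\<phi> ` G) = CARD('q) ^ (\<Sum>P\<in>S. place_degree c P * n P)" .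
  have "card (\<phi> ` G) \<le> CARD('q) ^ (m * degree w)"
  proof (rule card_incongruent_le[OF ring _ assms(3)])
    show "em w \<in> V" unfolding V_def using fin_em_mem x_regular assms(2) by blast
    show "finite (\<phi> ` G)" unfolding G_def using assms(1) X by (intro finite_imageI finite_PiE) auto
    show "\<phi> ` G \<subseteq> V"
    proof
      fix z assume "z \<in> \<phi> ` G"
      then obtain g where g: "z = \<phi> g" "g \<in> G" by (rule imageE)
      have "\<phi> g \<in> place_ring P" if P: "P \<in> S" for P
      proof -
        interpret discrete_place P by (rule disc) fact
        have "g P \<in> place_ring P" using g P X(3)[OF P] by (auto simp: G_def)
        moreover have "\<phi> g - g P \<in> place_ring P"
          using order_ge_mono[OF \<phi>[OF P, of g], of 0] by (simp add: order_ge_ring)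
        ultimately have "(\<phi> g - g P) + g P \<in> place_ring P" by (intro add_mem)
        then show ?thesis by simp
      qed
      then show "z \<in> V" using g by (simp add: V_def)
    qed
    fix b b' s assume "b \<in> \<phi> ` G" "b' \<in> \<phi> ` G" "s \<in> V" "b - b' = em w * s"
    then show "b = b'" using congr' by (elim imageE) metis
  qed
  then have "(\<Sum>P\<in>S. place_degree c P * n P) \<le> m * degree w" unfolding cG power_card_le_iff .
  then have "int (\<Sum>P\<in>S. place_degree c P * n P) \<le> int (m * degree w)" by (simp only: of_nat_le_iff)
  moreover have "int (\<Sum>P\<in>S. place_degree c P * n P) = (\<Sum>P\<in>S. valuation P (em w) * int (place_degree c P))"
    using n by (simp add: mult.commute cong: sum.cong)
  ultimately show ?thesis by simp
qed

definition zeros :: "'q poly \<Rightarrow> 'f set set" where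
  "zeros w = {P \<in> places c. em w \<in> P}"

lemma zeros_props: assumes "w \<noteq> 0" "P \<in> zeros w"
  shows "P \<in> places c" "P \<noteq> Q0" "valuation P (em w) \<ge> 1"
proof -
  show P: "P \<in> places c" using assms by (simp add: zeros_def)
  interpret discrete_place P by (rule place_discrete) fact
  show v: "valuation P (em w) \<ge> 1" using val_place[of "em w"] assms by (simp add: zeros_def)
  show "P \<noteq> Q0"
  proof
    assume "P = Q0"
    then have "1 \<le> - (int m * int (degree w))" using v Q0_val_em[OF assms(1)] by simp
    moreover have "0 \<le> int m * int (degree w)" by simp
    ultimately show False by linarith
  qed
qed

lemma zeros_subset_finite: assumes "w \<noteq> 0" "finite S" "S \<subseteq> zeros w" shows "card S \<le> m * degree w"
proof -
  have "int (card S) = (\<Sum>P\<in>S. 1)" by simp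
  also have "\<dots> \<le> (\<Sum>P\<in>S. valuation P (em w) * int (place_degree c P))"
  proof (rule sum_mono)
    fix P assume "P \<in> S"
    then have P: "P \<in> zeros w" using assms by blast
    have "1 * 1 \<le> valuation P (em w) * int (place_degree c P)"
      using zeros_props[OF assms(1) P] degree_pos[of P] by (intro mult_mono) auto
    then show "1 \<le> valuation P (em w) * int (place_degree c P)" by simp
  qed
  also have "\<dots> \<le> int m * int (degree w)"
    using zeros_props[OF assms(1)] assms by (intro degree_zeros_le) auto
  finally show ?thesis by (simp flip: of_nat_mult)
qed

lemma finite_zeros: assumes "w \<noteq> 0" shows "finite (zeros w)"
proof (rule ccontr)
  assume "infinite (zeros w)"
  then obtain S where "S \<subseteq> zeros w" "finite S" "card S = Suc (m * degree w)"
    using infinite_arbitrarily_large by blast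
  then show False using zeros_subset_finite[OF assms] by fastforce
qed

definition zero_divisor :: "'q poly \<Rightarrow> 'f set \<Rightarrow>\<^sub>0 int" where
  "zero_divisor w = (\<Sum>P\<in>zeros w. frag_cmul (valuation P (em w)) (frag_of P))"

lemma lookup_zero_divisor:
  assumes "w \<noteq> 0"
  shows "lookup (zero_divisor w) P = (if P \<in> zeros w then valuation P (em w) else 0)"
proof -
  have "lookup (zero_divisor w) P
      = (\<Sum>P'\<in>zeros w. if P' = P then valuation P (em w) else 0)"
    unfolding zero_divisor_def lookup_sum by (intro sum.cong) auto
  then show ?thesis using finite_zeros[OF assms] by simp
qed

abbreviation poly_divisor :: "'q poly \<Rightarrow> 'f set \<Rightarrow>\<^sub>0 int" where
  "poly_divisor w \<equiv> zero_divisor w - frag_cmul (int m * int (degree w)) (frag_of Q0)"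

lemma lookup_zero_divisor_place:
  assumes "w \<noteq> 0" "P \<in> places c"
  shows "lookup (poly_divisor w) P = valuation P (em w)"
proof (cases "P = Q0")
  case True
  then show ?thesis
    using assms Q0_val_em zeros_props(2)[OF assms(1), of P] by (auto simp: lookup_minus lookup_zero_divisor)
next
  case False
  interpret discrete_place P by (rule place_discrete) fact
  have "valuation P (em w) = 0" if "P \<notin> zeros w"
    using that val_em_nonneg[OF assms(2) False assms(1)] val_place[of "em w"] assms by (auto simp: zeros_def)
  then show ?thesis using False by (auto simp: lookup_minus lookup_zero_divisor[OF assms(1)])
qed

lemma divisor_add: "divisor c A \<Longrightarrow> divisor c B \<Longrightarrow> divisor c (A + B)"
  using keys_add[of A B] by (auto simp: divisor_def)

lemma divisor_cmul: "divisor c A \<Longrightarrow> divisor c (frag_cmul k A)"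
  using keys_cmul[of k A] by (auto simp: divisor_def)

lemma divisor_diff: "divisor c A \<Longrightarrow> divisor c B \<Longrightarrow> divisor c (A - B)"
  using keys_diff[of A B] by (auto simp: divisor_def)

lemma divisor_of: "P \<in> places c \<Longrightarrow> divisor c (frag_of P)"
  by (simp add: divisor_def)

lemma divisor_zero: "divisor c 0"
  by (simp add: divisor_def)

lemma divisor_sum: "(\<And>i. i \<in> I \<Longrightarrow> divisor c (h i)) \<Longrightarrow> divisor c (sum h I)"
  by (induction I rule: infinite_finite_induct) (auto intro: divisor_zero divisor_add)

lemma divisor_zero_divisor: "w \<noteq> 0 \<Longrightarrow> divisor c (zero_divisor w)"
  unfolding zero_divisor_def using zeros_props(1) by (intro divisor_sum divisor_cmul divisor_of) auto

lemma degree_zero_divisor: 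
  "w \<noteq> 0 \<Longrightarrow> div_degree c (zero_divisor w) = (\<Sum>P\<in>zeros w. valuation P (em w) * int (place_degree c P))"
  unfolding zero_divisor_def by (simp add: div_degree_sum div_degree_cmul div_degree_of)

subsection \<open>Finiteness\<close>

lemma RR_mult:
  assumes "h \<noteq> 0" "\<And>P. P \<in> places c \<Longrightarrow> lookup H P = valuation P h"
  shows "RR_space c (A - H) = (\<lambda>z. z * h) ` RR_space c A"
proof -
  have iff: "z * h \<in> RR_space c (A - H) \<longleftrightarrow> z \<in> RR_space c A" for z
  proof -
    have "order_ge P (- lookup (A - H) P) (z * h) \<longleftrightarrow> order_ge P (- lookup A P) z"
      if P: "P \<in> places c" for P
    proof -
      interpret discrete_place P by (rule place_discrete) fact
      show ?thesis using order_ge_mult_iff[OF assms(1)] assms(2)[OF P] by (simp add: lookup_minus)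
    qed
    then show ?thesis unfolding RR_space_order by blast
  qed
  show ?thesis
  proof
    show "RR_space c (A - H) \<subseteq> (\<lambda>z. z * h) ` RR_space c A"
    proof
      fix z assume z: "z \<in> RR_space c (A - H)"
      have "z = (z / h) * h" using assms(1) by simp
      then show "z \<in> (\<lambda>z. z * h) ` RR_space c A" using z iff[of "z / h"] by (intro image_eqI) auto
    qed
  qed (use iff in blast)
qed

lemma finite_RR_Q0: assumes "l \<ge> -1" shows "finite (RR_space c (frag_cmul l (frag_of Q0)))"
proof (rule ell_mono(1))
  show "divisor c (- frag_of Q0)" using divisor_cmul[OF divisor_of[OF Q0_place], of "-1"] by simp
  show "divisor c (frag_cmul l (frag_of Q0))" by (intro divisor_cmul divisor_of Q0_place)
  show "finite (RR_space c (- frag_of Q0))" unfolding RR_minus_Q0 by simp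
  show "lookup (- frag_of Q0) P \<le> lookup (frag_cmul l (frag_of Q0)) P" for P
    using assms by simp
qed

text \<open>
  A polynomial with zeros of sufficiently high order at the places of \<open>A\<close> other than \<open>Q0\<close> does this.
\<close>

lemma ex_shift_below_Q0:
  assumes "divisor c A"
  shows "\<exists>w. w \<noteq> 0 \<and> (\<forall>P. P \<noteq> Q0 \<longrightarrow>
    lookup (A - poly_divisor w) P \<le> 0)"
proof -
  let ?S = "Poly_Mapping.keys A - {Q0}"
  have S: "?S \<subseteq> places c - {Q0}" using assms by (auto simp: divisor_def)
  obtain w where w: "w \<noteq> 0" "\<And>P. P \<in> ?S \<Longrightarrow> valuation P (em w) \<ge> lookup A P"
    using ex_polynomial_vanishing[OF _ S, of "lookup A"] by auto
  have "lookup (A - poly_divisor w) P \<le> 0"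
    if P: "P \<noteq> Q0" for P
  proof (cases "P \<in> places c")
    case True
    have "lookup A P \<le> valuation P (em w)"
      using w(2)[of P] val_em_nonneg[OF True P w(1)] P by (cases "P \<in> Poly_Mapping.keys A") (auto simp: in_keys_iff)
    then show ?thesis using lookup_zero_divisor_place[OF w(1) True] by (simp only: lookup_minus)
  next
    case False
    then have "P \<notin> Poly_Mapping.keys A" "P \<notin> zeros w" using assms by (auto simp: divisor_def zeros_def)
    then show ?thesis using P w(1) by (simp add: lookup_minus lookup_zero_divisor in_keys_iff)
  qed
  then show ?thesis using w(1) by blast
qed

lemma RR_mult_poly:
  assumes "w \<noteq> 0"
  shows "RR_space c (A - poly_divisor w)
    = (\<lambda>z. z * em w) ` RR_space c A"
  using assms lookup_zero_divisor_place by (intro RR_mult) auto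

lemma card_RR_mult_poly:
  assumes "w \<noteq> 0"
  shows "finite (RR_space c (A - poly_divisor w)) \<longleftrightarrow> finite (RR_space c A)"
    and "card (RR_space c (A - poly_divisor w)) = card (RR_space c A)"
proof -
  have "inj_on (\<lambda>z. z * em w) (RR_space c A)" using assms by (auto simp: inj_on_def)
  then show "finite (RR_space c (A - poly_divisor w)) \<longleftrightarrow> finite (RR_space c A)"
    "card (RR_space c (A - poly_divisor w)) = card (RR_space c A)"
    unfolding RR_mult_poly[OF assms] by (simp_all add: finite_image_iff card_image)
qed

text \<open>
  Multiplication by a polynomial embeds the space into the functions without poles outside \<open>Q0\<close>.
\<close>

lemma finite_RR: assumes "divisor c A" shows "finite (RR_space c A)"
proof -
  obtain w where w: "w \<noteq> 0" "\<And>P. P \<noteq> Q0 \<Longrightarrow>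
      lookup (A - poly_divisor w) P \<le> 0"
    using ex_shift_below_Q0[OF assms] by blast
  define B where "B = A - poly_divisor w"
  have wB: "lookup B P \<le> 0" if "P \<noteq> Q0" for P using w(2)[OF that] by (simp only: B_def)
  define l where "l = \<bar>lookup B Q0\<bar>"
  have "RR_space c B \<subseteq> RR_space c (frag_cmul l (frag_of Q0))"
  proof
    fix z assume z: "z \<in> RR_space c B"
    have "order_ge P (- lookup (frag_cmul l (frag_of Q0)) P) z" if P: "P \<in> places c" for P
    proof -
      interpret discrete_place P by (rule place_discrete) fact
      have "order_ge P (- lookup B P) z" using z P unfolding RR_space_order by blast
      then show ?thesis
        by (rule order_ge_mono) (use wB[of P] in \<open>auto simp: l_def\<close>)
    qed
    then show "z \<in> RR_space c (frag_cmul l (frag_of Q0))" unfolding RR_space_order by blast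
  qed
  then have "finite (RR_space c B)" by (rule finite_subset) (simp add: finite_RR_Q0 l_def)
  then show ?thesis using card_RR_mult_poly(1)[OF w(1)] unfolding B_def by blast
qed

lemma ell_mult_poly:
  assumes "divisor c A" "w \<noteq> 0"
  shows "ell c (A - poly_divisor w) = ell c A"
proof -
  let ?B = "A - poly_divisor w"
  have "divisor c ?B" by (intro divisor_diff divisor_cmul divisor_of Q0_place divisor_zero_divisor assms)
  then have "CARD('q) ^ ell c ?B = CARD('q) ^ ell c A"
    using card_RR_mult_poly(2)[OF assms(2), of A] card_RR finite_RR assms(1) by metis
  then show ?thesis unfolding power_card_eq_iff .
qed

subsection \<open>Riemann's inequality\<close>

text \<open>The monomials \<open>x\<^sup>i y\<^sup>j\<close> already produce enough functions with poles at infinity only.\<close>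

lemma ell_Q0_ge:
  assumes "l \<ge> int m * int (degree f)"
  shows "int (ell c (frag_cmul l (frag_of Q0))) \<ge> l - int m * int (degree f)"
proof -
  let ?A = "frag_cmul l (frag_of Q0)"
  define k where "k = nat ((l - int m * int (degree f)) div int m)"
  have k: "int k = (l - int m * int (degree f)) div int m" using assms m_pos by (simp add: k_def pos_imp_zdiv_nonneg_iff)
  have split: "l - int m * int (degree f) = int m * int k + (l - int m * int (degree f)) mod int m" unfolding k by simp
  then have k1: "int m * int k + int m * int (degree f) \<le> l"
    using pos_mod_sign[of "int m" "l - int m * int (degree f)"] m_pos by linarith
  from split have k2: "l - int m * int (degree f) \<le> int m * (int k + 1)"
    using pos_mod_bound[of "int m" "l - int m * int (degree f)"] m_pos
    unfolding distrib_left mult_1_right by linarith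
  let ?G = "{..<m} \<rightarrow>\<^sub>E {p::'q poly. degree p \<le> k}"
  have sub: "comb ` ?G \<subseteq> RR_space c ?A"
  proof
    fix z assume "z \<in> comb ` ?G"
    then obtain C where C: "z = comb C" "C \<in> ?G" by (rule imageE)
    have "order_ge P (- lookup ?A P) (comb C)" if P: "P \<in> places c" for P
    proof (cases "P = Q0")
      case True
      show ?thesis
      proof (cases "\<exists>j<m. C j \<noteq> 0")
        case True
        then obtain j0 where j0: "j0 < m" "C j0 \<noteq> 0" by blast
        obtain j where j: "j < m" "C j \<noteq> 0"
          "valuation Q0 (comb C) = - (int m * int (degree (C j)) + int (degree f) * int j)"
          using Q0_val_comb(2)[of j0 C, OF j0] by blast
        have "C j \<in> {p. degree p \<le> k}" using C(2) j(1) by (auto dest: PiE_mem)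
        then have "int m * int (degree (C j)) \<le> int m * int k" by (intro mult_left_mono) auto
        moreover have "int (degree f) * int j \<le> int (degree f) * int m" using j(1) by (intro mult_left_mono) auto
        ultimately have "valuation Q0 (comb C) \<ge> - l" using j(3) k1 by (simp add: mult.commute)
        then show ?thesis using \<open>P = Q0\<close> by (simp add: order_ge_def)
      next
        case False
        then have "comb C = 0" by (simp add: comb_def)
        then show ?thesis by (simp add: order_ge_def)
      qed
    next
      case False
      interpret discrete_place P by (rule place_discrete) fact
      have "comb C \<in> place_ring P" by (intro fin_comb_mem P x_regular False)
      then show ?thesis using False by (simp add: order_ge_ring)
    qed
    then show "z \<in> RR_space c ?A" unfolding C RR_space_order by blast
  qed
  have "inj_on comb ?G"
  proof (rule inj_onI)
    fix C C' assume C: "C \<in> ?G" "C' \<in> ?G" "comb C = comb C'"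
    have "comb (\<lambda>j. C j - C' j) = 0" using C(3) by (simp flip: comb_diff)
    then have "C j = C' j" if "j < m" for j using Q0_val_comb(1)[of j "\<lambda>j. C j - C' j"] that by auto
    then show "C = C'" using C by (intro PiE_ext) auto
  qed
  then have "CARD('q) ^ (m * Suc k) = card (comb ` ?G)" using card_coefficients(2)[of k] by (simp add: card_image)
  also have "\<dots> \<le> card (RR_space c ?A)"
    by (intro card_mono sub finite_RR divisor_cmul divisor_of Q0_place)
  also have "\<dots> = CARD('q) ^ ell c ?A" by (intro card_RR finite_RR divisor_cmul divisor_of Q0_place)
  finally have "m * Suc k \<le> ell c ?A" unfolding power_card_le_iff .
  then have "int (m * Suc k) \<le> int (ell c ?A)" by (simp only: of_nat_le_iff)
  then show ?thesis using k2 by (simp add: algebra_simps)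
qed

text \<open>
  A polynomial shift carries \<open>A\<close> to a divisor below a multiple \<open>l Q0\<close>. Neither the shift nor the enlargement to
  \<open>l Q0\<close> decreases the difference of degree and dimension, and \<open>ell_Q0_ge\<close> bounds it for \<open>l Q0\<close>.
\<close>

theorem riemann_bound:
  assumes "divisor c A"
  shows "div_degree c A - int (ell c A) \<le> int m * int (degree f)"
proof -
  obtain w where w: "w \<noteq> 0" "\<And>P. P \<noteq> Q0 \<Longrightarrow>
      lookup (A - poly_divisor w) P \<le> 0"
    using ex_shift_below_Q0[OF assms] by blast
  define B where "B = A - poly_divisor w"
  have wB: "lookup B P \<le> 0" if "P \<noteq> Q0" for P using w(2)[OF that] by (simp only: B_def)
  have dB: "divisor c B" unfolding B_def by (intro divisor_diff divisor_cmul divisor_of Q0_place divisor_zero_divisor assms w)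
  define l where "l = int m * int (degree f) + \<bar>lookup B Q0\<bar>"
  have dQ: "divisor c (frag_cmul l (frag_of Q0))" by (intro divisor_cmul divisor_of Q0_place)
  have "int (ell c (frag_cmul l (frag_of Q0))) - div_degree c (frag_cmul l (frag_of Q0))
      \<le> int (ell c B) - div_degree c B"
  proof (rule ell_mono(2)[OF dB dQ _ finite_RR[OF dB]])
    show "lookup B P \<le> lookup (frag_cmul l (frag_of Q0)) P" for P
    proof (cases "P = Q0")
      case True
      have "lookup B Q0 \<le> l"
        using abs_ge_self[of "lookup B Q0"] by (simp add: l_def add_increasing)
      then show ?thesis using True by simp
    next
      case False
      then show ?thesis using wB[OF False] by (simp only: lookup_frag_cmul lookup_frag_of if_False mult_zero_right)
    qed
  qed
  moreover have "div_degree c (frag_cmul l (frag_of Q0)) = l" by (simp add: div_degree_cmul div_degree_of degree_Q0)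
  moreover have "int (ell c (frag_cmul l (frag_of Q0))) \<ge> l - int m * int (degree f)"
    by (intro ell_Q0_ge) (simp add: l_def)
  moreover have "ell c B = ell c A" unfolding B_def by (rule ell_mult_poly[OF assms w(1)])
  moreover have "div_degree c B \<ge> div_degree c A"
  proof -
    have "div_degree c (zero_divisor w) \<le> int m * int (degree w)"
      unfolding degree_zero_divisor[OF w(1)]
      using zeros_props[OF w(1)] by (intro degree_zeros_le finite_zeros w(1)) auto
    moreover have "A = B + zero_divisor w + frag_cmul (- (int m * int (degree w))) (frag_of Q0)"
      by (rule poly_mapping_eqI) (simp add: B_def lookup_add lookup_minus)
    then have "div_degree c A = div_degree c B + div_degree c (zero_divisor w) - int m * int (degree w)"
      using arg_cong[of A _ "div_degree c"] by (simp add: div_degree_add div_degree_cmul div_degree_of degree_Q0)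
    ultimately show ?thesis by simp
  qed
  ultimately show ?thesis by linarith
qed

text \<open>The genus is defined as a greatest element; it exists by \<open>riemann_bound\<close>.\<close>

lemma riemann_inequality:
  assumes "divisor c A"
  shows "int (ell c A) \<ge> div_degree c A + 1 - genus c"
proof -
  define S where "S g \<longleftrightarrow> (\<exists>A. divisor c A \<and> g = div_degree c A - int (ell c A) + 1)" for g :: int
  let ?b = "int m * int (degree f) + 1"
  have bound: "g \<le> ?b" if "S g" for g using that riemann_bound unfolding S_def by fastforce
  have "S (div_degree c A - int (ell c A) + 1)" using assms unfolding S_def by blast
  note SA = this
  obtain g where g: "S g" "\<And>g'. S g' \<Longrightarrow> nat (?b - g) \<le> nat (?b - g')"
    using ex_has_least_nat[of S _ "\<lambda>g. nat (?b - g)"] SA by blast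
  have max: "g' \<le> g" if "S g'" for g' using g(2)[OF that] bound[OF that] bound[OF g(1)] by linarith
  have "genus c = g" unfolding genus_def S_def[symmetric] using g(1) max by (intro Greatest_equality)
  then show ?thesis using max[OF SA] by simp
qed

text \<open>
  Comparing \<open>L(i deg(w) m Q0)\<close> with \<open>L(i W)\<close>, where \<open>W\<close> is the divisor of zeros of \<open>w\<close>, shows that
  the degree of \<open>W\<close> is not too small either.
\<close>

lemma degree_zeros_ge:
  assumes "w \<noteq> 0"
  shows "div_degree c (zero_divisor w) \<ge> int m * int (degree w)"
proof (rule ccontr)
  assume H: "\<not> ?thesis"
  let ?D = "int m * int (degree w)"
  have lookupW: "lookup (zero_divisor w) P \<ge> 0" for P
    using zeros_props(3)[OF assms] lookup_zero_divisor[OF assms] by force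
  have step: "ell c (frag_cmul (int i * ?D) (frag_of Q0)) = ell c (frag_cmul (int i) (zero_divisor w))" for i
  proof -
    have "RR_space c (frag_cmul (int i) (zero_divisor w) - (frag_cmul (int i) (zero_divisor w) - frag_cmul (int i * ?D) (frag_of Q0)))
      = (\<lambda>z. z * em w ^ i) ` RR_space c (frag_cmul (int i) (zero_divisor w))"
    proof (rule RR_mult)
      fix P assume P: "P \<in> places c"
      interpret discrete_place P by (rule place_discrete) fact
      have "int i * lookup (zero_divisor w - frag_cmul ?D (frag_of Q0)) P = int i * valuation P (em w)"
        using lookup_zero_divisor_place[OF assms P] by simp
      then show "lookup (frag_cmul (int i) (zero_divisor w) - frag_cmul (int i * ?D) (frag_of Q0)) P
          = valuation P (em w ^ i)"
        using assms by (simp add: lookup_minus val_power algebra_simps)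
    qed (use assms in simp)
    then have eq: "RR_space c (frag_cmul (int i * ?D) (frag_of Q0))
        = (\<lambda>z. z * em w ^ i) ` RR_space c (frag_cmul (int i) (zero_divisor w))" by simp
    have "inj_on (\<lambda>z. z * em w ^ i) (RR_space c (frag_cmul (int i) (zero_divisor w)))"
      using assms by (auto simp: inj_on_def)
    then have "card (RR_space c (frag_cmul (int i * ?D) (frag_of Q0))) = card (RR_space c (frag_cmul (int i) (zero_divisor w)))"
      unfolding eq by (rule card_image)
    moreover have "finite (RR_space c (frag_cmul (int i * ?D) (frag_of Q0)))"
      "finite (RR_space c (frag_cmul (int i) (zero_divisor w)))"
      by (intro finite_RR divisor_cmul divisor_of Q0_place divisor_zero_divisor assms)+
    ultimately have "CARD('q) ^ ell c (frag_cmul (int i * ?D) (frag_of Q0)) = CARD('q) ^ ell c (frag_cmul (int i) (zero_divisor w))"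
      using card_RR by metis
    then show ?thesis unfolding power_card_eq_iff .
  qed
  have "int i * ?D - int m * int (degree f) - int (ell c 0) \<le> int i * div_degree c (zero_divisor w)" for i
  proof -
    have "int (ell c (frag_cmul (int i) (zero_divisor w))) - div_degree c (frag_cmul (int i) (zero_divisor w))
      \<le> int (ell c 0) - div_degree c 0"
      using lookupW by (intro ell_mono(2) divisor_zero divisor_cmul divisor_zero_divisor assms finite_RR) simp
    moreover have "div_degree c (frag_cmul (int i * ?D) (frag_of Q0)) = int i * ?D"
      by (simp add: div_degree_cmul div_degree_of degree_Q0)
    moreover have "divisor c (frag_cmul (int i * ?D) (frag_of Q0))" by (intro divisor_cmul divisor_of Q0_place)
    ultimately show ?thesis
      using riemann_bound[of "frag_cmul (int i * ?D) (frag_of Q0)"] step[of i]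
        div_degree_cmul[of "int i" "zero_divisor w"] div_degree_zero by linarith
  qed
  note * = this
  define K where "K = nat (int m * int (degree f) + int (ell c 0)) + 1"
  have "int K * (div_degree c (zero_divisor w) + 1) \<le> int K * ?D" using H by (intro mult_left_mono) auto
  then show False using *[of K] by (simp add: K_def algebra_simps)
qed

theorem degree_zeros:
  assumes "w \<noteq> 0"
  shows "(\<Sum>P\<in>zeros w. valuation P (em w) * int (place_degree c P)) = int m * int (degree w)"
  using degree_zeros_ge[OF assms] degree_zeros_le[OF finite_zeros[OF assms] _ assms] zeros_props[OF assms]
  unfolding degree_zero_divisor[OF assms] by force

end

section \<open>Ramification over a zero of f\<close>

lemma (in embedding) ev_monom: "ev s (monom a n) = c a * s ^ n"
  by (simp add: ev_def map_poly_monom poly_monom)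

context superelliptic
begin

lemma em_split: "\<exists>p'. em p = c (poly p a) + em [:- a, 1:] * em p'"
proof -
  have "p = [:- a, 1:] * synthetic_div p a + [:poly p a:]" by (rule synthetic_div_correct'[symmetric])
  then have "em p = em ([:- a, 1:] * synthetic_div p a + [:poly p a:])" by (rule arg_cong)
  then have "em p = em [:- a, 1:] * em (synthetic_div p a) + c (poly p a)" unfolding em_add em_mult em_const .
  then show ?thesis by (metis add.commute)
qed

definition Kxu :: "'f \<Rightarrow> 'f set" where
  "Kxu u = adjoin (range em) u"

lemma ring_range_em: "ring_in_field (range em)"
proof
  show "1 \<in> range em" by (intro range_eqI[of _ _ 1]) simp
  fix u v assume "u \<in> range em" "v \<in> range em"
  then obtain p q where "u = em p" "v = em q" by blast
  then show "u - v \<in> range em" "u * v \<in> range em"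
    using em_diff[of p q] em_mult[of p q] by (metis rangeI)+
qed

context
  fixes a :: 'q and P
  assumes P_zero: "P \<in> zeros [:- a, 1:]"
begin

lemma P_place: "P \<in> places c" and P_not_Q0: "P \<noteq> Q0" and val_X: "valuation P (em [:- a, 1:]) \<ge> 1"
  using zeros_props[OF _ P_zero] by simp_all

interpretation discrete_place P
  by (rule place_discrete) (rule P_place)

lemma em_in_place_iff: "em p \<in> P \<longleftrightarrow> poly p a = 0"
proof -
  obtain p' where p': "em p = c (poly p a) + em [:- a, 1:] * em p'" using em_split by blast
  have "em [:- a, 1:] \<in> nonunits (place_ring P)"
    using P_zero unfolding nonunits_place_ring zeros_def by blast
  then have X: "em [:- a, 1:] * em p' \<in> P"
    using nonunits_mult fin_em_mem[OF P_place x_regular[OF P_place P_not_Q0]] unfolding nonunits_place_ring by blast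
  have "em p \<in> P \<longleftrightarrow> c (poly p a) \<in> P"
  proof
    assume "em p \<in> P"
    then have "em p - em [:- a, 1:] * em p' \<in> P" using nonunits_diff X unfolding nonunits_place_ring by blast
    then show "c (poly p a) \<in> P" using p' by simp
  next
    assume "c (poly p a) \<in> P"
    then show "em p \<in> P" using nonunits_add X unfolding nonunits_place_ring p' by blast
  qed
  then show ?thesis using place_const[OF P_place] by simp
qed

lemma val_em_nonroot: assumes "poly p a \<noteq> 0" shows "valuation P (em p) = 0"
proof -
  have "p \<noteq> 0" using assms by auto
  moreover have "em p \<notin> P" unfolding em_in_place_iff by (rule assms)
  ultimately show ?thesis
    using val_place[of "em p"] val_em_nonneg[OF P_place P_not_Q0, of p] by simp
qed
text \<open>
  Here \<open>u\<close> is a \<open>d\<close>-th root of a polynomial that does not vanish at \<open>a\<close>. Reducing an element of \<open>K[x, u]\<close>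
  modulo \<open>x - a\<close> gives a polynomial in \<open>u\<close> over \<open>K\<close>. If it vanishes at \<open>P\<close>, then it is a multiple of the
  minimal polynomial \<open>\<pi>\<close> of \<open>u\<close> modulo \<open>P\<close>. Because \<open>T\<^sup>d - g(a)\<close> is separable, the complementary factor \<open>\<rho>\<close> of
  \<open>\<pi>\<close> is a unit at \<open>P\<close>, and after multiplication by it the element becomes divisible by \<open>x - a\<close>.
\<close>

context
  fixes u :: 'f and d :: nat and g :: "'q poly"
  assumes u_power: "u ^ d = em g" and g_a: "poly g a \<noteq> 0" and char_d: "(of_nat d :: 'q) \<noteq> 0"
begin

lemma d_pos: "d > 0"
  using char_d by (cases d) auto

lemma u_nonzero: "u \<noteq> 0"
proof
  assume "u = 0"
  then have "em g = 0" using u_power d_pos by (simp add: power_0_left)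
  then show False using g_a by simp
qed

lemma val_u: "valuation P u = 0"
proof -
  have "int d * valuation P u = 0"
    using val_power[OF u_nonzero, of d] val_em_nonroot[OF g_a] u_power by simp
  then show ?thesis using d_pos by simp
qed

lemma u_mem: "u \<in> place_ring P"
  using val_u u_nonzero val_ring by simp

interpretation Kxu: ring_in_field "Kxu u"
  unfolding Kxu_def by (rule ring_in_field.adjoin_ring[OF ring_range_em])

lemma em_Kxu: "em p \<in> Kxu u"
  unfolding Kxu_def using ring_in_field.subset_adjoin[OF ring_range_em] by blast

lemma u_Kxu: "u \<in> Kxu u"
  unfolding Kxu_def using ring_in_field.mem_adjoin[OF ring_range_em] .

lemma Kxu_ring: "Kxu u \<subseteq> place_ring P"
proof
  fix z assume "z \<in> Kxu u"
  then obtain p where p: "z = poly p u" "\<And>i. coeff p i \<in> range em" unfolding Kxu_def adjoin_def by blast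
  have "coeff p i \<in> place_ring P" for i
  proof -
    obtain q where "coeff p i = em q" using p(2)[of i] by blast
    then show ?thesis using fin_em_mem[OF P_place x_regular[OF P_place P_not_Q0]] by simp
  qed
  then show "z \<in> place_ring P" unfolding p(1) poly_altdef by (intro sum_mem mult_mem power_mem u_mem)
qed

lemma ev_Kxu: "ev u p \<in> Kxu u"
proof (induction p)
  case 0
  show ?case by (simp add: Kxu.zero_mem)
next
  case (pCons b p)
  have "c b \<in> Kxu u" using em_Kxu[of "[:b:]"] by simp
  then show ?case using pCons by (simp add: Kxu.add_mem Kxu.mult_mem u_Kxu)
qed

lemma Kxu_split: assumes "B \<in> Kxu u" shows "\<exists>B0 B'. B' \<in> Kxu u \<and> B = ev u B0 + em [:- a, 1:] * B'"
proof -
  obtain p where p: "B = poly p u" "\<And>i. coeff p i \<in> range em"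
    using assms unfolding Kxu_def adjoin_def by blast
  have "(\<forall>i. coeff p i \<in> range em) \<Longrightarrow> \<exists>B0 B'. B' \<in> Kxu u \<and> poly p u = ev u B0 + em [:- a, 1:] * B'" for p
  proof (induction p)
    case 0
    show ?case by (intro exI[of _ 0]) (simp add: Kxu.zero_mem)
  next
    case (pCons b p)
    have "coeff p i \<in> range em" for i using pCons.prems[rule_format, of "Suc i"] by simp
    then obtain B0 B' where B: "B' \<in> Kxu u" "poly p u = ev u B0 + em [:- a, 1:] * B'" using pCons.IH by blast
    obtain q where q: "b = em q" using pCons.prems[rule_format, of 0] by auto
    obtain q' where q': "em q = c (poly q a) + em [:- a, 1:] * em q'" using em_split by blast
    have "poly (pCons b p) u = ev u (pCons (poly q a) B0) + em [:- a, 1:] * (em q' + u * B')"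
      using B(2) q q' by (simp add: distrib_left mult.left_commute del: em_pCons)
    moreover have "em q' + u * B' \<in> Kxu u" by (intro Kxu.add_mem Kxu.mult_mem em_Kxu u_Kxu B)
    ultimately show ?case by blast
  qed
  then show ?thesis using p by blast
qed

lemma Kxu_step:
  assumes B: "B \<in> Kxu u" "B \<noteq> 0" "B \<in> P"
  shows "\<exists>B'\<in>Kxu u. B' \<noteq> 0 \<and> valuation P B = valuation P (em [:- a, 1:]) + valuation P B'"
proof -
  let ?X = "em [:- a, 1:]"
  have nP: "nonunits (place_ring P) = P" by (rule nonunits_place_ring)
  have X0: "?X \<noteq> 0" unfolding em_eq_0 by simp
  have XP: "?X * z \<in> P" if "z \<in> Kxu u" for z
  proof -
    have "?X \<in> nonunits (place_ring P)" using P_zero unfolding nP zeros_def by blast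
    then show ?thesis using nonunits_mult that Kxu_ring unfolding nP by blast
  qed
  define h where "h = monom 1 d - [:poly g a:]"
  obtain g' where g': "em g = c (poly g a) + ?X * em g'" using em_split by blast
  have evh: "ev u h = ?X * em g'" using u_power g' by (simp add: h_def ev_diff ev_monom del: em_pCons)
  have hP: "ev u h \<in> P" unfolding evh by (rule XP[OF em_Kxu])
  have "coeff h d = 1" using d_pos by (cases d) (auto simp: h_def coeff_pCons)
  then have h0: "h \<noteq> 0" by auto
  then obtain \<pi> where \<pi>: "\<pi> \<noteq> 0" "ev u \<pi> \<in> P"
    and min: "\<And>p. p \<noteq> 0 \<Longrightarrow> ev u p \<in> P \<Longrightarrow> degree \<pi> \<le> degree p"
    using ex_has_least_nat[of "\<lambda>p. p \<noteq> 0 \<and> ev u p \<in> P" h degree] hP by blast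
  have multP: "ev u q * z \<in> P" if "z \<in> P" for q z
    using nonunits_mult[of z "ev u q"] that ev_Kxu Kxu_ring unfolding nP by (auto simp: mult.commute)
  have \<pi>_dvd: "\<exists>q. p = q * \<pi>" if "ev u p \<in> P" for p
  proof -
    have "p mod \<pi> = p - p div \<pi> * \<pi>" by (simp add: minus_div_mult_eq_mod)
    then have "ev u (p mod \<pi>) = ev u p - ev u (p div \<pi>) * ev u \<pi>" by (simp add: ev_diff ev_mult)
    also have "\<dots> \<in> P" using nonunits_diff that multP[OF \<pi>(2)] unfolding nP by blast
    finally have "p mod \<pi> = 0" using min[of "p mod \<pi>"] degree_mod_less[OF \<pi>(1), of p] by fastforce
    then have "p = p div \<pi> * \<pi>" using div_mult_mod_eq[of p \<pi>] by simp
    then show ?thesis by blast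
  qed
  obtain B0 B1 where B1: "B1 \<in> Kxu u" "B = ev u B0 + ?X * B1" using Kxu_split[OF B(1)] by blast
  have "B - ?X * B1 \<in> P" using nonunits_diff B(3) XP[OF B1(1)] unfolding nP by blast
  then have "ev u B0 \<in> P" using B1(2) by simp
  then obtain \<tau> where \<tau>: "B0 = \<tau> * \<pi>" using \<pi>_dvd by blast
  obtain \<rho> where \<rho>: "h = \<rho> * \<pi>" using \<pi>_dvd[OF hP] by blast
  have "ev u \<rho> \<notin> P"
  proof
    assume "ev u \<rho> \<in> P"
    have "pderiv h = \<rho> * pderiv \<pi> + \<pi> * pderiv \<rho>" unfolding \<rho> by (rule pderiv_mult)
    then have "ev u (pderiv h) = ev u (pderiv \<pi>) * ev u \<rho> + ev u (pderiv \<rho>) * ev u \<pi>"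
      by (simp add: ev_add ev_mult mult.commute)
    also have "\<dots> \<in> P" using nonunits_add multP[OF \<open>ev u \<rho> \<in> P\<close>] multP[OF \<pi>(2)] unfolding nP by blast
    finally have 1: "ev u (pderiv h) \<in> P" .
    have "pderiv h = monom (of_nat d) (d - 1)" by (simp add: h_def pderiv_diff pderiv_monom pderiv_pCons)
    then have 2: "ev u (pderiv h) = c (of_nat d) * u ^ (d - 1)" by (simp add: ev_monom)
    have "c (of_nat d) \<noteq> 0" "c (of_nat d) \<notin> P" using char_d place_const[OF P_place] by simp_all
    moreover have "order_ge P 0 (c (of_nat d))" using place_props(3)[OF P_place] order_ge_ring by blast
    ultimately have "valuation P (c (of_nat d)) = 0" using val_place[of "c (of_nat d)"] by (simp add: order_ge_def)
    then have "valuation P (ev u (pderiv h)) = 0" "ev u (pderiv h) \<noteq> 0"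
      unfolding 2 using u_nonzero \<open>c (of_nat d) \<noteq> 0\<close> val_u by (simp_all add: val_mult val_power)
    then show False using 1 val_place by simp
  qed
  moreover have "ev u \<rho> \<in> place_ring P" using ev_Kxu Kxu_ring by blast
  ultimately have "unit_in (place_ring P) (ev u \<rho>)" using unit_or_nonunit unfolding nP by blast
  then have \<rho>u: "ev u \<rho> \<noteq> 0" "valuation P (ev u \<rho>) = 0" using val_unit by auto
  define B' where "B' = ev u \<tau> * em g' + ev u \<rho> * B1"
  have "ev u \<rho> * ev u B0 = ev u \<tau> * ev u h" unfolding \<tau> \<rho> by (simp add: ev_mult)
  then have eq: "ev u \<rho> * B = ?X * B'"
    unfolding B1(2) B'_def evh by (simp add: algebra_simps del: em_pCons)
  have "B' \<in> Kxu u" unfolding B'_def by (intro Kxu.add_mem Kxu.mult_mem ev_Kxu em_Kxu B1)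
  moreover have B'0: "B' \<noteq> 0" using eq \<rho>u B(2) by auto
  moreover have "valuation P B = valuation P ?X + valuation P B'"
    using val_mult[OF \<rho>u(1) B(2)] val_mult[OF X0 B'0] eq \<rho>u(2) by simp
  ultimately show ?thesis by blast
qed

lemma Kxu_unramified:
  assumes "B \<in> Kxu u" "B \<noteq> 0"
  shows "valuation P (em [:- a, 1:]) dvd valuation P B"
  using assms
proof (induction "nat (valuation P B)" arbitrary: B rule: less_induct)
  case less
  have nn: "valuation P B \<ge> 0" using less.prems Kxu_ring val_ring by blast
  show ?case
  proof (cases "B \<in> P")
    case False
    then show ?thesis using nn val_place[OF less.prems(2)] by simp
  next
    case True
    obtain B' where B': "B' \<in> Kxu u" "B' \<noteq> 0" "valuation P B = valuation P (em [:- a, 1:]) + valuation P B'"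
      using Kxu_step[OF less.prems True] by blast
    have "valuation P B' \<ge> 0" using B' Kxu_ring val_ring by blast
    then have "nat (valuation P B') < nat (valuation P B)" using B'(3) val_X by linarith
    from less.hyps[OF this B'(1,2)] show ?thesis unfolding B'(3) by simp
  qed
qed

end

text \<open>
  If \<open>x - a\<close> divides \<open>f\<close> exactly \<open>l\<close> times, then \<open>F\<close> is generated by \<open>y\<close> over the field of the previous
  lemmas, where \<open>y\<close> is an \<open>m/d\<close>-th root of \<open>u (x - a)\<^sup>l\<^sup>/\<^sup>d\<close> with \<open>d = gcd m l\<close>. So all orders lie in the group generated by
  \<open>1/(m/d)\<close> times the order of \<open>x - a\<close>.
\<close>

lemma kummer_valuations:
  assumes f_eq: "f = [:- a, 1:] ^ l * g" and g_a: "poly g a \<noteq> 0" and char: "(of_nat m :: 'q) \<noteq> 0"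
  shows "valuation P (em [:- a, 1:]) = int (m div gcd m l)" and "valuation P y = int (l div gcd m l)"
proof -
  let ?X = "em [:- a, 1:]"
  define d where "d = gcd m l"
  define m' where "m' = m div d"
  define l' where "l' = l div d"
  have d0: "d > 0" using m_pos by (simp add: d_def)
  have m: "m = m' * d" and l: "l = l' * d" by (simp_all add: m'_def l'_def d_def)
  have m'0: "m' > 0" using m m_pos by (cases m') auto
  have cop: "coprime l' m'" unfolding l'_def m'_def d_def using m_pos
    by (metis coprime_commute div_gcd_coprime less_numeral_extra(3))
  have char_d: "(of_nat d :: 'q) \<noteq> 0" using char unfolding m of_nat_mult by auto
  have X0: "?X \<noteq> 0" unfolding em_eq_0 by simp
  define u where "u = y ^ m' / ?X ^ l'"
  have em_f: "em f = ?X ^ l * em g" unfolding f_eq by (simp only: em_mult em_power)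
  have yX: "y ^ m' = u * ?X ^ l'" using X0 by (simp add: u_def del: em_pCons)
  have up: "u ^ d = em g"
  proof -
    have "u ^ d = y ^ m / ?X ^ l" by (simp only: u_def power_divide power_mult[symmetric] m l)
    then show ?thesis unfolding y_power_em em_f using X0 by (simp del: em_pCons)
  qed
  define e where "e = valuation P ?X"
  define v where "v = valuation P y"
  have g0: "em g \<noteq> 0" using g_a by auto
  have "int m * v = int l * e"
  proof -
    have "int m * v = valuation P (em f)" unfolding v_def y_power_em[symmetric] using y_nonzero by (simp add: val_power)
    also have "\<dots> = int l * e"
      unfolding em_f e_def using X0 g0 val_em_nonroot[OF g_a] by (simp add: val_mult val_power del: em_pCons)
    finally show ?thesis .
  qed
  then have ml: "int m' * v = int l' * e" unfolding m l using d0 by simp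
  then have "int m' dvd int l' * e" by (metis dvd_triv_left)
  then have "int m' dvd e" using cop by (simp add: coprime_dvd_mult_right_iff coprime_commute)
  then obtain e' where e': "e = int m' * e'" by blast
  have v: "v = int l' * e'"
  proof -
    have "int m' * v = int m' * (int l' * e')" using ml e' by simp
    then show ?thesis using m'0 by simp
  qed
  interpret R: ring_in_field "Kxu u" unfolding Kxu_def by (rule ring_in_field.adjoin_ring[OF ring_range_em])
  have unram: "e dvd valuation P B" if "B \<in> Kxu u" "B \<noteq> 0" for B
    unfolding e_def by (rule Kxu_unramified[OF up g_a char_d that])
  define S where "S = {z. \<exists>D. (\<forall>j. D j \<in> Kxu u) \<and> z = (\<Sum>j<m'. D j * y ^ j)}"
  have S_zero: "0 \<in> S" unfolding S_def using R.zero_mem by (intro CollectI exI[of _ "\<lambda>_. 0"]) simp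
  have S_add: "z + w \<in> S" if "z \<in> S" "w \<in> S" for z w
  proof -
    obtain D where D: "\<forall>j. D j \<in> Kxu u" "z = (\<Sum>j<m'. D j * y ^ j)"
      using \<open>z \<in> S\<close> unfolding S_def by blast
    obtain D' where "\<forall>j. D' j \<in> Kxu u" "w = (\<Sum>j<m'. D' j * y ^ j)"
      using \<open>w \<in> S\<close> unfolding S_def by blast
    with D show ?thesis unfolding S_def
      by (intro CollectI exI[of _ "\<lambda>j. D j + D' j"]) (auto simp: distrib_right sum.distrib intro: R.add_mem)
  qed
  have S_monomial: "em p * y ^ i \<in> S" for p i
  proof -
    define B where "B = em p * (u * ?X ^ l') ^ (i div m')"
    have B: "B \<in> Kxu u" unfolding B_def
      by (intro R.mult_mem R.power_mem em_Kxu[OF up g_a char_d] u_Kxu[OF up g_a char_d])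
    have "y ^ i = (y ^ m') ^ (i div m') * y ^ (i mod m')"
      by (metis mult_div_mod_eq power_add power_mult)
    then have eq: "em p * y ^ i = B * y ^ (i mod m')" unfolding B_def yX by simp
    have "(\<Sum>j<m'. (if j = i mod m' then B else 0) * y ^ j) = (\<Sum>j<m'. if j = i mod m' then B * y ^ (i mod m') else 0)"
      by (intro sum.cong) auto
    also have "\<dots> = B * y ^ (i mod m')" using m'0 by simp
    finally show ?thesis unfolding S_def eq using B R.zero_mem
      by (intro CollectI exI[of _ "\<lambda>j. if j = i mod m' then B else 0"]) auto
  qed
  have S_sum: "(\<Sum>j\<in>J. h j) \<in> S" if "\<And>j. j \<in> J \<Longrightarrow> h j \<in> S" for h :: "nat \<Rightarrow> 'f" and J
    using that by (induction J rule: infinite_finite_induct) (auto intro: S_zero S_add)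
  have S_val: "e' dvd valuation P z" if z: "z \<in> S" "z \<noteq> 0" for z
  proof -
    obtain D where D: "\<And>j. D j \<in> Kxu u" "z = (\<Sum>j<m'. D j * y ^ j)" using z unfolding S_def by blast
    define J where "J = {j. j < m' \<and> D j \<noteq> 0}"
    have zJ: "z = (\<Sum>j\<in>J. D j * y ^ j)" unfolding D(2) J_def by (intro sum.mono_neutral_right) auto
    have val: "\<exists>k. valuation P (D j * y ^ j) = e' * (int m' * k + int l' * int j)" if "j \<in> J" for j
    proof -
      have Dj: "D j \<noteq> 0" using that by (simp add: J_def)
      obtain k where "valuation P (D j) = e * k" using unram[OF D(1) Dj] by blast
      then have "valuation P (D j * y ^ j) = e' * (int m' * k + int l' * int j)"
        using Dj y_nonzero v e' unfolding v_def by (simp add: val_mult val_power algebra_simps)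
      then show ?thesis by blast
    qed
    have e'0: "e' \<noteq> 0" using e' val_X unfolding e_def by auto
    have "\<exists>j\<in>J. valuation P (\<Sum>j\<in>J. D j * y ^ j) = valuation P (D j * y ^ j)"
    proof (rule val_sum_distinct[THEN conjunct2, THEN conjunct1])
      show "finite J" by (simp add: J_def)
      show "J \<noteq> {}" using z(2) zJ by auto
      show "inj_on (\<lambda>j. valuation P (D j * y ^ j)) J"
      proof (rule inj_onI)
        fix j j' assume H: "j \<in> J" "j' \<in> J" "valuation P (D j * y ^ j) = valuation P (D j' * y ^ j')"
        obtain k k' where "valuation P (D j * y ^ j) = e' * (int m' * k + int l' * int j)"
          "valuation P (D j' * y ^ j') = e' * (int m' * k' + int l' * int j')" using val H(1,2) by blast
        then have "int m' * k + int l' * int j = int m' * k' + int l' * int j'" using H(3) e'0 by simp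
        then show "j = j'" using coprime_orders_inj[OF cop] H(1,2) by (simp add: J_def)
      qed
      show "D j * y ^ j \<noteq> 0" if "j \<in> J" for j using that y_nonzero by (simp add: J_def)
    qed
    then obtain j where "j \<in> J" "valuation P z = valuation P (D j * y ^ j)" unfolding zJ by blast
    then show ?thesis using val[of j] by auto
  qed
  obtain z where z: "z \<noteq> 0" "valuation P z = 1" using ex_val_1 by blast
  obtain C D where C: "D \<noteq> 0" "z = comb C / em D" using representation by blast
  have "comb C \<noteq> 0" using C z by auto
  have "comb C \<in> S" unfolding comb_def by (intro S_sum S_monomial)
  then have 1: "e' dvd valuation P (comb C)" using S_val \<open>comb C \<noteq> 0\<close> by blast
  have "e' dvd e" using e' by simp
  moreover have "e dvd valuation P (em D)" using C em_Kxu[OF up g_a char_d] by (intro unram) auto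
  ultimately have 2: "e' dvd valuation P (em D)" by (rule dvd_trans)
  have "valuation P z = valuation P (comb C) - valuation P (em D)"
    using C \<open>comb C \<noteq> 0\<close> by (simp add: val_divide)
  then have "e' dvd 1" using 1 2 z(2) by (metis dvd_diff)
  moreover have "e' > 0"
  proof -
    have "int m' * e' > 0" using val_X e' unfolding e_def by linarith
    then show ?thesis using m'0 by (simp add: zero_less_mult_iff)
  qed
  ultimately have "e' = 1" by (simp add: zdvd1_eq)
  then show "valuation P ?X = int (m div gcd m l)" "valuation P y = int (l div gcd m l)"
    using e' v by (simp_all add: e_def v_def m'_def l'_def d_def)
qed

end

text \<open>
  The function \<open>x - a\<close> has order \<open>m / gcd m l\<close> at each of its zeros, and these orders, weighted by the
  degrees, add up to \<open>m\<close>.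
\<close>

lemma sum_degree_over_zero:
  assumes "f = [:- a, 1:] ^ l * g" "poly g a \<noteq> 0" "(of_nat m :: 'q) \<noteq> 0"
  shows "(\<Sum>P\<in>zeros [:- a, 1:]. place_degree c P) = gcd m l"
proof -
  have "int (m div gcd m l) * int (\<Sum>P\<in>zeros [:- a, 1:]. place_degree c P)
      = (\<Sum>P\<in>zeros [:- a, 1:]. valuation P (em [:- a, 1:]) * int (place_degree c P))"
    using kummer_valuations(1)[OF _ assms] by (simp add: sum_distrib_left del: em_pCons)
  also have "\<dots> = int m" using degree_zeros[of "[:- a, 1:]"] by (simp del: em_pCons)
  finally have "(m div gcd m l) * (\<Sum>P\<in>zeros [:- a, 1:]. place_degree c P) = m"
    by (metis of_nat_eq_iff of_nat_mult)
  also have "m = (m div gcd m l) * gcd m l" by simp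
  finally show ?thesis using m_pos by (metis gcd_dvd1 dvd_div_eq_0_iff mult_left_cancel not_gr0)
qed

end

section \<open>The places of the rational function field\<close>

text \<open>The local ring of the affine line at the point \<open>a\<close>.\<close>

definition zero_ring :: "'k::field \<Rightarrow> 'k poly fract set" where
  "zero_ring a = {Fract p q | p q. poly q a \<noteq> 0}"

lemma uniformized_zero_ring:
  "uniformized (zero_ring a) (to_fract [:- a, 1:])" and nonunits_zero_ring: "nonunits (zero_ring a) = zero_place a"
  and zero_ring_decomposition: "z \<noteq> 0 \<Longrightarrow> \<exists>n p q. poly p a \<noteq> 0 \<and> poly q a \<noteq> 0 \<and>
     has_order (zero_ring a) (to_fract [:- a, 1:]) n z \<and> z = to_fract [:- a, 1:] powi n * Fract p q"
proof -
  let ?V = "zero_ring a" and ?t = "to_fract [:- a, 1:]"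
  have memI: "Fract p q \<in> ?V" if "poly q a \<noteq> 0" for p q using that unfolding zero_ring_def by blast
  have ring: "ring_in_field ?V"
  proof
    show "1 \<in> ?V" unfolding One_fract_def by (rule memI) simp
    fix u v assume "u \<in> ?V" "v \<in> ?V"
    then obtain p q p' q' where H: "u = Fract p q" "poly q a \<noteq> 0" "v = Fract p' q'" "poly q' a \<noteq> 0"
      unfolding zero_ring_def by blast
    then have "q \<noteq> 0" "q' \<noteq> 0" by auto
    then show "u - v \<in> ?V" unfolding H by (simp add: memI H)
    show "u * v \<in> ?V" unfolding H by (simp add: memI H)
  qed
  have unit: "unit_in ?V (Fract p q)" if "poly p a \<noteq> 0" "poly q a \<noteq> 0" for p q
    unfolding unit_in_def using that by (auto simp: memI Fract_conv_to_fract) (auto simp: memI simp flip: Fract_conv_to_fract)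
  have t0: "?t \<noteq> 0" by simp
  have tV: "?t \<in> ?V" unfolding to_fract_def by (rule memI) simp
  have dec: "\<exists>n p q. poly p a \<noteq> 0 \<and> poly q a \<noteq> 0 \<and> z = ?t powi n * Fract p q" if z: "z \<noteq> 0" for z
  proof -
    obtain p q where pq: "z = Fract p q" "q \<noteq> 0" by (cases z) auto
    then have "p \<noteq> 0" using z by (auto simp: eq_fract Zero_fract_def)
    then obtain p' where p': "p = [:- a, 1:] ^ order a p * p'" "\<not> [:- a, 1:] dvd p'" using order_decomp by blast
    obtain q' where q': "q = [:- a, 1:] ^ order a q * q'" "\<not> [:- a, 1:] dvd q'" using order_decomp[OF pq(2)] by blast
    have pow: "to_fract (b ^ n) = to_fract b ^ n" for b :: "'a poly" and n by (induction n) auto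
    have "z = to_fract p / to_fract q" using pq Fract_conv_to_fract by simp
    moreover have "to_fract p = ?t ^ order a p * to_fract p'"
      using arg_cong[OF p'(1), of to_fract] unfolding to_fract_mult pow .
    moreover have "to_fract q = ?t ^ order a q * to_fract q'"
      using arg_cong[OF q'(1), of to_fract] unfolding to_fract_mult pow .
    ultimately have "z = ?t powi (int (order a p) - int (order a q)) * Fract p' q'"
      using t0 by (simp add: Fract_conv_to_fract power_int_diff)
    then show ?thesis using p' q' by (metis poly_eq_0_iff_dvd)
  qed
  have ho: "has_order ?V ?t n (?t powi n * Fract p q)" if "poly p a \<noteq> 0" "poly q a \<noteq> 0" for n p q
    unfolding has_order_def using unit[OF that] by blast
  interpret ring_in_field ?V by (rule ring)
  have "total_ring ?V"
  proof
    fix z :: "'a poly fract"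
    show "z \<in> ?V \<or> inverse z \<in> ?V"
    proof (cases "z = 0")
      case False
      then obtain n p q where n: "poly p a \<noteq> 0" "poly q a \<noteq> 0" "z = ?t powi n * Fract p q" using dec by blast
      show ?thesis
      proof (cases "n \<ge> 0")
        case True
        then have "z = ?t ^ nat n * Fract p q" using n by (simp add: power_int_def)
        moreover have "?t ^ nat n * Fract p q \<in> ?V" by (intro mult_mem power_mem tV memI n)
        ultimately show ?thesis by simp
      next
        case False
        then have "inverse z = ?t ^ nat (- n) * Fract q p" using n by (simp add: power_int_def power_inverse)
        moreover have "?t ^ nat (- n) * Fract q p \<in> ?V" by (intro mult_mem power_mem tV memI n)
        ultimately show ?thesis by simp
      qed
    qed (simp add: zero_mem)
  qed
  then interpret total_ring ?V .
  show nu: "nonunits ?V = zero_place a"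
  proof (intro set_eqI iffI)
    fix z assume z: "z \<in> nonunits ?V"
    then obtain p q where pq: "z = Fract p q" "poly q a \<noteq> 0" unfolding nonunits_def zero_ring_def by blast
    have "poly p a = 0"
    proof (rule ccontr)
      assume "poly p a \<noteq> 0"
      then show False using unit[OF _ pq(2)] z not_unit_nonunit unfolding pq by blast
    qed
    then show "z \<in> zero_place a" unfolding zero_place_def pq(1)
      using pq(2) by (intro CollectI exI[of _ p] exI[of _ q]) (auto simp: poly_eq_0_iff_dvd)
  next
    fix z assume "z \<in> zero_place a"
    then obtain p q where pq: "z = Fract p q" "poly p a = 0" "poly q a \<noteq> 0"
      unfolding zero_place_def poly_eq_0_iff_dvd[symmetric] by blast
    have "\<not> unit_in ?V z"
    proof
      assume "unit_in ?V z"
      then have "inverse z \<in> ?V" by (simp add: unit_in_def)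
      then obtain p2 q2 where pq2: "Fract q p = Fract p2 q2" "poly q2 a \<noteq> 0" unfolding pq zero_ring_def by auto
      show False
      proof (cases "p = 0")
        case True
        then have "z = 0" using pq by (simp add: Fract_conv_to_fract)
        then show False using \<open>unit_in ?V z\<close> by (simp add: unit_in_def)
      next
        case False
        moreover have "q2 \<noteq> 0" using pq2 by auto
        ultimately have "q * q2 = p2 * p" using pq2(1) by (simp add: eq_fract)
        then have "poly q a * poly q2 a = poly p2 a * poly p a" by (metis poly_mult)
        then show False using pq pq2 by simp
      qed
    qed
    then show "z \<in> nonunits ?V" using unit_or_nonunit pq memI by blast
  qed
  show "uniformized ?V ?t"
  proof
    show "?t \<noteq> 0" by (rule t0)
    show "?t \<in> nonunits ?V" unfolding nu zero_place_def to_fract_def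
      by (intro CollectI exI[of _ "[:- a, 1:]"] exI[of _ 1]) (auto simp: poly_eq_0_iff_dvd[symmetric])
    fix z :: "'a poly fract" assume "z \<noteq> 0"
    then show "\<exists>n. has_order ?V ?t n z" using dec ho by blast
  qed
  assume "z \<noteq> 0"
  then show "\<exists>n p q. poly p a \<noteq> 0 \<and> poly q a \<noteq> 0 \<and> has_order ?V ?t n z \<and> z = ?t powi n * Fract p q"
    using dec ho by blast
qed

context superelliptic
begin

lemma places_over_zero_place: "places_over ratfun_const \<iota> (zero_place a) = zeros [:- a, 1:]"
proof (intro set_eqI iffI)
  fix P assume "P \<in> places_over ratfun_const \<iota> (zero_place a)"
  then have P: "P \<in> places c" "\<iota> ` zero_place a \<subseteq> P" by (auto simp: places_over_def c_def)
  have "to_fract [:- a, 1:] \<in> zero_place a"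
    unfolding zero_place_def to_fract_def
    by (intro CollectI exI[of _ "[:- a, 1:]"] exI[of _ 1]) (auto simp: poly_eq_0_iff_dvd[symmetric])
  then have "em [:- a, 1:] \<in> P" unfolding em_def using P(2) by blast
  then show "P \<in> zeros [:- a, 1:]" using P by (simp add: zeros_def del: em_pCons)
next
  fix P assume P: "P \<in> zeros [:- a, 1:]"
  then have Pc: "P \<in> places c" by (simp add: zeros_def)
  interpret discrete_place P by (rule place_discrete) fact
  have "\<iota> ` zero_place a \<subseteq> P"
  proof
    fix z assume "z \<in> \<iota> ` zero_place a"
    then obtain p q where pq: "z = em p / em q" "poly p a = 0" "poly q a \<noteq> 0"
      unfolding zero_place_def poly_eq_0_iff_dvd[symmetric] by (auto simp: iota_Fract)
    show "z \<in> P"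
    proof (cases "p = 0")
      case True
      then show ?thesis using pq zero_in_place by simp
    next
      case False
      have "em p \<in> P" using em_in_place_iff[OF P] pq by simp
      then have "valuation P (em p) > 0" using val_place[of "em p"] False by simp
      moreover have "em q \<noteq> 0" using pq by auto
      ultimately show ?thesis using val_place[of z] False val_em_nonroot[OF P pq(3)] pq(1) by (simp add: val_divide)
    qed
  qed
  then show "P \<in> places_over ratfun_const \<iota> (zero_place a)" using Pc by (auto simp: places_over_def c_def)
qed

lemma ram_index_zero_place:
  assumes "P \<in> zeros [:- a, 1:]"
  shows "int (ram_index \<iota> (zero_place a) P) = valuation P (em [:- a, 1:])"
proof -
  let ?e = "valuation P (em [:- a, 1:])"
  interpret discrete_place P by (rule place_discrete) (use assms zeros_def in blast)
  interpret U: uniformized "zero_ring a" "to_fract [:- a, 1:]" by (rule uniformized_zero_ring)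
  have e: "?e \<ge> 1" by (rule val_X[OF assms])
  have X0: "em [:- a, 1:] \<noteq> 0" unfolding em_eq_0 by simp
  have val: "valuation P (\<iota> z) = ?e * valuation (zero_place a) z" if "z \<noteq> 0" for z
  proof -
    obtain n p q where n: "poly p a \<noteq> 0" "poly q a \<noteq> 0" "has_order (zero_ring a) (to_fract [:- a, 1:]) n z"
      "z = to_fract [:- a, 1:] powi n * Fract p q" using zero_ring_decomposition[OF \<open>z \<noteq> 0\<close>, of a] by blast
    have powi: "\<iota> (w powi n) = \<iota> w powi n" for w
      by (simp add: power_int_def)
    have pq: "em p \<noteq> 0" "em q \<noteq> 0" using n by auto
    have "\<iota> z = em [:- a, 1:] powi n * (em p / em q)"
      unfolding n(4) iota.c_mult iota_Fract powi em_def[symmetric] ..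
    then have "valuation P (\<iota> z) = n * ?e"
      using pq X0 val_em_nonroot[OF assms n(1)] val_em_nonroot[OF assms n(2)]
      by (simp add: val_mult val_divide val_powi del: em_pCons)
    moreover have "valuation (zero_place a) z = n" using U.valuation_eq[OF n(3)] unfolding nonunits_zero_ring .
    ultimately show ?thesis by simp
  qed
  have t1: "valuation (zero_place a) (to_fract [:- a, 1:]) = 1"
    using U.valuation_eq[OF U.has_order_self[of 1]] unfolding nonunits_zero_ring by simp
  have "ram_index \<iota> (zero_place a) P = nat ?e"
    unfolding ram_index_def
  proof (rule the_equality)
    show "\<forall>z. z \<noteq> 0 \<longrightarrow> valuation P (\<iota> z) = int (nat ?e) * valuation (zero_place a) z" using val e by simp
    fix k assume "\<forall>z. z \<noteq> 0 \<longrightarrow> valuation P (\<iota> z) = int k * valuation (zero_place a) z"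
    then have "valuation P (\<iota> (to_fract [:- a, 1:])) = int k" using t1 U.t0 by (metis mult.right_neutral)
    then show "k = nat ?e" unfolding em_def by simp
  qed
  then show ?thesis using e by simp
qed

end

section \<open>Places that split completely\<close>

context superelliptic
begin

lemma embedding_ratfun_const: "embedding (ratfun_const :: 'q \<Rightarrow> 'q poly fract)"
  by unfold_locales
     (auto simp: field_embedding_def ratfun_const_def one_pCons[symmetric] simp flip: to_fract_add to_fract_mult)

lemma place_below_polynomial:
  fixes P :: "'q poly fract set"
  assumes "P \<in> places ratfun_const" "to_fract [:0, 1:] \<in> place_ring P"
  shows "\<exists>p. p \<noteq> 0 \<and> to_fract p \<in> P \<and>
    (\<forall>p'. p' \<noteq> 0 \<longrightarrow> degree p' < degree p \<longrightarrow> unit_in (place_ring P) (to_fract p'))"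
proof -
  interpret rf: embedding "ratfun_const :: 'q \<Rightarrow> 'q poly fract" by (rule embedding_ratfun_const)
  interpret total_ring "place_ring P" using rf.place_props[OF assms(1)] by simp
  note nP = rf.place_props(2)[OF assms(1)]
  have mem: "to_fract p \<in> place_ring P" for p
  proof (induction p)
    case (pCons b p)
    have "to_fract (pCons b p) = to_fract ([:b:] + [:0, 1:] * p)" by simp
    also have "\<dots> = ratfun_const b + to_fract [:0, 1:] * to_fract p"
      unfolding to_fract_add to_fract_mult ratfun_const_def ..
    also have "\<dots> \<in> place_ring P"
      using rf.place_props(3)[OF assms(1)] assms(2) pCons.IH by (intro add_mem mult_mem) auto
    finally show ?case .
  qed (simp add: zero_mem)
  have "\<exists>p. p \<noteq> 0 \<and> to_fract p \<in> P"
  proof (rule ccontr)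
    assume H: "\<not> ?thesis"
    have "z \<in> place_ring P" for z
    proof -
      obtain p q where z: "z = Fract p q" "q \<noteq> 0" by (cases z) auto
      then have "unit_in (place_ring P) (to_fract q)" using H mem[of q] unit_or_nonunit unfolding nP by blast
      then show ?thesis unfolding z(1) Fract_conv_to_fract divide_inverse
        by (intro mult_mem mem) (simp add: unit_in_def)
    qed
    then show False using rf.place_props(4)[OF assms(1)] by blast
  qed
  then obtain p0 where "p0 \<noteq> 0 \<and> to_fract p0 \<in> P" by blast
  then obtain p where p: "p \<noteq> 0 \<and> to_fract p \<in> P" "\<And>p'. p' \<noteq> 0 \<and> to_fract p' \<in> P \<Longrightarrow> degree p \<le> degree p'"
    using ex_has_least_nat[of "\<lambda>p. p \<noteq> 0 \<and> to_fract p \<in> P" p0 degree] by blast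
  have "unit_in (place_ring P) (to_fract p')" if p': "p' \<noteq> 0" "degree p' < degree p" for p'
  proof -
    have "to_fract p' \<notin> P" using p(2)[of p'] p' by auto
    then show ?thesis using unit_or_nonunit[OF mem[of p']] unfolding nP by blast
  qed
  then show ?thesis using p(1) by blast
qed

text \<open>
  The place at infinity has a single extension, so a completely split place is finite. A rational
  place above it provides a constant \<open>b\<close> with \<open>x = b\<close>, and this \<open>b\<close> is a root of the prime polynomial of the
  place below.
\<close>

lemma split_place_over_root:
  assumes P: "P \<in> places ratfun_const" "splits_completely ratfun_const \<iota> P"
    and S: "S \<in> places_over ratfun_const \<iota> P" "place_degree c S = 1"
  shows "\<exists>b. places_over ratfun_const \<iota> P = zeros [:- b, 1:]"
proof -
  interpret rf: embedding "ratfun_const :: 'q \<Rightarrow> 'q poly fract" by (rule embedding_ratfun_const)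
  interpret total_ring "place_ring P" using rf.place_props[OF P(1)] by simp
  note nP = rf.place_props(2)[OF P(1)]
  let ?PO = "places_over ratfun_const \<iota> P"
  have PO: "finite ?PO" "card ?PO = m" using P(2) by (auto simp: splits_completely_def ext_degree_eq)
  have over: "S' \<in> places c" "\<And>z. z \<in> P \<Longrightarrow> \<iota> z \<in> S'" if "S' \<in> ?PO" for S'
    using that by (auto simp: places_over_def c_def)
  have x_below: "to_fract [:0, 1:] \<in> place_ring P"
  proof (rule ccontr)
    assume "to_fract [:0, 1:] \<notin> place_ring P"
    then have i: "inverse (to_fract [:0, 1:]) \<in> P" using notin_imp_inverse unfolding nP by blast
    have "S' = Q0" if "S' \<in> ?PO" for S'
    proof (rule inf_unique)
      show "S' \<in> places c" using over that by blast
      have "inverse x \<in> S'" using over(2)[OF that i] by (simp add: x_def em_def)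
      then show "x \<notin> place_ring S'" using x_nonzero by (simp add: place_ring_def)
    qed
    then have "card ?PO \<le> card {Q0}" by (intro card_mono) auto
    then show False using PO m2 by simp
  qed
  obtain p where p: "p \<noteq> 0" "to_fract p \<in> P"
    "\<And>p'. p' \<noteq> 0 \<Longrightarrow> degree p' < degree p \<Longrightarrow> unit_in (place_ring P) (to_fract p')"
    using place_below_polynomial[OF P(1) x_below] by blast
  have Sc: "S \<in> places c" using over S by blast
  have pS: "em p \<in> S" unfolding em_def using over(2)[OF S(1) p(2)] .
  then have "S \<noteq> Q0" using zeros_props(2)[OF p(1), of S] Sc by (simp add: zeros_def)
  then obtain b where "x - c b \<in> S" using rational_residue[OF Sc S(2) x_regular[OF Sc]] by blast
  then have "em [:- b, 1:] \<in> S" by simp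
  then have "S \<in> zeros [:- b, 1:]" using Sc unfolding zeros_def by blast
  from em_in_place_iff[OF this, of p] have "poly p b = 0" using pS by blast
  then obtain p2 where p2: "p = [:- b, 1:] * p2" unfolding poly_eq_0_iff_dvd by (rule dvdE)
  then have p20: "p2 \<noteq> 0" using p(1) by auto
  have "degree p = degree [:- b, 1:] + degree p2" unfolding p2 by (rule degree_mult_eq) (use p20 in auto)
  then have u: "unit_in (place_ring P) (to_fract p2)" using p(3)[OF p20] by simp
  have "to_fract p * inverse (to_fract p2) \<in> P"
    using nonunits_mult[of "to_fract p" "inverse (to_fract p2)"] p(2) u unfolding nP unit_in_def by blast
  moreover have "to_fract p * inverse (to_fract p2) = to_fract [:- b, 1:]"
    unfolding p2 to_fract_mult using p20 by (simp add: mult.assoc)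
  ultimately have "to_fract [:- b, 1:] \<in> P" by simp
  then have sub: "?PO \<subseteq> zeros [:- b, 1:]" using over by (auto simp: zeros_def em_def simp del: em_pCons)
  have b0: "[:- b, 1:] \<noteq> 0" by simp
  have "card (zeros [:- b, 1:]) \<le> m"
    using zeros_subset_finite[OF b0 finite_zeros[OF b0] subset_refl] by simp
  then have "?PO = zeros [:- b, 1:]" using sub PO finite_zeros[OF b0] by (intro card_seteq) auto
  then show ?thesis by blast
qed

text \<open>
  The \<open>m\<close> zeros contribute at least \<open>1\<close> each to a sum that equals \<open>m\<close>.
\<close>

lemma valuation_split:
  assumes "card (zeros [:- b, 1:]) = m" "S \<in> zeros [:- b, 1:]"
  shows "valuation S (em [:- b, 1:]) = 1"
proof (rule ccontr)
  let ?Z = "zeros [:- b, 1:]" and ?h = "\<lambda>S. valuation S (em [:- b, 1:]) * int (place_degree c S)"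
  have b0: "[:- b, 1:] \<noteq> 0" by simp
  assume "valuation S (em [:- b, 1:]) \<noteq> 1"
  then have v: "valuation S (em [:- b, 1:]) > 1" using zeros_props(3)[OF b0 assms(2)] by linarith
  have ge: "valuation S' (em [:- b, 1:]) \<le> ?h S'" if "S' \<in> ?Z" for S'
  proof -
    have "valuation S' (em [:- b, 1:]) * 1 \<le> ?h S'"
      using zeros_props(1,3)[OF b0 that] degree_pos[of S'] by (intro mult_left_mono) auto
    then show ?thesis by (simp only: mult_1_right)
  qed
  have "(\<Sum>S'\<in>?Z. 1) < sum ?h ?Z"
  proof (rule sum_strict_mono_ex1)
    show "finite ?Z" by (rule finite_zeros[OF b0])
    show "\<forall>S'\<in>?Z. 1 \<le> ?h S'" using order_trans[OF zeros_props(3)[OF b0] ge] by blast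
    show "\<exists>S'\<in>?Z. 1 < ?h S'" using less_le_trans[OF v ge[OF assms(2)]] assms(2) by blast
  qed
  then show False using degree_zeros[OF b0] assms(1) by simp
qed

end

section \<open>Complementary pairs of evaluation codes\<close>

lemma card_code: "card C = CARD('k) ^ vec.dim C" if "vec.subspace C" for C :: "('k::{field,finite} ^ 'n::finite) set"
  using card_finite_subspace[OF vec.vector_space_axioms that] by simp

context superelliptic
begin

text \<open>
  If \<open>z \<in> L(G)\<close> and \<open>w \<in> L(H)\<close> have the same values, then \<open>(z - w) h\<close> belongs to \<open>L(E) = 0\<close>. So \<open>z = w\<close> lies in
  \<open>L(G) \<inter> L(H) \<subseteq> L(E) = 0\<close>. This shows that evaluation is injective on both spaces and that the two codes
  intersect trivially. Riemann's inequality bounds their dimensions from below by numbers that add up to the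
  length, so together they fill the whole space.
\<close>

lemma complementary_codes:
  fixes R :: "'n::finite \<Rightarrow> 'f set"
  assumes div: "divisor c E" "divisor c G" "divisor c H" and E0: "ell c E = 0"
    and R: "\<And>i. R i \<in> places c" "\<And>i. place_degree c (R i) = 1"
    and RE: "\<And>i. lookup E (R i) = 0" and RG: "\<And>i. lookup G (R i) = 0"
    and RH: "\<And>i. lookup H (R i) = 0"
    and meet: "\<And>P. P \<in> places c \<Longrightarrow> lookup G P \<le> lookup E P
                    \<or> lookup H P \<le> lookup E P"
    and h: "h \<noteq> 0" "\<And>i. valuation (R i) h \<ge> - 1"
      "\<And>P. P \<in> places c \<Longrightarrow> P \<notin> range R \<Longrightarrow> lookup G P \<le> lookup E P + valuation P h"
      "\<And>P. P \<in> places c \<Longrightarrow> P \<notin> range R \<Longrightarrow> lookup H P \<le> lookup E P + valuation P h"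
    and deg: "div_degree c G + 1 - genus c = k1" "div_degree c H + 1 - genus c = k2" "k1 + k2 = int CARD('n)"
  shows "linear_complementary_pair (AG_code c R G) (AG_code c R H)
    \<and> linear_code (AG_code c R G) CARD('n) k1 \<and> linear_code (AG_code c R H) CARD('n) k2"
proof -
  define evl where "evl z = (\<chi> i. place_value c (R i) z)" for z
  let ?CG = "evl ` RR_space c G" and ?CH = "evl ` RR_space c H"
  have code: "AG_code c R A = evl ` RR_space c A" for A
    by (auto simp: AG_code_def evl_def)
  have value_iff: "place_value c (R i) z = b \<longleftrightarrow> z - c b \<in> R i" if z: "z \<in> place_ring (R i)" for z i b
  proof -
    obtain b0 where b0: "z - c b0 \<in> R i" using rational_residue[OF R z] by blast
    then have "place_value c (R i) z = b0"
      unfolding place_value_def using place_residue_unique[OF R(1)] by (intro the_equality) blast+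
    then show ?thesis using b0 place_residue_unique[OF R(1)] by blast
  qed
  have mem: "z \<in> place_ring (R i)" if "z \<in> RR_space c A" "lookup A (R i) = 0" for z A i
  proof -
    interpret discrete_place "R i" by (rule place_discrete) (rule R)
    have "order_ge (R i) (- lookup A (R i)) z" using that(1) R(1) unfolding RR_space_order by blast
    then show ?thesis using that(2) by (simp add: order_ge_ring)
  qed
  have diff: "evl (z - w) = evl z - evl w"
    if "\<And>i. z \<in> place_ring (R i)" "\<And>i. w \<in> place_ring (R i)" for z w
  proof -
    have "place_value c (R i) (z - w) = place_value c (R i) z - place_value c (R i) w" for i
    proof -
      interpret discrete_place "R i" by (rule place_discrete) (rule R)
      have "z - c (place_value c (R i) z) \<in> R i" "w - c (place_value c (R i) w) \<in> R i"
        using value_iff that by blast+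
      then have "(z - c (place_value c (R i) z)) - (w - c (place_value c (R i) w)) \<in> R i"
        using nonunits_diff unfolding nonunits_place_ring by blast
      then have "(z - w) - c (place_value c (R i) z - place_value c (R i) w) \<in> R i"
        by (simp add: algebra_simps)
      then show ?thesis using value_iff[OF diff_mem[OF that(1)[of i] that(2)[of i]]] by blast
    qed
    then show ?thesis by (simp add: evl_def vec_eq_iff)
  qed
  have scale: "evl (c b * z) = b *s evl z" if "\<And>i. z \<in> place_ring (R i)" for z b
  proof -
    have "place_value c (R i) (c b * z) = b * place_value c (R i) z" for i
    proof -
      interpret discrete_place "R i" by (rule place_discrete) (rule R)
      have cb: "c b \<in> place_ring (R i)" using place_props(3)[OF R(1)[of i]] by blast
      have "z - c (place_value c (R i) z) \<in> R i" using value_iff that by blast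
      then have "(z - c (place_value c (R i) z)) * c b \<in> R i"
        using nonunits_mult[OF _ cb] unfolding nonunits_place_ring by blast
      then have "c b * z - c (b * place_value c (R i) z) \<in> R i" by (simp add: algebra_simps)
      then show ?thesis using value_iff[OF mult_mem[OF cb that[of i]]] by blast
    qed
    then show ?thesis by (simp add: evl_def vec_eq_iff)
  qed
  have fin: "finite (RR_space c E)" "finite (RR_space c G)" "finite (RR_space c H)"
    using finite_RR div by blast+
  have "card (RR_space c E) = 1" using card_RR[OF fin(1)] E0 by simp
  then have LE: "RR_space c E = {0}" using RR_zero[of E] card_1_singletonE by (metis singletonD)
  have inj: "z = 0 \<and> w = 0" if zw: "z \<in> RR_space c G" "w \<in> RR_space c H" "evl z = evl w" for z w
  proof -
    have "(z - w) * h \<in> RR_space c E"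
      unfolding RR_space_order
    proof (intro CollectI ballI)
      fix P assume P: "P \<in> places c"
      interpret discrete_place P by (rule place_discrete) fact
      have o: "order_ge P (- lookup G P) z" "order_ge P (- lookup H P) w"
        using zw P unfolding RR_space_order by blast+
      have "order_ge P (- lookup E P - valuation P h) (z - w)"
      proof (cases "P \<in> range R")
        case True
        then obtain i where i: "P = R i" by blast
        have zi: "z \<in> place_ring (R i)" "w \<in> place_ring (R i)" using mem zw RG RH by blast+
        have "place_value c (R i) z = place_value c (R i) w" using zw(3) by (simp add: evl_def vec_eq_iff)
        then obtain b where "z - c b \<in> R i" "w - c b \<in> R i" using value_iff zi by metis
        then have "(z - c b) - (w - c b) \<in> P" using nonunits_diff unfolding i nonunits_place_ring[unfolded i] by blast
        then have "order_ge P 1 (z - w)" by (simp add: order_ge_place)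
        then show ?thesis by (rule order_ge_mono) (use RE[of i] h(2)[of i] in \<open>simp add: i\<close>)
      next
        case False
        show ?thesis
          by (rule order_ge_diff; rule order_ge_mono[OF o(1)] order_ge_mono[OF o(2)])
             (use h(3,4)[OF P False] in linarith)+
      qed
      then show "order_ge P (- lookup E P) ((z - w) * h)" using order_ge_mult_iff[OF h(1)] by simp
    qed
    then have eq: "z = w" using LE h(1) by simp
    have "z \<in> RR_space c E"
      unfolding RR_space_order
    proof (intro CollectI ballI)
      fix P assume P: "P \<in> places c"
      interpret discrete_place P by (rule place_discrete) fact
      have o: "order_ge P (- lookup G P) z" "order_ge P (- lookup H P) z"
        using zw P eq unfolding RR_space_order by blast+
      from meet[OF P] show "order_ge P (- lookup E P) z"
      proof
        assume "lookup G P \<le> lookup E P"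
        then show ?thesis by (intro order_ge_mono[OF o(1)]) simp
      next
        assume "lookup H P \<le> lookup E P"
        then show ?thesis by (intro order_ge_mono[OF o(2)]) simp
      qed
    qed
    then show ?thesis using LE eq by simp
  qed
  have evl0: "evl 0 = 0" using diff[of 0 0] mem[OF RR_zero RG] by simp
  have sub: "vec.subspace (evl ` RR_space c A)" if A: "\<And>i. lookup A (R i) = 0" for A
  proof -
    have m: "z \<in> place_ring (R i)" if "z \<in> RR_space c A" for z i using mem that A by blast
    have sc: "b *s v \<in> evl ` RR_space c A" if "v \<in> evl ` RR_space c A" for b v
    proof -
      obtain z where z: "v = evl z" "z \<in> RR_space c A" using \<open>v \<in> _\<close> by (rule imageE)
      have "c b * z \<in> RR_space c A" using z(2) order_ge_const unfolding RR_space_order by blast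
      then show ?thesis using scale[of z b] m[OF z(2)] z(1) by (intro image_eqI[of _ _ "c b * z"]) simp_all
    qed
    have df: "v - v' \<in> evl ` RR_space c A" if "v \<in> evl ` RR_space c A" "v' \<in> evl ` RR_space c A" for v v'
    proof -
      obtain z where z: "v = evl z" "z \<in> RR_space c A" using \<open>v \<in> _\<close> by (rule imageE)
      obtain z' where z': "v' = evl z'" "z' \<in> RR_space c A" using \<open>v' \<in> _\<close> by (rule imageE)
      show ?thesis using diff[of z z'] m z z' RR_diff[OF z(2) z'(2)]
        by (intro image_eqI[of _ _ "z - z'"]) simp_all
    qed
    have zr: "0 \<in> evl ` RR_space c A" using RR_zero evl0 by (metis imageI)
    have "v + v' \<in> evl ` RR_space c A" if "v \<in> evl ` RR_space c A" "v' \<in> evl ` RR_space c A" for v v'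
      using df[OF that(1) df[OF zr that(2)]] by simp
    then show ?thesis using sc zr by (intro vec.subspaceI) auto
  qed
  note subG = sub[OF RG] and subH = sub[OF RH]
  have injG: "inj_on evl (RR_space c G)"
  proof (rule inj_onI)
    fix z z' assume z: "z \<in> RR_space c G" "z' \<in> RR_space c G" "evl z = evl z'"
    then have "evl (z - z') = evl 0" using diff[of z z'] mem RG evl0 by simp
    then show "z = z'" using inj[OF RR_diff[OF z(1,2)] RR_zero] by simp
  qed
  have injH: "inj_on evl (RR_space c H)"
  proof (rule inj_onI)
    fix z z' assume z: "z \<in> RR_space c H" "z' \<in> RR_space c H" "evl z = evl z'"
    then have "evl 0 = evl (z - z')" using diff[of z z'] mem RH evl0 by simp
    then show "z = z'" using inj[OF RR_zero RR_diff[OF z(1,2)]] by simp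
  qed
  have cardG: "card (?CG) = CARD('q) ^ ell c G" using card_image[OF injG] card_RR[OF fin(2)] by simp
  have cardH: "card (?CH) = CARD('q) ^ ell c H" using card_image[OF injH] card_RR[OF fin(3)] by simp
  have int: "?CG \<inter> ?CH = {0}"
  proof
    show "?CG \<inter> ?CH \<subseteq> {0}"
    proof
      fix v assume v: "v \<in> ?CG \<inter> ?CH"
      then obtain z w where "z \<in> RR_space c G" "v = evl z" "w \<in> RR_space c H" "v = evl w" by blast
      then show "v \<in> {0}" using inj[of z w] evl0 by simp
    qed
    show "{0} \<subseteq> ?CG \<inter> ?CH" using RR_zero evl0 by (metis IntI empty_subsetI imageI insert_subset)
  qed
  define add where "add = (\<lambda>(u::'q ^ 'n, v::'q ^ 'n). u + v)"
  have "inj_on add (?CG \<times> ?CH)"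
  proof (rule inj_onI)
    fix p p' assume H: "p \<in> ?CG \<times> ?CH"
      "p' \<in> ?CG \<times> ?CH" "add p = add p'"
    obtain u v u' v' where p: "p = (u, v)" "p' = (u', v')" by (cases p, cases p')
    have "u - u' = v' - v" using H(3) unfolding p add_def by (simp add: algebra_simps)
    moreover have "u - u' \<in> ?CG" "v' - v \<in> ?CH"
      using H p vec.subspace_diff[OF subG] vec.subspace_diff[OF subH] by auto
    ultimately have "u - u' \<in> ?CG \<inter> ?CH" by (simp only: Int_iff)
    then have "u - u' = 0" "v' - v = 0" using int \<open>u - u' = v' - v\<close> by simp_all
    then show "p = p'" by (simp add: p)
  qed
  then have card_add: "card (add ` (?CG \<times> ?CH)) = CARD('q) ^ (ell c G + ell c H)"
    by (simp add: card_image card_cartesian_product cardG cardH power_add)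
  then have "CARD('q) ^ (ell c G + ell c H) \<le> CARD('q) ^ CARD('n)"
    using card_mono[of UNIV "add ` (?CG \<times> ?CH)"] by simp
  then have "ell c G + ell c H \<le> CARD('n)" unfolding power_card_le_iff .
  moreover have "int (ell c G) \<ge> k1" "int (ell c H) \<ge> k2"
    using riemann_inequality[OF div(2)] riemann_inequality[OF div(3)] deg by simp_all
  ultimately have ell: "int (ell c G) = k1" "int (ell c H) = k2" using deg(3) by linarith+
  then have "ell c G + ell c H = CARD('n)" using deg(3) by linarith
  then have surj: "add ` (?CG \<times> ?CH) = UNIV"
    using card_add by (intro card_subset_eq) simp_all
  have "{u + v | u v. u \<in> ?CG \<and> v \<in> ?CH} = UNIV"
  proof (rule UNIV_eq_I[symmetric])
    fix v
    have "v \<in> add ` (?CG \<times> ?CH)" unfolding surj ..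
    then obtain p where p: "v = add p" "p \<in> ?CG \<times> ?CH" by (rule imageE)
    then have "v = fst p + snd p" "fst p \<in> ?CG" "snd p \<in> ?CH"
      by (simp_all only: add_def case_prod_beta mem_Times_iff)
    then show "v \<in> {u + v | u v. u \<in> ?CG \<and> v \<in> ?CH}" by blast
  qed
  then have lcp: "linear_complementary_pair (AG_code c R G) (AG_code c R H)"
    unfolding linear_complementary_pair_def code using subG subH int by blast
  have "CARD('q) ^ vec.dim (?CG) = CARD('q) ^ ell c G" using card_code[OF subG] cardG by simp
  then have dG: "vec.dim (?CG) = ell c G" unfolding power_card_eq_iff .
  have "CARD('q) ^ vec.dim (?CH) = CARD('q) ^ ell c H" using card_code[OF subH] cardH by simp
  then have dH: "vec.dim (?CH) = ell c H" unfolding power_card_eq_iff .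
  show ?thesis using lcp subG subH dG dH ell unfolding linear_code_def code by simp
qed

end

theorem theorem5p1:
  fixes \<iota> :: "'q::{field,finite} poly fract \<Rightarrow> 'f::field"
    and c :: "'q \<Rightarrow> 'f"
    and y :: 'f
    and m r n t N lam0 :: nat
    and a :: "nat \<Rightarrow> 'q"
    and lam :: "nat \<Rightarrow> nat"
    and Q :: "nat \<Rightarrow> 'f set"
    and P :: "nat \<Rightarrow> 'q poly fract set"
    and R :: "'n::finite \<Rightarrow> 'f set"
    and \<alpha> :: "nat \<Rightarrow> int"
    and s g :: int
    and D E G H :: "'f set \<Rightarrow>\<^sub>0 int"
  assumes "m \<ge> 2" and "r \<ge> 2"
    and "\<not> CHAR('q) dvd m"
    and "inj_on a {1..r}"
    and "\<And>k. k \<in> {1..r} \<Longrightarrow> 1 \<le> lam k \<and> lam k \<le> m - 1"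
    and "lam0 = (\<Sum>k=1..r. lam k)"
    and "coprime lam0 m"
    \<comment> \<open>the function field \<open>F = K(x, y)\<close> of the curve, as an extension of \<open>K(x)\<close>\<close>
    and "field_embedding \<iota>"
    and "c = \<iota> \<circ> ratfun_const"
    and "y ^ m = \<iota> (to_fract (\<Prod>k=1..r. [:- a k, 1:] ^ lam k))"
    and "is_subfield hull (insert y (range \<iota>)) = UNIV"
    and "g = genus c" and "g \<ge> 1"
    and "places_over ratfun_const \<iota> infinite_place = {Q 0}"
    and "2 \<le> n" and "n \<le> r"
    and "\<And>k. k \<in> {1..n} \<Longrightarrow> totally_ramified ratfun_const \<iota> (zero_place (a k))"
    and "\<And>k. k \<in> {1..n} \<Longrightarrow> places_over ratfun_const \<iota> (zero_place (a k)) = {Q k}"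
    and "inj_on P {1..t}"
    and "\<And>j. j \<in> {1..t} \<Longrightarrow> P j \<in> places ratfun_const \<and> place_degree ratfun_const (P j) = 1"
    and "\<And>j. j \<in> {1..t} \<Longrightarrow> splits_completely ratfun_const \<iota> (P j)"
    and "N = m * t" and "CARD('n) = N"
    and "bij_betw R UNIV
           {S. (\<exists>j\<in>{1..t}. S \<in> places_over ratfun_const \<iota> (P j)) \<and> place_degree c S = 1}"
    and "D = (\<Sum>i\<in>UNIV. frag_of (R i))"
    and "E = (\<Sum>k=0..n. frag_cmul (\<alpha> k) (frag_of (Q k)))"
    and "non_special c E" and "div_degree c E = g - 1"
    and "real_of_int (g - 1) / real lam0 < real_of_int s"
    and "real_of_int s < real_of_int (int N + 1 - g) / real lam0"
    and "G = (\<Sum>k=1..n. frag_cmul (\<alpha> k) (frag_of (Q k)))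
             + frag_cmul (\<alpha> 0 + int N - s * int lam0) (frag_of (Q 0))"
    and "H = (\<Sum>k=1..n. frag_cmul (s * int (lam k) + \<alpha> k) (frag_of (Q k)))
             + frag_cmul (\<alpha> 0) (frag_of (Q 0))
             + (\<Sum>k=n+1..r. frag_cmul (s * int (lam k) div int (gcd m (lam k)))
                  (\<Sum>S\<in>places_over ratfun_const \<iota> (zero_place (a k)). frag_of S))"
  shows "Poly_Mapping.keys D \<inter> Poly_Mapping.keys G = {}
    \<and> Poly_Mapping.keys D \<inter> Poly_Mapping.keys H = {}
    \<and> linear_complementary_pair (AG_code c R G) (AG_code c R H)
    \<and> linear_code (AG_code c R G) N (int N - s * int lam0)
    \<and> linear_code (AG_code c R H) N (s * int lam0)"
proof -
  define f where "f = (\<Prod>k=1..r. [:- a k, 1:] ^ lam k)"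
  have deg_f: "degree f = lam0"
    unfolding f_def assms(6) by (subst degree_prod_eq_sum_degree) (auto simp: degree_power_eq)
  interpret superelliptic \<iota> c y m f "Q 0"
    by unfold_locales (use assms(1,7,8,9,10,11,14) deg_f in \<open>simp_all only: f_def\<close>)
  let ?X = "\<lambda>k. [:- a k, 1:]"
  have m_char: "(of_nat m :: 'q) \<noteq> 0" using assms(3) by (simp add: of_nat_eq_0_iff_char_dvd)
  have lam0: "lam0 > 0" using degree_f_pos deg_f by simp
  have div_E: "divisor c E" and ell_E: "ell c E = 0"
    using assms(12,27,28) by (auto simp: non_special_def)
  have s_lo: "s * int lam0 > g - 1" and s_hi: "int N - s * int lam0 > g - 1"
  proof -
    have "real_of_int (g - 1) < real_of_int s * real lam0" using assms(29) lam0 by (simp add: pos_divide_less_eq)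
    then have "real_of_int (g - 1) < real_of_int (s * int lam0)" by simp
    then show "s * int lam0 > g - 1" unfolding of_int_less_iff .
    have "real_of_int s * real lam0 < real_of_int (int N + 1 - g)" using assms(30) lam0 by (simp add: pos_less_divide_eq)
    then have "real_of_int (s * int lam0) < real_of_int (int N + 1 - g)" by simp
    then have "s * int lam0 < int N + 1 - g" unfolding of_int_less_iff .
    then show "int N - s * int lam0 > g - 1" by simp
  qed
  have s_pos: "s > 0" using s_lo assms(13) lam0  proof -
    have "0 < s * int lam0" using s_lo assms(13) by linarith
    then show ?thesis using lam0 by (simp add: zero_less_mult_iff)
  qed

  have f_split: "\<exists>g. f = ?X k ^ lam k * g \<and> poly g (a k) \<noteq> 0" if k: "k \<in> {1..r}" for k
  proof (intro exI conjI)
    show "f = ?X k ^ lam k * (\<Prod>i\<in>{1..r} - {k}. ?X i ^ lam i)"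
      unfolding f_def using k by (intro prod.remove) auto
    show "poly (\<Prod>i\<in>{1..r} - {k}. ?X i ^ lam i) (a k) \<noteq> 0"
    proof -
      have "poly (?X i ^ lam i) (a k) \<noteq> 0" if "i \<in> {1..r} - {k}" for i
      proof -
        have "a k \<noteq> a i" using inj_onD[OF assms(4), of k i] k that by blast
        then show ?thesis by (simp add: poly_power)
      qed
      then show ?thesis unfolding poly_prod prod_zero_iff[OF finite_Diff[OF finite_atLeastAtMost]] by blast
    qed
  qed
  define l where "l k = lam k div gcd m (lam k)" for k
  have val_Xk: "valuation S (em (?X k)) = int (m div gcd m (lam k))" and val_yk: "valuation S y = int (l k)"
    if "k \<in> {1..r}" "S \<in> zeros (?X k)" for k S
  proof -
    from f_split[OF that(1)] obtain g where g: "f = ?X k ^ lam k * g" "poly g (a k) \<noteq> 0" by blast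
    show "valuation S (em (?X k)) = int (m div gcd m (lam k))" "valuation S y = int (l k)"
      unfolding l_def by (rule kummer_valuations[OF that(2) g m_char])+
  qed
  have sum_degk: "(\<Sum>S\<in>zeros (?X k). place_degree c S) = gcd m (lam k)" if "k \<in> {1..r}" for k
  proof -
    from f_split[OF that] obtain g where g: "f = ?X k ^ lam k * g" "poly g (a k) \<noteq> 0" by blast
    show ?thesis by (rule sum_degree_over_zero[OF g m_char])
  qed
  have l_gcd: "lam k = l k * gcd m (lam k)" for k unfolding l_def by simp
  have Xne: "?X k \<noteq> 0" for k by simp
  have zeros_disjoint: "b = b'" if "S \<in> zeros [:- b, 1:]" "S \<in> zeros [:- b', 1:]" for S and b b' :: 'q
  proof -
    have "em [:- b', 1:] \<in> S" using that(2) unfolding zeros_def by blast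
    then have "poly [:- b', 1:] b = 0" unfolding em_in_place_iff[OF that(1)] .
    then show ?thesis by simp
  qed
  have Q_zeros: "zeros (?X k) = {Q k}" if "k \<in> {1..n}" for k
    using assms(18)[OF that] unfolding places_over_zero_place .
  have gcd1: "gcd m (lam k) = 1" if k: "k \<in> {1..n}" for k
  proof -
    have k': "k \<in> {1..r}" using k assms(16) by auto
    obtain S where S: "S \<in> places_over ratfun_const \<iota> (zero_place (a k))" "ram_index \<iota> (zero_place (a k)) S = m"
      using assms(17)[OF k] unfolding totally_ramified_def ext_degree_eq by blast
    then have SZ: "S \<in> zeros (?X k)" unfolding places_over_zero_place by blast
    have "int m = int (m div gcd m (lam k))"
      using ram_index_zero_place[OF SZ] val_Xk[OF k' SZ] S(2) by simp
    then have "m div gcd m (lam k) = m" by simp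
    then show ?thesis using m_pos by (metis div_eq_dividend_iff)
  qed

  (* T is the divisor of zeros of y^s: at a zero of x - a k the function y has order l k. *)
  define T where "T = (\<Sum>k=1..r. frag_cmul (s * int (l k)) (\<Sum>S\<in>zeros (?X k). frag_of S))"
  have div_T: "divisor c T"
    unfolding T_def by (intro divisor_sum divisor_cmul divisor_of zeros_props(1)[OF Xne])
  have deg_T: "div_degree c T = s * int lam0"
  proof -
    have "div_degree c T = (\<Sum>k=1..r. s * int (l k) * int (\<Sum>P\<in>zeros (?X k). place_degree c P))"
      unfolding T_def by (simp add: div_degree_sum div_degree_cmul div_degree_of)
    also have "\<dots> = (\<Sum>k=1..r. s * int (lam k))"
    proof (rule sum.cong)
      fix k assume "k \<in> {1..r}"
      then show "s * int (l k) * int (\<Sum>P\<in>zeros (?X k). place_degree c P) = s * int (lam k)"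
        unfolding sum_degk[OF \<open>k \<in> {1..r}\<close>] using arg_cong[OF l_gcd[of k], of int] by simp
    qed simp
    finally show ?thesis unfolding assms(6) by (simp add: sum_distrib_left)
  qed
  have lookup_T: "lookup T S = (\<Sum>k=1..r. if S \<in> zeros (?X k) then s * int (l k) else 0)" for S
  proof -
    have "lookup (\<Sum>S\<in>zeros (?X k). frag_of S) S = (if S \<in> zeros (?X k) then 1 else 0)" for k
    proof -
      have "lookup (\<Sum>S\<in>zeros (?X k). frag_of S) S = (\<Sum>S'\<in>zeros (?X k). if S' = S then 1 else 0)"
        unfolding lookup_sum by (intro sum.cong) auto
      then show ?thesis using finite_zeros[OF Xne, of k] by simp
    qed
    then show ?thesis unfolding T_def lookup_sum lookup_frag_cmul by (intro sum.cong) auto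
  qed
  have lookup_T_zero: "lookup T S = s * int (l k)" if k: "k \<in> {1..r}" "S \<in> zeros (?X k)" for k S
  proof -
    have "S \<in> zeros (?X k') \<longleftrightarrow> k' = k" if "k' \<in> {1..r}" for k'
      using zeros_disjoint[of S "a k'" "a k"] k assms(4) that unfolding inj_on_def by blast
    then have "lookup T S = (\<Sum>k'=1..r. if k' = k then s * int (l k) else 0)"
      unfolding lookup_T by (intro sum.cong) auto
    then show ?thesis using k by simp
  qed
  have val_y_other: "valuation S y = 0" if S: "S \<in> places c" "S \<noteq> Q 0" "\<And>k. k \<in> {1..r} \<Longrightarrow> S \<notin> zeros (?X k)" for S
  proof -
    interpret discrete_place S by (rule place_discrete) fact
    have "valuation S (em (?X k)) = 0" if "k \<in> {1..r}" for k
    proof -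
      have "em (?X k) \<notin> S" using S(1) S(3)[OF that] unfolding zeros_def by blast
      moreover have "em (?X k) \<noteq> 0" unfolding em_eq_0 by simp
      ultimately have "\<not> valuation S (em (?X k)) > 0" using val_place by blast
      then show ?thesis using val_em_nonneg[OF S(1,2) Xne, of k] by linarith
    qed
    then have "valuation S (em f) = 0"
      unfolding f_def em_prod em_power using Xne
      by (subst val_prod) (auto simp: val_power simp del: em_pCons)
    then show ?thesis using val_power[OF y_nonzero, of m] y_power_em m_pos by simp
  qed
  have T_y: "lookup T S = s * valuation S y" if S: "S \<in> places c" "S \<noteq> Q 0" for S
  proof (cases "\<exists>k\<in>{1..r}. S \<in> zeros (?X k)")
    case True
    then show ?thesis using lookup_T_zero val_yk by auto
  next
    case False
    then have "lookup T S = 0" unfolding lookup_T by (intro sum.neutral) auto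
    then show ?thesis using val_y_other[OF S] False by auto
  qed
  have T_Q0: "lookup T (Q 0) = 0"
    unfolding lookup_T using zeros_props(2)[OF Xne] by (intro sum.neutral) auto
  have val_y_nonneg: "valuation S y \<ge> 0" if S: "S \<in> places c" "S \<noteq> Q 0" for S
    using val_yk val_y_other[OF S] by (cases "\<exists>k\<in>{1..r}. S \<in> zeros (?X k)") auto

  have E_split: "E = frag_cmul (\<alpha> 0) (frag_of (Q 0)) + (\<Sum>k=1..n. frag_cmul (\<alpha> k) (frag_of (Q k)))"
    unfolding assms(26) by (simp add: sum.atLeast_Suc_atMost)
  have G_E: "G = E + frag_cmul (int N - s * int lam0) (frag_of (Q 0))"
    unfolding assms(31) E_split by (simp add: frag_cmul_distrib frag_cmul_diff_distrib algebra_simps)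
  (* For k <= n the place is totally ramified, so gcd(m, lam k) = 1 and l k = lam k. *)
  have H_E: "H = E + T"
  proof -
    have "{1..r} = {1..n} \<union> {n + 1..r}" "{1..n} \<inter> {n + 1..r} = {}" using assms(16) by auto
    then have "T = (\<Sum>k=1..n. frag_cmul (s * int (l k)) (\<Sum>S\<in>zeros (?X k). frag_of S))
        + (\<Sum>k=n+1..r. frag_cmul (s * int (l k)) (\<Sum>S\<in>zeros (?X k). frag_of S))"
      unfolding T_def by (simp add: sum.union_disjoint)
    also have "(\<Sum>k=1..n. frag_cmul (s * int (l k)) (\<Sum>S\<in>zeros (?X k). frag_of S))
        = (\<Sum>k=1..n. frag_cmul (s * int (lam k)) (frag_of (Q k)))"
    proof (rule sum.cong)
      fix k assume "k \<in> {1..n}"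
      then show "frag_cmul (s * int (l k)) (\<Sum>S\<in>zeros (?X k). frag_of S) = frag_cmul (s * int (lam k)) (frag_of (Q k))"
        using Q_zeros gcd1 by (simp add: l_def)
    qed simp
    also have "(\<Sum>k=n+1..r. frag_cmul (s * int (l k)) (\<Sum>S\<in>zeros (?X k). frag_of S))
        = (\<Sum>k=n+1..r. frag_cmul (s * int (lam k) div int (gcd m (lam k)))
                  (\<Sum>S\<in>places_over ratfun_const \<iota> (zero_place (a k)). frag_of S))"
    proof (rule sum.cong)
      fix k
      have "s * int (lam k) div int (gcd m (lam k)) = s * int (l k)"
        unfolding l_def zdiv_int by (intro div_mult_swap[symmetric]) simp
      then show "frag_cmul (s * int (l k)) (\<Sum>S\<in>zeros (?X k). frag_of S)
        = frag_cmul (s * int (lam k) div int (gcd m (lam k)))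
                  (\<Sum>S\<in>places_over ratfun_const \<iota> (zero_place (a k)). frag_of S)"
        unfolding places_over_zero_place by simp
    qed simp
    finally have "E + T = E + ((\<Sum>k=1..n. frag_cmul (s * int (lam k)) (frag_of (Q k))) +
        (\<Sum>k=n+1..r. frag_cmul (s * int (lam k) div int (gcd m (lam k)))
                  (\<Sum>S\<in>places_over ratfun_const \<iota> (zero_place (a k)). frag_of S)))" by (rule arg_cong)
    then show ?thesis unfolding assms(32) E_split by (simp add: frag_cmul_distrib sum.distrib add_ac)
  qed

  (* At most m t places lie over the P j, and R enumerates m t of them, so all are rational.
     Hence P j is the place x = b j for some constant b j. *)
  define U where "U = (\<Union>j\<in>{1..t}. places_over ratfun_const \<iota> (P j))"
  have PO: "finite (places_over ratfun_const \<iota> (P j))" "card (places_over ratfun_const \<iota> (P j)) = m" if "j \<in> {1..t}" for j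
    using assms(21)[OF that] by (auto simp: splits_completely_def ext_degree_eq)
  have range_R: "range R = {S. (\<exists>j\<in>{1..t}. S \<in> places_over ratfun_const \<iota> (P j)) \<and> place_degree c S = 1}"
    using assms(24) unfolding bij_betw_def by (rule conjunct2)
  have inj_R: "inj R" using assms(24) by (rule bij_betw_imp_inj_on)
  have card_R: "card (range R) = m * t" using card_image[OF inj_R] assms(22,23) by simp
  have "card U \<le> (\<Sum>j\<in>{1..t}. card (places_over ratfun_const \<iota> (P j)))"
    unfolding U_def by (intro card_UN_le) simp
  also have "\<dots> = m * t" using PO(2) by simp
  finally have card_U: "card U \<le> m * t" .
  have finU: "finite U" unfolding U_def using PO(1) by auto
  have "range R \<subseteq> U" unfolding range_R U_def by blast
  then have RU: "range R = U" using finU card_U card_R by (intro card_seteq) auto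
  have R_deg: "place_degree c (R i) = 1" for i
    using range_R rangeI[of R i] by blast
  have "\<exists>b. places_over ratfun_const \<iota> (P j) = zeros [:- b, 1:]" if j: "j \<in> {1..t}" for j
  proof -
    obtain S where S: "S \<in> places_over ratfun_const \<iota> (P j)" using PO(2)[OF j] m_pos by fastforce
    then have "S \<in> range R" unfolding RU U_def using j by blast
    then have "place_degree c S = 1" using R_deg by blast
    then show ?thesis using split_place_over_root[OF _ assms(21)[OF j] S] assms(20)[OF j] by blast
  qed
  then obtain b where b: "\<And>j. j \<in> {1..t} \<Longrightarrow> places_over ratfun_const \<iota> (P j) = zeros [:- b j, 1:]" by metis
  have RZ: "range R = (\<Union>j\<in>{1..t}. zeros [:- b j, 1:])" unfolding RU U_def using b by simp
  have card_zeros_b: "card (zeros [:- b j, 1:]) = m" if "j \<in> {1..t}" for j using PO(2)[OF that] b[OF that] by simp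
  have b_inj: "inj_on b {1..t}"
  proof (rule eq_card_imp_inj_on)
    have "range R = (\<Union>\<beta>\<in>b ` {1..t}. zeros [:- \<beta>, 1:])" unfolding RZ by blast
    then have "m * t \<le> (\<Sum>\<beta>\<in>b ` {1..t}. card (zeros [:- \<beta>, 1:]))"
      using card_R card_UN_le[of "b ` {1..t}" "\<lambda>\<beta>. zeros [:- \<beta>, 1:]"] by simp
    also have "\<dots> = (\<Sum>\<beta>\<in>b ` {1..t}. m)" using card_zeros_b by (intro sum.cong) auto
    finally have "t \<le> card (b ` {1..t})" using m_pos by (simp add: mult.commute)
    moreover have "card (b ` {1..t}) \<le> card {1..t}" by (rule card_image_le) simp
    ultimately show "card (b ` {1..t}) = card {1..t}" by simp
  qed simp
  have R_place: "R i \<in> places c" and R_Q0: "R i \<noteq> Q 0" for i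
  proof -
    obtain j where "R i \<in> zeros [:- b j, 1:]" using RZ by blast
    then show "R i \<in> places c" "R i \<noteq> Q 0" using zeros_props(1,2)[of "[:- b j, 1:]" "R i"] by simp_all
  qed
  (* A completely split place is unramified, whereas e = m / gcd(m, lam k) > 1 over the roots of f. *)
  have R_zeros: "R i \<notin> zeros (?X k)" if k: "k \<in> {1..r}" for i k
  proof
    assume H: "R i \<in> zeros (?X k)"
    obtain j where j: "j \<in> {1..t}" "R i \<in> zeros [:- b j, 1:]" using RZ by blast
    have "a k = b j" using zeros_disjoint[OF H j(2)] .
    then have "valuation (R i) (em (?X k)) = 1" using valuation_split[OF card_zeros_b[OF j(1)] j(2)] by simp
    then have "m div gcd m (lam k) = 1" using val_Xk[OF k H] by simp
    then have "m = gcd m (lam k)" by (metis dvd_mult_div_cancel gcd_dvd1 mult.right_neutral)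
    then have "m dvd lam k" by (metis gcd_dvd2)
    then show False using assms(5)[OF k] m_pos by (auto dest: dvd_imp_le)
  qed
  have E_R: "lookup E (R i) = 0" for i
  proof -
    have "R i \<noteq> Q k" if "k \<in> {1..n}" for k
      using R_zeros[of k i] Q_zeros[OF that] that assms(16) by auto
    then have "R i \<noteq> Q k" if "k \<in> {0..n}" for k
    proof (cases "k = 0")
      case True
      then show ?thesis using R_Q0[of i] by (simp only: not_False_eq_True)
    next
      case False
      then have "k \<in> {1..n}" using that by simp
      then show ?thesis by (rule \<open>\<And>k. k \<in> {1..n} \<Longrightarrow> R i \<noteq> Q k\<close>)
    qed
    then show ?thesis unfolding assms(26) lookup_sum by (intro sum.neutral) auto
  qed
  have T_R: "lookup T (R i) = 0" for i
    unfolding lookup_T using R_zeros by (intro sum.neutral) auto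
  have G_R: "lookup G (R i) = 0" for i unfolding G_E using E_R R_Q0[of i] by (simp add: lookup_add)
  have H_R: "lookup H (R i) = 0" for i unfolding H_E using E_R T_R by (simp add: lookup_add)

  (* The divisor of h is T - s lam0 Q0 - D + N Q0, so E + div h is the maximum of G and H minus D. *)
  define w where "w = (\<Prod>j=1..t. [:- b j, 1:])"
  define h where "h = y powi s / em w"
  have w0: "w \<noteq> 0" by (simp add: w_def)
  have deg_w: "degree w = t" unfolding w_def by (subst degree_prod_eq_sum_degree) auto
  have h0: "h \<noteq> 0" using y_nonzero w0 by (simp add: h_def)
  have val_h: "valuation S h = s * valuation S y - valuation S (em w)" if "S \<in> places c" for S
  proof -
    interpret discrete_place S by (rule place_discrete) fact
    show ?thesis using y_nonzero w0 by (simp add: h_def val_divide val_powi)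
  qed
  have val_w: "valuation S (em w) = (\<Sum>j=1..t. valuation S (em [:- b j, 1:]))" if "S \<in> places c" for S
  proof -
    interpret discrete_place S by (rule place_discrete) fact
    show ?thesis unfolding w_def em_prod by (rule val_prod) (simp_all del: em_pCons)
  qed
  have val_b0: "valuation S (em [:- \<beta>, 1:]) = 0" if "S \<in> places c" "S \<noteq> Q 0" "S \<notin> zeros [:- \<beta>, 1:]" for S \<beta>
  proof -
    interpret discrete_place S by (rule place_discrete) fact
    have "em [:- \<beta>, 1:] \<notin> S" using that unfolding zeros_def by blast
    moreover have "em [:- \<beta>, 1:] \<noteq> 0" unfolding em_eq_0 by simp
    ultimately have "\<not> valuation S (em [:- \<beta>, 1:]) > 0" using val_place by blast
    moreover have "valuation S (em [:- \<beta>, 1:]) \<ge> 0" by (rule val_em_nonneg[OF that(1,2)]) simp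
    ultimately show ?thesis by linarith
  qed
  have val_h_Q0: "valuation (Q 0) h = int N - s * int lam0"
    using val_h[OF Q0_place] Q0_val_y Q0_val_em[OF w0] deg_f deg_w assms(22) by simp
  have val_h_other: "valuation S h = s * valuation S y" if S: "S \<in> places c" "S \<noteq> Q 0" "S \<notin> range R" for S
  proof -
    have "valuation S (em w) = 0" unfolding val_w[OF S(1)]
      using S(3) by (intro sum.neutral ballI val_b0[OF S(1,2)]) (auto simp: RZ)
    then show ?thesis using val_h[OF S(1)] by simp
  qed
  have val_h_R: "valuation (R i) h = - 1" for i
  proof -
    obtain j where j: "j \<in> {1..t}" "R i \<in> zeros [:- b j, 1:]" using RZ by blast
    have "valuation (R i) (em [:- b j', 1:]) = (if j' = j then 1 else 0)" if j': "j' \<in> {1..t}" for j'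
    proof (cases "j' = j")
      case True
      then show ?thesis using valuation_split[OF card_zeros_b[OF j(1)] j(2)] by simp
    next
      case False
      then have "b j' \<noteq> b j" using inj_onD[OF b_inj _ j' j(1)] by blast
      then have "R i \<notin> zeros [:- b j', 1:]" using zeros_disjoint[OF j(2)] by metis
      then show ?thesis using val_b0[OF R_place R_Q0] False by simp
    qed
    then have "valuation (R i) (em w) = (\<Sum>j'=1..t. if j' = j then 1 else 0)"
      unfolding val_w[OF R_place] by (intro sum.cong) auto
    then have "valuation (R i) (em w) = 1" using j by simp
    moreover have "valuation (R i) y = 0" using val_y_other[OF R_place R_Q0] R_zeros by blast
    ultimately show ?thesis using val_h[OF R_place] by simp
  qed

  have div_G: "divisor c G" unfolding G_E by (intro divisor_add div_E divisor_cmul divisor_of Q0_place)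
  have div_H: "divisor c H" unfolding H_E by (intro divisor_add div_E div_T)
  have N_nonneg: "int N - s * int lam0 \<ge> 0" using s_hi assms(13) by linarith
  have "linear_complementary_pair (AG_code c R G) (AG_code c R H)
    \<and> linear_code (AG_code c R G) CARD('n) (int N - s * int lam0)
    \<and> linear_code (AG_code c R H) CARD('n) (s * int lam0)"
  proof (rule complementary_codes[OF div_E div_G div_H ell_E R_place R_deg E_R G_R H_R _ h0])
    fix S assume S: "S \<in> places c"
    show "lookup G S \<le> lookup E S \<or> lookup H S \<le> lookup E S"
      unfolding G_E H_E lookup_add using T_Q0 by (cases "S = Q 0") auto
    assume SR: "S \<notin> range R"
    show "lookup G S \<le> lookup E S + valuation S h"
    proof (cases "S = Q 0")
      case False
      have "s * valuation S y \<ge> 0" using s_pos val_y_nonneg[OF S False] by simp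
      then show ?thesis unfolding G_E lookup_add using val_h_other[OF S False SR] False by simp
    qed (simp add: G_E lookup_add val_h_Q0)
    show "lookup H S \<le> lookup E S + valuation S h"
    proof (cases "S = Q 0")
      case False
      then show ?thesis unfolding H_E lookup_add using val_h_other[OF S False SR] T_y[OF S False] by simp
    qed (use N_nonneg in \<open>simp add: H_E lookup_add val_h_Q0 T_Q0\<close>)
  next
    show "valuation (R i) h \<ge> - 1" for i using val_h_R by simp
    show "div_degree c G + 1 - genus c = int N - s * int lam0"
      unfolding G_E div_degree_add div_degree_cmul div_degree_of degree_Q0 using assms(12,28) by simp
    show "div_degree c H + 1 - genus c = s * int lam0"
      unfolding H_E div_degree_add deg_T using assms(12,28) by simp
    show "int N - s * int lam0 + s * int lam0 = int CARD('n)" using assms(23) by simp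
  qed
  moreover have "Poly_Mapping.keys D \<subseteq> range R"
  proof
    fix S assume "S \<in> Poly_Mapping.keys D"
    then have "lookup D S \<noteq> 0" by (simp add: in_keys_iff)
    then have ne: "(\<Sum>i\<in>UNIV. if S = R i then 1 else 0 :: int) \<noteq> 0" unfolding assms(25) lookup_sum by simp
    show "S \<in> range R"
    proof (rule ccontr)
      assume "S \<notin> range R"
      then have "(\<Sum>i\<in>UNIV. if S = R i then 1 else 0 :: int) = 0" by (intro sum.neutral) auto
      then show False using ne by simp
    qed
  qed
  moreover have "R i \<notin> Poly_Mapping.keys G" "R i \<notin> Poly_Mapping.keys H" for i
    using G_R H_R by (simp_all add: in_keys_iff)
  ultimately show ?thesis using assms(23) by auto
qed

end
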